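(* Let $X$ be a Banach space. Then $X$ has asymptotic basic subtype if and only if there exists $1<p<\infty$ such that $X$ has asymptotic basic type $p$. The analogous results hold for the other properties: $X$ has asymptotic basic subcotype iff it has asymptotic basic cotype $q$ for some $1<q<\infty$; $X$ has asymptotic subtype iff it has asymptotic type $p$ for some $1<p<\infty$; $X$ has asymptotic subcotype iff it has asymptotic cotype $q$ for some $1<q<\infty$; and the same four equivalences hold with each property replaced by its weak$^*$ counterpart (weak$^*$ asymptotic basic subtype / basic type $p$, basic subcotype / basic cotype $q$, subtype / type $p$, subcotype / cotype $q$).
   Context: Fix $\mathbb K\in\{\mathbb R,\mathbb C\}$. Banach spaces are over $\mathbb K$, $(e_i)_{i=1}^n$ is the canonical basis of $\mathbb K^n$, $(\varepsilon_i)$ are independent uniform $\pm1$ (Rademacher) random variables, and $L_p$-norms are taken with respect to these signs. Trees: for a directed set $D$ put $D^{\le n}=\bigcup_{i=0}^n D^i$; for $t\in D^n$, $t|_i$ is the initial segment of $t$ of length $i$; $t\frown(u)$ is concatenation. A tree $(x_t)_{t\in D^{\le n}\setminus\{\varnothing\}}$ in $X$ is normalized if $\|x_t\|=1$ for all $t$, and weakly null if for every $t\in D^{\le n-1}$ the net $(x_{t\frown(u)})_{u\in D}$ is weakly null. A tree in $X^*$ is weak$^*$-null if for every $t\in D^{\le n-1}$ the net $(x^*_{t\frown(u)})_{u\in D}$ is weak$^*$-null. Asymptotic structures: for $n\in\mathbb N$, $\{X\}_n=\varnothing$ if $\dim X<\infty$; otherwise $\{X\}_n$ is the set of all norms $r$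 on $\mathbb K^n$ such that $r(e_i)=1$ for all $i$, $r(\sum_{i=1}^m a_ie_i)\le r(\sum_{i=1}^n a_ie_i)$ for all $m\le n$ and all scalars, and for every $\delta>0$ there exist a directed set $D$ and a normalized weakly null tree $(x_t)_{t\in D^{\le n}\setminus\{\varnothing\}}\subset X$ with $\bigl|\|\sum_i a_ix_{t|_i}\|-r(\sum_i a_ie_i)\bigr|<\delta$ for all $t\in D^n$ and all scalars with $\max_i|a_i|\le1$. (This is the asymptotic structure of the operator $\mathrm{Id}_X$.) $\{X\}^*_n$ is defined in the same way using normalized weak$^*$-null trees in $X^*$. Quantities: $\alpha_{p,n}(X)$, $\tau_{p,n}(X)$ are the infima of $T>0$ such that for all $r\in\{X\}_n$ and scalars $(a_i)_{i=1}^n$: $r(\sum_i a_ie_i)\le T\|(a_i)\|_{\ell_p^n}$, resp. $\|r(\sum_i\varepsilon_ia_ie_i)\|_{L_p}\le T\|(a_i)\|_{\ell_p^n}$. $\beta_{q,n}(X)$, $\gamma_{q,n}(X)$ are the infima of $C>0$ such that for all such $r$ and scalars: $C\,r(\sum_i a_ie_i)\ge\|(a_i)\|_{\ell_q^n}$, resp. $C\|r(\sum_i\varepsilon_ia_ie_i)\|_{L_q}\ge\|(a_i)\|_{\ell_q^n}$. $\theta_n(X)$, $\Theta_n(X)$ are the infima of $T>0$ such that always $r(\frac1n\sum_i a_ie_i)\le T\max_i|a_i|$, resp. $\|r(\frac1n\sum_i\varepsilon_ia_ie_i)\|_{L_1}\le T\max_i|a_i|$. $\upsilon_n(X)$, $\Upsilon_n(X)$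 are the infima of $C>0$ such that always $C\,r(\sum_i a_ie_i)\ge\min_i|a_i|$, resp. $C\|r(\sum_i\varepsilon_ia_ie_i)\|_{L_1}\ge\min_i|a_i|$. Weak$^*$ versions use $\{X\}_n^*$. $X$ has asymptotic basic type $p$, type $p$, basic cotype $q$, cotype $q$ if respectively $\sup_n\alpha_{p,n}(X)$, $\sup_n\tau_{p,n}(X)$, $\sup_n\beta_{q,n}(X)$, $\sup_n\gamma_{q,n}(X)$ is finite. $X$ has asymptotic basic subtype, subtype, basic subcotype, subcotype if respectively $\theta_n(X)$, $\Theta_n(X)$, $\upsilon_n(X)$, $\Upsilon_n(X)$ tends to $0$ as $n\to\infty$. The weak$^*$ properties are defined by the same conditions on the weak$^*$ versions of these quantities. *)

theory Defs
  imports "HOL-Probability.Probability"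
begin

section \<open>Banach spaces over the real or complex field\<close>

text \<open>
  The class contains exactly the real and the complex field with their usual absolute values, up to
  isometric isomorphism.
\<close>

class real_or_complex = real_normed_field +
  assumes real_or_complex:
    "(\<forall>z. \<exists>a. z = a *\<^sub>R 1) \<or>
     (\<exists>j. j * j = - 1 \<and> (\<forall>z. \<exists>a b. z = a *\<^sub>R 1 + b *\<^sub>R j)
        \<and> (\<forall>a b. norm (a *\<^sub>R 1 + b *\<^sub>R j) = sqrt (a\<^sup>2 + b\<^sup>2)))"

instance real :: real_or_complex
  by standard simp

instance complex :: real_or_complex
proof
  have "\<i> * \<i> = - 1 \<and> (\<forall>z. \<exists>a b. z = a *\<^sub>R 1 + b *\<^sub>R \<i>)
        \<and> (\<forall>a b. norm (a *\<^sub>R 1 + b *\<^sub>R \<i>) = sqrt (a\<^sup>2 + b\<^sup>2))"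
  proof (intro conjI allI)
    show "\<exists>a b. z = a *\<^sub>R 1 + b *\<^sub>R \<i>" for z
      by (rule exI[of _ "Re z"], rule exI[of _ "Im z"]) (simp add: complex_eq_iff)
  qed (simp_all add: cmod_def)
  then show "(\<forall>z::complex. \<exists>a. z = a *\<^sub>R 1) \<or>
     (\<exists>j::complex. j * j = - 1 \<and> (\<forall>z. \<exists>a b. z = a *\<^sub>R 1 + b *\<^sub>R j)
        \<and> (\<forall>a b. norm (a *\<^sub>R 1 + b *\<^sub>R j) = sqrt (a\<^sup>2 + b\<^sup>2)))"
    by blast
qed

text \<open>
  The type class \<open>banach\<close> only provides real scalars; \<open>smul\<close> is the multiplication by scalars of
  the field, and \<open>smul_of_real\<close> says that it extends the one of the type class.
\<close>

locale banach_space_over = vector_space smul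
  for smul :: "'k::real_or_complex \<Rightarrow> 'a::banach \<Rightarrow> 'a" +
  assumes norm_smul: "norm (smul c x) = norm c * norm x"
    and smul_of_real: "smul (of_real r) x = r *\<^sub>R x"

definition finite_dim :: "('k::field \<Rightarrow> 'a::ab_group_add \<Rightarrow> 'a) \<Rightarrow> bool" where
  "finite_dim smul \<longleftrightarrow> (\<exists>B. finite B \<and> module.span smul B = UNIV)"

text \<open>
  The norm of \<open>'a \<Rightarrow>\<^sub>L 'k\<close> is the operator norm, so the dual space below carries the usual dual norm.
\<close>

definition dual ::
  "('k::real_normed_field \<Rightarrow> 'a::real_normed_vector \<Rightarrow> 'a) \<Rightarrow> ('a \<Rightarrow>\<^sub>L 'k) set" where
  "dual smul = {f. \<forall>c x. blinfun_apply f (smul c x) = c * blinfun_apply f x}"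

definition dual_smul ::
  "'k::real_normed_field \<Rightarrow> ('a::real_normed_vector \<Rightarrow>\<^sub>L 'k) \<Rightarrow> ('a \<Rightarrow>\<^sub>L 'k)" where
  "dual_smul c f = blinfun_mult_right c o\<^sub>L f"


section \<open>Nets and trees\<close>

definition directed :: "'d set \<Rightarrow> ('d \<Rightarrow> 'd \<Rightarrow> bool) \<Rightarrow> bool" where
  "directed D le \<longleftrightarrow> D \<noteq> {} \<and> (\<forall>a\<in>D. le a a) \<and>
     (\<forall>a\<in>D. \<forall>b\<in>D. \<forall>c\<in>D. le a b \<longrightarrow> le b c \<longrightarrow> le a c) \<and>
     (\<forall>a\<in>D. \<forall>b\<in>D. \<exists>c\<in>D. le a c \<and> le b c)"

definition tails :: "'d set \<Rightarrow> ('d \<Rightarrow> 'd \<Rightarrow> bool) \<Rightarrow> 'd filter" where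
  "tails D le = (INF d\<in>D. principal {u\<in>D. le d u})"

text \<open>
  A net is null for the topology induced by a set \<open>\<Phi>\<close> of functionals. The weak topology of \<open>X\<close> is
  obtained from \<open>\<Phi> = X\<^sup>*\<close>, the weak* topology of \<open>X\<^sup>*\<close> from the evaluations at the points of \<open>X\<close>.
\<close>

definition null_net :: "('v \<Rightarrow> 'k::real_normed_field) set \<Rightarrow> 'd set \<Rightarrow> ('d \<Rightarrow> 'd \<Rightarrow> bool) \<Rightarrow> ('d \<Rightarrow> 'v) \<Rightarrow> bool"
  where "null_net \<Phi> D le y \<longleftrightarrow> (\<forall>\<phi>\<in>\<Phi>. ((\<lambda>u. \<phi> (y u)) \<longlongrightarrow> 0) (tails D le))"

text \<open>
  The nodes of a tree of height \<open>n\<close> on \<open>D\<close> are the nonempty lists over \<open>D\<close> of length at most \<open>n\<close>;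
  values of \<open>x\<close> elsewhere are irrelevant.
\<close>

definition normalized_null_tree ::
  "'v::real_normed_vector set \<Rightarrow> ('v \<Rightarrow> 'k::real_normed_field) set \<Rightarrow> nat \<Rightarrow>
   'd set \<Rightarrow> ('d \<Rightarrow> 'd \<Rightarrow> bool) \<Rightarrow> ('d list \<Rightarrow> 'v) \<Rightarrow> bool" where
  "normalized_null_tree V \<Phi> n D le x \<longleftrightarrow>
     (\<forall>t\<in>lists D. t \<noteq> [] \<longrightarrow> length t \<le> n \<longrightarrow> x t \<in> V \<and> norm (x t) = 1) \<and>
     (\<forall>t\<in>lists D. length t < n \<longrightarrow> null_net \<Phi> D le (\<lambda>u. x (t @ [u])))"

text \<open>\<open>take i t\<close> is the initial segment of \<open>t\<close> of length \<open>i\<close>.\<close>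

definition approximates ::
  "('k::real_normed_field \<Rightarrow> 'v::real_normed_vector \<Rightarrow> 'v) \<Rightarrow> nat \<Rightarrow> 'd set \<Rightarrow> ('d list \<Rightarrow> 'v) \<Rightarrow>
   real \<Rightarrow> ((nat \<Rightarrow> 'k) \<Rightarrow> real) \<Rightarrow> bool" where
  "approximates smul n D x \<delta> r \<longleftrightarrow>
     (\<forall>t\<in>lists D. length t = n \<longrightarrow> (\<forall>a. (\<forall>i\<in>{1..n}. norm (a i) \<le> 1) \<longrightarrow>
        \<bar>norm (\<Sum>i=1..n. smul (a i) (x (take i t))) - r a\<bar> < \<delta>))"


section \<open>Asymptotic structures\<close>

text \<open>
  A vector of \<open>\<bbbK>\<^sup>n\<close> is given by a family \<open>a :: nat \<Rightarrow> 'k\<close> of which only the coordinates in \<open>{1..n}\<close>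
  count, so that \<open>r a\<close> stands for the value of \<open>r\<close> at the combination of \<open>e\<^sub>1, \<dots>, e\<^sub>n\<close> with
  coefficients \<open>a 1, \<dots>, a n\<close>. The first condition makes \<open>r\<close> a function on \<open>\<bbbK>\<^sup>n\<close>.
\<close>

definition norm_on :: "nat \<Rightarrow> ((nat \<Rightarrow> 'k::real_normed_field) \<Rightarrow> real) \<Rightarrow> bool" where
  "norm_on n r \<longleftrightarrow>
     (\<forall>a b. (\<forall>i\<in>{1..n}. a i = b i) \<longrightarrow> r a = r b) \<and>
     (\<forall>a. 0 \<le> r a) \<and>
     (\<forall>a. r a = 0 \<longleftrightarrow> (\<forall>i\<in>{1..n}. a i = 0)) \<and>
     (\<forall>c a. r (\<lambda>i. c * a i) = norm c * r a) \<and>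
     (\<forall>a b. r (\<lambda>i. a i + b i) \<le> r a + r b)"

definition unit_vec :: "nat \<Rightarrow> nat \<Rightarrow> 'k::zero_neq_one" where
  "unit_vec i = (\<lambda>j. if j = i then 1 else 0)"

definition monotone_normalized :: "nat \<Rightarrow> ((nat \<Rightarrow> 'k::real_normed_field) \<Rightarrow> real) \<Rightarrow> bool" where
  "monotone_normalized n r \<longleftrightarrow>
     (\<forall>i\<in>{1..n}. r (unit_vec i) = 1) \<and>
     (\<forall>m\<le>n. \<forall>a. r (\<lambda>j. \<Sum>i=1..m. a i * unit_vec i j) \<le> r (\<lambda>j. \<Sum>i=1..n. a i * unit_vec i j))"

text \<open>
  HOL does not quantify over all types inside a formula, so the directed sets range over the subsets
  of the type \<open>'v set\<close>, with arbitrary preorders. This loses nothing: by the lemma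
  \<open>directed_set_irrelevant\<close> below, a tree on a directed set of any type can be replaced by a tree on a
  directed set in \<open>'v set\<close> (a neighbourhood base of 0).
\<close>

definition tree_norms ::
  "('k::real_normed_field \<Rightarrow> 'v::real_normed_vector \<Rightarrow> 'v) \<Rightarrow> 'v set \<Rightarrow> ('v \<Rightarrow> 'k) set \<Rightarrow> nat \<Rightarrow>
   ((nat \<Rightarrow> 'k) \<Rightarrow> real) set" where
  "tree_norms smul V \<Phi> n =
     {r. norm_on n r \<and> monotone_normalized n r \<and>
        (\<forall>\<delta>>0. \<exists>(D :: 'v set set) le x. directed D le \<and> normalized_null_tree V \<Phi> n D le x \<and>
           approximates smul n D x \<delta> r)}"

definition asymptotic_structure ::
  "('k::real_normed_field \<Rightarrow> 'a::real_normed_vector \<Rightarrow> 'a) \<Rightarrow> nat \<Rightarrow> ((nat \<Rightarrow> 'k) \<Rightarrow> real) set" where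
  "asymptotic_structure smul n =
     (if finite_dim smul then {} else tree_norms smul UNIV (blinfun_apply ` dual smul) n)"

definition weak_star_asymptotic_structure ::
  "('k::real_normed_field \<Rightarrow> 'a::real_normed_vector \<Rightarrow> 'a) \<Rightarrow> nat \<Rightarrow> ((nat \<Rightarrow> 'k) \<Rightarrow> real) set" where
  "weak_star_asymptotic_structure smul n =
     (if finite_dim smul then {}
      else tree_norms dual_smul (dual smul) (range (\<lambda>x f. blinfun_apply f x)) n)"


section \<open>Quantities\<close>

definition lp_norm :: "real \<Rightarrow> nat \<Rightarrow> (nat \<Rightarrow> 'k::real_normed_field) \<Rightarrow> real" where
  "lp_norm p n a = (\<Sum>i=1..n. norm (a i) powr p) powr (1 / p)"

definition rademacher :: "nat \<Rightarrow> (nat \<Rightarrow> real) pmf" where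
  "rademacher n = Pi_pmf {1..n} 0 (\<lambda>_. pmf_of_set {-1, 1})"

definition rademacher_norm :: "real \<Rightarrow> nat \<Rightarrow> ((nat \<Rightarrow> real) \<Rightarrow> real) \<Rightarrow> real" where
  "rademacher_norm p n f =
     measure_pmf.expectation (rademacher n) (\<lambda>\<epsilon>. \<bar>f \<epsilon>\<bar> powr p) powr (1 / p)"

text \<open>
  In what follows \<open>R\<close> is a set of norms on \<open>\<bbbK>\<^sup>n\<close>, and \<open>S\<close> a sequence of such sets, to be instantiated
  by an asymptotic structure or its weak* version. The infima are taken in the extended reals, so
  that the infimum of the empty set is \<open>\<infinity>\<close>.
\<close>

definition const_alpha :: "real \<Rightarrow> nat \<Rightarrow> ((nat \<Rightarrow> 'k::real_normed_field) \<Rightarrow> real) set \<Rightarrow> ereal" where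
  "const_alpha p n R = Inf {ereal T | T. 0 < T \<and> (\<forall>r\<in>R. \<forall>a. r a \<le> T * lp_norm p n a)}"

definition const_tau :: "real \<Rightarrow> nat \<Rightarrow> ((nat \<Rightarrow> 'k::real_normed_field) \<Rightarrow> real) set \<Rightarrow> ereal" where
  "const_tau p n R = Inf {ereal T | T. 0 < T \<and>
     (\<forall>r\<in>R. \<forall>a. rademacher_norm p n (\<lambda>\<epsilon>. r (\<lambda>i. of_real (\<epsilon> i) * a i)) \<le> T * lp_norm p n a)}"

definition const_beta :: "real \<Rightarrow> nat \<Rightarrow> ((nat \<Rightarrow> 'k::real_normed_field) \<Rightarrow> real) set \<Rightarrow> ereal" where
  "const_beta q n R = Inf {ereal C | C. 0 < C \<and> (\<forall>r\<in>R. \<forall>a. C * r a \<ge> lp_norm q n a)}"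

definition const_gamma :: "real \<Rightarrow> nat \<Rightarrow> ((nat \<Rightarrow> 'k::real_normed_field) \<Rightarrow> real) set \<Rightarrow> ereal" where
  "const_gamma q n R = Inf {ereal C | C. 0 < C \<and>
     (\<forall>r\<in>R. \<forall>a. C * rademacher_norm q n (\<lambda>\<epsilon>. r (\<lambda>i. of_real (\<epsilon> i) * a i)) \<ge> lp_norm q n a)}"

definition const_theta :: "nat \<Rightarrow> ((nat \<Rightarrow> 'k::real_normed_field) \<Rightarrow> real) set \<Rightarrow> ereal" where
  "const_theta n R = Inf {ereal T | T. 0 < T \<and>
     (\<forall>r\<in>R. \<forall>a. r (\<lambda>i. of_real (1 / real n) * a i) \<le> T * (MAX i\<in>{1..n}. norm (a i)))}"

definition const_Theta :: "nat \<Rightarrow> ((nat \<Rightarrow> 'k::real_normed_field) \<Rightarrow> real) set \<Rightarrow> ereal" where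
  "const_Theta n R = Inf {ereal T | T. 0 < T \<and>
     (\<forall>r\<in>R. \<forall>a. rademacher_norm 1 n (\<lambda>\<epsilon>. r (\<lambda>i. of_real (1 / real n) * (of_real (\<epsilon> i) * a i)))
        \<le> T * (MAX i\<in>{1..n}. norm (a i)))}"

definition const_upsilon :: "nat \<Rightarrow> ((nat \<Rightarrow> 'k::real_normed_field) \<Rightarrow> real) set \<Rightarrow> ereal" where
  "const_upsilon n R = Inf {ereal C | C. 0 < C \<and>
     (\<forall>r\<in>R. \<forall>a. C * r a \<ge> (MIN i\<in>{1..n}. norm (a i)))}"

definition const_Upsilon :: "nat \<Rightarrow> ((nat \<Rightarrow> 'k::real_normed_field) \<Rightarrow> real) set \<Rightarrow> ereal" where
  "const_Upsilon n R = Inf {ereal C | C. 0 < C \<and>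
     (\<forall>r\<in>R. \<forall>a. C * rademacher_norm 1 n (\<lambda>\<epsilon>. r (\<lambda>i. of_real (\<epsilon> i) * a i))
        \<ge> (MIN i\<in>{1..n}. norm (a i)))}"


section \<open>Properties\<close>

definition basic_type :: "real \<Rightarrow> (nat \<Rightarrow> ((nat \<Rightarrow> 'k::real_normed_field) \<Rightarrow> real) set) \<Rightarrow> bool" where
  "basic_type p S \<longleftrightarrow> (SUP n\<in>{1..}. const_alpha p n (S n)) < \<infinity>"

definition type_p :: "real \<Rightarrow> (nat \<Rightarrow> ((nat \<Rightarrow> 'k::real_normed_field) \<Rightarrow> real) set) \<Rightarrow> bool" where
  "type_p p S \<longleftrightarrow> (SUP n\<in>{1..}. const_tau p n (S n)) < \<infinity>"

definition basic_cotype :: "real \<Rightarrow> (nat \<Rightarrow> ((nat \<Rightarrow> 'k::real_normed_field) \<Rightarrow> real) set) \<Rightarrow> bool" where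
  "basic_cotype q S \<longleftrightarrow> (SUP n\<in>{1..}. const_beta q n (S n)) < \<infinity>"

definition cotype_q :: "real \<Rightarrow> (nat \<Rightarrow> ((nat \<Rightarrow> 'k::real_normed_field) \<Rightarrow> real) set) \<Rightarrow> bool" where
  "cotype_q q S \<longleftrightarrow> (SUP n\<in>{1..}. const_gamma q n (S n)) < \<infinity>"

definition basic_subtype :: "(nat \<Rightarrow> ((nat \<Rightarrow> 'k::real_normed_field) \<Rightarrow> real) set) \<Rightarrow> bool" where
  "basic_subtype S \<longleftrightarrow> (\<lambda>n. const_theta n (S n)) \<longlonglongrightarrow> 0"

definition subtype :: "(nat \<Rightarrow> ((nat \<Rightarrow> 'k::real_normed_field) \<Rightarrow> real) set) \<Rightarrow> bool" where
  "subtype S \<longleftrightarrow> (\<lambda>n. const_Theta n (S n)) \<longlonglongrightarrow> 0"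

definition basic_subcotype :: "(nat \<Rightarrow> ((nat \<Rightarrow> 'k::real_normed_field) \<Rightarrow> real) set) \<Rightarrow> bool" where
  "basic_subcotype S \<longleftrightarrow> (\<lambda>n. const_upsilon n (S n)) \<longlonglongrightarrow> 0"

definition subcotype :: "(nat \<Rightarrow> ((nat \<Rightarrow> 'k::real_normed_field) \<Rightarrow> real) set) \<Rightarrow> bool" where
  "subcotype S \<longleftrightarrow> (\<lambda>n. const_Upsilon n (S n)) \<longlonglongrightarrow> 0"


section \<open>Independence of the type of the directed sets\<close>

lemma eventually_tails:
  assumes "directed D le"
  shows "eventually P (tails D le) \<longleftrightarrow> (\<exists>d\<in>D. \<forall>u\<in>D. le d u \<longrightarrow> P u)"
proof -
  have "eventually P (tails D le) \<longleftrightarrow> (\<exists>d\<in>D. eventually P (principal {u\<in>D. le d u}))"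
    unfolding tails_def
  proof (rule eventually_INF_base)
    show "D \<noteq> {}" using assms by (simp add: directed_def)
    fix a b assume ab: "a \<in> D" "b \<in> D"
    then obtain c where c: "c \<in> D" "le a c" "le b c"
      using assms unfolding directed_def by blast
    have "{u \<in> D. le c u} \<subseteq> {u \<in> D. le a u} \<inter> {u \<in> D. le b u}"
      using assms ab c unfolding directed_def by blast
    then show "\<exists>x\<in>D. principal {u \<in> D. le x u}
        \<le> inf (principal {u \<in> D. le a u}) (principal {u \<in> D. le b u})"
      using c(1) by auto
  qed
  then show ?thesis by (auto simp: eventually_principal)
qed

lemma directed_set_irrelevant:
  fixes D :: "'d set" and \<Phi> :: "('v::real_normed_vector \<Rightarrow> 'k::real_normed_field) set"
    and smul :: "'k::real_normed_field \<Rightarrow> 'v::real_normed_vector \<Rightarrow> 'v"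
  assumes D: "directed D le"
    and x: "normalized_null_tree V \<Phi> n D le x"
    and r: "approximates smul n D x \<delta> r"
  shows "\<exists>(E :: 'v set set) le' y. directed E le' \<and> normalized_null_tree V \<Phi> n E le' y \<and>
           approximates smul n E y \<delta> r"
proof -
  define U where "U F e = {v. \<forall>\<phi>\<in>F. norm (\<phi> v :: 'k) < e}" for F :: "('v \<Rightarrow> 'k) set" and e :: real
  define E where "E = {U F e | F e. finite F \<and> F \<subseteq> \<Phi> \<and> e > 0}"
  define le' where "le' A B \<longleftrightarrow> B \<subseteq> A" for A B :: "'v set"
  have E: "directed E le'"
    unfolding directed_def le'_def
  proof (intro conjI ballI impI)
    show "E \<noteq> {}" unfolding E_def using zero_less_one by blast
    fix A B assume "A \<in> E" "B \<in> E"
    then obtain F e G d where *: "A = U F e" "B = U G d" "finite F" "F \<subseteq> \<Phi>" "e > 0"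
      "finite G" "G \<subseteq> \<Phi>" "d > 0" unfolding E_def by blast
    have "U (F \<union> G) (min e d) \<in> E" unfolding E_def using *
      by (auto intro!: exI[of _ "F \<union> G"] exI[of _ "min e d"])
    moreover have "U (F \<union> G) (min e d) \<subseteq> A" "U (F \<union> G) (min e d) \<subseteq> B"
      unfolding * U_def by auto
    ultimately show "\<exists>C\<in>E. C \<subseteq> A \<and> C \<subseteq> B" by blast
  qed auto
  have sel: "\<exists>u\<in>D. x (t @ [u]) \<in> A" if t: "t \<in> lists D" "length t < n" and A: "A \<in> E" for t A
  proof -
    obtain F e where *: "A = U F e" "finite F" "F \<subseteq> \<Phi>" "e > 0" using A unfolding E_def by blast
    have "\<forall>\<phi>\<in>F. eventually (\<lambda>u. norm (\<phi> (x (t @ [u]))) < e) (tails D le)"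
    proof
      fix \<phi> assume "\<phi> \<in> F"
      then have "((\<lambda>u. \<phi> (x (t @ [u]))) \<longlongrightarrow> 0) (tails D le)"
        using x t *(3) unfolding normalized_null_tree_def null_net_def by blast
      then show "eventually (\<lambda>u. norm (\<phi> (x (t @ [u]))) < e) (tails D le)"
        using *(4) by (simp add: tendsto_iff dist_norm)
    qed
    then have "eventually (\<lambda>u. \<forall>\<phi>\<in>F. norm (\<phi> (x (t @ [u]))) < e) (tails D le)"
      using *(2) by (simp add: eventually_ball_finite)
    then obtain d where "d \<in> D" "\<forall>u\<in>D. le d u \<longrightarrow> (\<forall>\<phi>\<in>F. norm (\<phi> (x (t @ [u]))) < e)"
      unfolding eventually_tails[OF D] by blast
    then have "d \<in> D" "\<forall>\<phi>\<in>F. norm (\<phi> (x (t @ [d]))) < e"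
      using D unfolding directed_def by blast+
    then show ?thesis unfolding * U_def by blast
  qed
  obtain d0 where d0: "d0 \<in> D" using D unfolding directed_def by blast
  define s where "s t A = (if \<exists>u\<in>D. x (t @ [u]) \<in> A then SOME u. u \<in> D \<and> x (t @ [u]) \<in> A else d0)"
    for t A
  have sD: "s t A \<in> D" for t A
    unfolding s_def using d0 by (auto intro: someI2_ex)
  have sA: "x (t @ [s t A]) \<in> A" if "t \<in> lists D" "length t < n" "A \<in> E" for t A
  proof -
    have ex: "\<exists>u. u \<in> D \<and> x (t @ [u]) \<in> A" using sel[OF that] by blast
    from someI_ex[OF ex] show ?thesis using ex unfolding s_def by auto
  qed
  define h where "h = foldl (\<lambda>t A. t @ [s t A]) []"
  have h_snoc: "h (us @ [A]) = h us @ [s (h us) A]" for us A by (simp add: h_def)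
  have h_nil: "h [] = []" by (simp add: h_def)
  have h_len: "length (h us) = length us" for us
    by (induction us rule: rev_induct) (auto simp: h_nil h_snoc)
  have h_D: "h us \<in> lists D" for us
    by (induction us rule: rev_induct) (auto simp: h_nil h_snoc sD)
  have h_take: "h (take i us) = take i (h us)" for i us
    by (induction us rule: rev_induct) (auto simp: h_nil h_snoc h_len take_Cons')
  define y where "y us = x (h us)" for us
  have "normalized_null_tree V \<Phi> n E le' y"
    unfolding normalized_null_tree_def
  proof (intro conjI ballI impI)
    fix t assume "t \<in> lists E" "t \<noteq> []" "length t \<le> n"
    moreover from this have "h t \<noteq> []" by (metis h_len length_0_conv)
    ultimately show "y t \<in> V" "norm (y t) = 1"
      using x h_D[of t] h_len[of t] unfolding normalized_null_tree_def y_def by auto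
  next
    fix t assume t: "t \<in> lists E" "length t < n"
    show "null_net \<Phi> E le' (\<lambda>u. y (t @ [u]))"
      unfolding null_net_def tendsto_iff eventually_tails[OF E]
    proof (intro ballI allI impI)
      fix \<phi> and e :: real assume \<phi>: "\<phi> \<in> \<Phi>" and e: "0 < e"
      have UE: "U {\<phi>} e \<in> E" unfolding E_def using \<phi> e by blast
      have "dist (\<phi> (y (t @ [A]))) 0 < e" if "A \<in> E" "le' (U {\<phi>} e) A" for A
        using sA[OF h_D, of t A] t(2) that unfolding le'_def U_def y_def
        by (auto simp: h_snoc h_len)
      then show "\<exists>d\<in>E. \<forall>u\<in>E. le' d u \<longrightarrow> dist (\<phi> (y (t @ [u]))) 0 < e" using UE by blast
    qed
  qed
  moreover have "approximates smul n E y \<delta> r"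
    using r h_D h_len unfolding approximates_def y_def h_take by auto
  ultimately show ?thesis using E by blast
qed

end

theory Submission
  imports Defs
begin

text \<open>
  Both asymptotic structures have one property from which everything else follows: they are closed
  under normalised blocks. If \<open>r\<close> belongs to the structure of order \<open>N\<close> and the coordinates
  \<open>1, \<dots>, N\<close> are cut into \<open>m\<close> consecutive blocks carrying vectors \<open>b\<^sub>1, \<dots>, b\<^sub>m\<close> with \<open>r b\<^sub>j = 1\<close>, then
  \<open>(d\<^sub>1, \<dots>, d\<^sub>m) \<mapsto> r (\<Sum>\<^sub>j d\<^sub>j b\<^sub>j)\<close> belongs to the structure of order \<open>m\<close>
  (\<open>block_norm_in_tree_norms\<close>). The four equivalences are therefore proved once, for every family of
  norms with this property (locale \<open>block_closed_norms\<close>).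

  From basic subtype to basic type: if \<open>\<theta>\<^sub>m \<le> 1/2\<close> for one \<open>m \<ge> 2\<close>, then a sum of \<open>m\<close> consecutive
  blocks has norm at most \<open>\<kappa>\<close> times the largest norm of a block, where \<open>\<kappa> < m\<close>. Iterating this, a
  vector with \<open>m\<^sup>k\<close> nonzero coordinates, of modulus at most 1, has norm of order \<open>\<kappa>\<^sup>k\<close>, a power of the
  number of coordinates with exponent less than 1. Cutting an arbitrary vector into levels on which
  the modulus is almost constant, and summing a geometric series, gives an estimate by an
  \<open>\<ell>\<^sub>p\<close>-norm (\<open>upper_block_estimate_imp_type\<close>).

  From basic subcotype to basic cotype: now a sum of \<open>m\<close> consecutive blocks has norm at least \<open>\<rho> > 1\<close>
  times the smallest norm of a block, so a vector with \<open>m\<^sup>k\<close> coordinates of modulus at least \<open>b\<close> has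
  norm at least \<open>\<rho>\<^sup>k b / 2\<close>. Hence a vector of small norm has few coordinates of a given size, and the
  sum of the \<open>q\<close>-th powers of its coordinates converges when \<open>q\<close> is large
  (\<open>lower_block_estimate_imp_cotype\<close>).

  The two statements about signed sums are obtained by applying the same two lemmas to the norm
  \<open>a \<mapsto> (\<bbbE> r(\<Sum>\<^sub>i \<epsilon>\<^sub>i a\<^sub>i e\<^sub>i)\<^sup>2)\<^bsup>1/2\<^esup>\<close>. The difficulty is that a maximum or a minimum over blocks does not
  commute with the expectation, whereas a sum of squares does. So subtype and subcotype are first
  turned into an improvement by a constant factor of the trivial comparison between
  \<open>\<bbbE> r(\<Sum>\<^sub>i \<delta>\<^sub>i d\<^sub>i e\<^sub>i)\<^sup>2\<close> and \<open>\<Sum>\<^sub>i |d\<^sub>i|\<^sup>2\<close> (\<open>mean_square_signs_upper\<close>, \<open>mean_square_signs_lower\<close>): when all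
  \<open>|d\<^sub>i|\<close> are comparable the hypothesis gives it, and otherwise the trivial comparison is not sharp.

  The converse directions follow by comparing \<open>\<ell>\<^sub>p\<close>-norms with the extreme coordinates. For cotype the
  \<open>L\<^sub>q\<close>-average has moreover to be bounded by the \<open>L\<^sub>1\<close>-average, which is Kahane's inequality; it is
  derived from a two-point inequality (\<open>hypercontractive_inequality\<close>).
\<close>

section \<open>Norms on coordinate spaces\<close>

definition restr :: "nat set \<Rightarrow> (nat \<Rightarrow> 'k::zero) \<Rightarrow> nat \<Rightarrow> 'k" where
  "restr S a = (\<lambda>i. if i \<in> S then a i else 0)"

locale normed_space_over = vector_space smul
  for smul :: "'k::real_normed_field \<Rightarrow> 'v::real_normed_vector \<Rightarrow> 'v" +
  assumes norm_smul: "norm (smul c x) = norm c * norm x"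

lemma restr_unit_vec_sum:
  fixes a :: "nat \<Rightarrow> 'k::real_normed_field"
  shows "(\<lambda>j. \<Sum>i=1..m. a i * unit_vec i j) = restr {1..m} a"
proof
  fix j
  have "(\<Sum>i=1..m. a i * unit_vec i j) = (\<Sum>i=1..m. if j = i then a i else 0)"
    by (rule sum.cong) (auto simp: unit_vec_def)
  then show "(\<Sum>i=1..m. a i * unit_vec i j) = restr {1..m} a j"
    by (simp add: restr_def)
qed

context
  fixes n :: nat and r :: "(nat \<Rightarrow> 'k::real_normed_field) \<Rightarrow> real"
  assumes r: "norm_on n r"
begin

lemma norm_on_cong: "(\<And>i. i \<in> {1..n} \<Longrightarrow> a i = b i) \<Longrightarrow> r a = r b"
  using r unfolding norm_on_def by blast

lemma norm_on_nonneg: "0 \<le> r a"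
  using r unfolding norm_on_def by blast

lemma norm_on_eq_0: "r a = 0 \<longleftrightarrow> (\<forall>i\<in>{1..n}. a i = 0)"
  using r unfolding norm_on_def by blast

lemma norm_on_scale: "r (\<lambda>i. c * a i) = norm c * r a"
  using r unfolding norm_on_def by blast

lemma norm_on_triangle: "r (\<lambda>i. a i + b i) \<le> r a + r b"
  using r unfolding norm_on_def by blast

lemma norm_on_triangle_diff: "r (\<lambda>i. a i - b i) \<le> r a + r b"
  using norm_on_triangle[of a "\<lambda>i. (-1) * b i"] norm_on_scale[of "-1" b] by simp

end

lemma monotone_restr:
  assumes "norm_on n r" "monotone_normalized n r" "m \<le> n"
  shows "r (restr {1..m} a) \<le> r a"
proof -
  have "r (restr {1..m} a) \<le> r (restr {1..n} a)"
    using assms(2,3) unfolding monotone_normalized_def restr_unit_vec_sum by blast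
  also have "r (restr {1..n} a) = r a"
    by (rule norm_on_cong[OF assms(1)]) (simp add: restr_def)
  finally show ?thesis .
qed

lemma norm_on_restr_le_sum:
  assumes r: "norm_on n r" "\<And>i. i \<in> {1..n} \<Longrightarrow> r (unit_vec i) = 1" and A: "A \<subseteq> {1..n}"
  shows "r (restr A a) \<le> (\<Sum>i\<in>A. norm (a i))"
proof -
  have "finite A" using A finite_subset by blast
  then show ?thesis using A
  proof (induction A rule: finite_induct)
    case empty
    have "r (restr {} a) = 0" unfolding norm_on_eq_0[OF r(1)] by (simp add: restr_def)
    then show ?case by simp
  next
    case (insert i A)
    have "restr (insert i A) a = (\<lambda>j. restr A a j + a i * unit_vec i j)"
      using insert.hyps by (auto simp: restr_def unit_vec_def)
    then have "r (restr (insert i A) a) \<le> r (restr A a) + r (\<lambda>j. a i * unit_vec i j)"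
      using norm_on_triangle[OF r(1)] by metis
    also have "r (\<lambda>j. a i * unit_vec i j) = norm (a i)"
      using norm_on_scale[OF r(1), of "a i" "unit_vec i"] r(2)[of i] insert.prems by simp
    also have "r (restr A a) \<le> (\<Sum>i\<in>A. norm (a i))" using insert by simp
    finally show ?case using insert.hyps by simp
  qed
qed

text \<open>
  A coordinate is the difference of two truncations, and truncations do not increase the norm.
\<close>
lemma norm_on_coordinate_le:
  assumes r: "norm_on n r" "monotone_normalized n r" and i: "i \<in> {1..n}"
  shows "norm (a i) \<le> 2 * r a"
proof -
  have "norm (a i) = r (\<lambda>j. a i * unit_vec i j)"
    using norm_on_scale[OF r(1), of "a i" "unit_vec i"] r(2) i
    unfolding monotone_normalized_def by simp
  also have "(\<lambda>j. a i * unit_vec i j) = (\<lambda>j. restr {1..i} a j - restr {1..i - 1} a j)"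
    using i by (auto simp: restr_def unit_vec_def fun_eq_iff)
  also have "r \<dots> \<le> r (restr {1..i} a) + r (restr {1..i - 1} a)"
    by (rule norm_on_triangle_diff[OF r(1)])
  also have "\<dots> \<le> 2 * r a"
    using monotone_restr[OF r, of i a] monotone_restr[OF r, of "i - 1" a] i
    by (simp add: le_diff_conv)
  finally show ?thesis .
qed

lemma norm_on_pos:
  assumes "norm_on n r" "i \<in> {1..n}" "a i \<noteq> 0"
  shows "0 < r a"
  using norm_on_nonneg[OF assms(1), of a] norm_on_eq_0[OF assms(1), of a] assms(2,3)
  by (metis order_less_le)

lemma norm_on_le_support:
  assumes r: "norm_on N r" "monotone_normalized N r"
    and a: "\<And>i. i \<in> {1..N} \<Longrightarrow> norm (a i) \<le> b"
  shows "r a \<le> b * real (card {i \<in> {1..N}. a i \<noteq> 0})"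
proof -
  let ?A = "{i \<in> {1..N}. a i \<noteq> 0}"
  have "r a = r (restr ?A a)" by (rule norm_on_cong[OF r(1)]) (simp add: restr_def)
  also have "\<dots> \<le> (\<Sum>i\<in>?A. norm (a i))"
    using r(2) by (intro norm_on_restr_le_sum[OF r(1)]) (auto simp: monotone_normalized_def)
  also have "\<dots> \<le> (\<Sum>i\<in>?A. b)" using a by (intro sum_mono) auto
  finally show ?thesis by (simp add: mult.commute)
qed

lemma lp_norm_nonneg: "0 \<le> lp_norm p n a"
  by (simp add: lp_norm_def)

lemma lp_norm_scale:
  assumes "0 < p"
  shows "lp_norm p n (\<lambda>i. c * a i) = norm c * lp_norm p n a"
proof -
  have "lp_norm p n (\<lambda>i. c * a i) = (norm c powr p * (\<Sum>i=1..n. norm (a i) powr p)) powr (1 / p)"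
    by (simp add: lp_norm_def norm_mult powr_mult sum_distrib_left)
  then show ?thesis
    using assms by (simp add: lp_norm_def powr_mult sum_nonneg powr_powr)
qed

lemma lp_norm_eq_0:
  assumes "0 < p" "lp_norm p n a = 0" "i \<in> {1..n}"
  shows "a i = 0"
proof -
  have "(\<Sum>i=1..n. norm (a i) powr p) = 0" using assms by (simp add: lp_norm_def)
  then have "norm (a i) powr p = 0" using assms(3) by (subst (asm) sum_nonneg_eq_0_iff) auto
  then show ?thesis by simp
qed

lemma sum_powr_eq_1:
  assumes "0 < p" "lp_norm p n a = 1"
  shows "(\<Sum>i=1..n. norm (a i) powr p) = 1"
proof -
  have "(\<Sum>i=1..n. norm (a i) powr p) = lp_norm p n a powr p"
    using assms(1) by (simp add: lp_norm_def powr_powr sum_nonneg)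
  then show ?thesis using assms by simp
qed

lemma lp_norm_le_Max:
  assumes "0 < p" "1 \<le> n"
  shows "lp_norm p n a \<le> real n powr (1 / p) * (MAX i\<in>{1..n}. norm (a i))"
proof -
  let ?M = "MAX i\<in>{1..n}. norm (a i)"
  have le: "norm (a i) \<le> ?M" if "i \<in> {1..n}" for i using that by (intro Max_ge) auto
  have M: "0 \<le> ?M" using order_trans[OF norm_ge_zero le[of 1]] assms(2) by simp
  have "(\<Sum>i=1..n. norm (a i) powr p) \<le> (\<Sum>i=1..n. ?M powr p)"
    using assms le by (intro sum_mono powr_mono2) auto
  then have "lp_norm p n a \<le> (n * ?M powr p) powr (1 / p)"
    unfolding lp_norm_def using assms by (intro powr_mono2) (auto intro: sum_nonneg)
  also have "\<dots> = real n powr (1 / p) * ?M" using assms M by (simp add: powr_mult powr_powr)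
  finally show ?thesis .
qed

lemma lp_norm_ge_Min:
  assumes "0 < p" "1 \<le> n"
  shows "real n powr (1 / p) * (MIN i\<in>{1..n}. norm (a i)) \<le> lp_norm p n a"
proof -
  let ?M = "MIN i\<in>{1..n}. norm (a i)"
  have le: "?M \<le> norm (a i)" if "i \<in> {1..n}" for i using that by (intro Min_le) auto
  have M: "0 \<le> ?M" using assms(2) by (subst Min_ge_iff) auto
  have "real n powr (1 / p) * ?M = (n * ?M powr p) powr (1 / p)"
    using assms M by (simp add: powr_mult powr_powr)
  also have "(n * ?M powr p) \<le> (\<Sum>i=1..n. norm (a i) powr p)"
  proof -
    have "(\<Sum>i=1..n. ?M powr p) \<le> (\<Sum>i=1..n. norm (a i) powr p)"
      using assms le M by (intro sum_mono powr_mono2) auto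
    then show ?thesis by simp
  qed
  then have "(n * ?M powr p) powr (1 / p) \<le> lp_norm p n a"
    unfolding lp_norm_def using assms by (intro powr_mono2) auto
  finally show ?thesis .
qed

lemma Max_norm_nonneg: "1 \<le> n \<Longrightarrow> 0 \<le> (MAX i\<in>{1..n :: nat}. norm (a i))"
  by (rule order_trans[OF norm_ge_zero Max_ge[of _ "norm (a 1)"]]) auto

section \<open>Normalised blocks of tree norms\<close>

lemma downward_closed_eq_interval:
  fixes A :: "nat set"
  assumes "A \<subseteq> {1..N}" and "\<And>i j. i \<in> A \<Longrightarrow> 1 \<le> j \<Longrightarrow> j \<le> i \<Longrightarrow> j \<in> A"
  shows "A = {1..card A}"
proof (cases "A = {}")
  case False
  have "finite A" using assms(1) finite_subset by blast
  have "A = {1..Max A}"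
  proof (intro set_eqI iffI)
    fix j assume "j \<in> A"
    then show "j \<in> {1..Max A}" using assms(1) Max_ge[OF \<open>finite A\<close>] by auto
  next
    fix j assume "j \<in> {1..Max A}"
    then show "j \<in> A" using assms(2)[OF Max_in[OF \<open>finite A\<close> False]] by simp
  qed
  then show ?thesis by (metis card_atLeastAtMost diff_Suc_1)
qed simp

text \<open>
  The blocks are described by a function \<open>g\<close> that gives the index of the block containing a
  coordinate. The sum \<open>\<Sum>\<^sub>j d\<^sub>j b\<^sub>j\<close> of multiples of the blocks \<open>b\<^sub>j = restr {i. g i = j} a\<close> then has the
  coordinates \<open>d (g i) * a i\<close>; the blocks are consecutive when \<open>g\<close> is monotone.
\<close>
definition block_norm :: "((nat \<Rightarrow> 'k::real_normed_field) \<Rightarrow> real) \<Rightarrow> (nat \<Rightarrow> nat) \<Rightarrow> (nat \<Rightarrow> 'k) \<Rightarrow>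
    (nat \<Rightarrow> 'k) \<Rightarrow> real" where
  "block_norm r g a = (\<lambda>d. r (\<lambda>i. d (g i) * a i))"

lemma block_norm_on:
  assumes r: "norm_on N r" and g: "g ` {1..N} \<subseteq> {1..m}"
    and a: "\<And>j. j \<in> {1..m} \<Longrightarrow> r (restr {i. g i = j} a) \<noteq> 0"
  shows "norm_on m (block_norm r g a)"
proof -
  have gin: "g i \<in> {1..m}" if "i \<in> {1..N}" for i using g that by blast
  have zero: "(\<forall>i\<in>{1..N}. d (g i) * a i = 0) \<longleftrightarrow> (\<forall>j\<in>{1..m}. d j = 0)" for d
  proof
    assume *: "\<forall>i\<in>{1..N}. d (g i) * a i = 0"
    show "\<forall>j\<in>{1..m}. d j = 0"
    proof
      fix j assume "j \<in> {1..m}"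
      from a[OF this] obtain i where "i \<in> {1..N}" "g i = j" "a i \<noteq> 0"
        unfolding norm_on_eq_0[OF r] by (auto simp: restr_def split: if_splits)
      then show "d j = 0" using * by auto
    qed
  qed (use gin in auto)
  show ?thesis
    unfolding norm_on_def block_norm_def norm_on_eq_0[OF r] zero
  proof (intro conjI allI impI refl)
    fix d d' :: "nat \<Rightarrow> 'a" assume "\<forall>i\<in>{1..m}. d i = d' i"
    then show "r (\<lambda>i. d (g i) * a i) = r (\<lambda>i. d' (g i) * a i)"
      using gin by (intro norm_on_cong[OF r]) auto
  next
    fix c d show "r (\<lambda>i. c * d (g i) * a i) = norm c * r (\<lambda>i. d (g i) * a i)"
      using norm_on_scale[OF r, of c "\<lambda>i. d (g i) * a i"] by (simp add: mult.assoc)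
  next
    fix d d' show "r (\<lambda>i. (d (g i) + d' (g i)) * a i) \<le> r (\<lambda>i. d (g i) * a i) + r (\<lambda>i. d' (g i) * a i)"
      using norm_on_triangle[OF r, of "\<lambda>i. d (g i) * a i" "\<lambda>i. d' (g i) * a i"]
      by (simp add: distrib_right)
  qed (rule norm_on_nonneg[OF r])
qed

lemma block_monotone_normalized:
  assumes r: "norm_on N r" "monotone_normalized N r"
    and g: "mono_on {1..N} g" "g ` {1..N} \<subseteq> {1..m}"
    and a: "\<And>j. j \<in> {1..m} \<Longrightarrow> r (restr {i. g i = j} a) = 1"
  shows "monotone_normalized m (block_norm r g a)"
  unfolding monotone_normalized_def restr_unit_vec_sum
proof (intro conjI ballI allI impI)
  fix j assume "j \<in> {1..m}"
  have "(\<lambda>i. unit_vec j (g i) * a i) = restr {i. g i = j} a"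
    by (auto simp: unit_vec_def restr_def)
  then show "block_norm r g a (unit_vec j) = 1"
    using a[OF \<open>j \<in> {1..m}\<close>] by (simp add: block_norm_def)
next
  fix k d assume "k \<le> m"
  have gin: "g i \<in> {1..m}" if "i \<in> {1..N}" for i using g that by blast
  let ?A = "{i \<in> {1..N}. g i \<le> k}"
  have A: "?A = {1..card ?A}"
  proof (rule downward_closed_eq_interval[of _ N])
    fix i j assume "i \<in> ?A" "1 \<le> j" "j \<le> i"
    then show "j \<in> ?A" using mono_onD[OF g(1), of j i] by auto
  qed auto
  have "card ?A \<le> card {1..N}" by (rule card_mono) auto
  then have "card ?A \<le> N" by simp
  have "block_norm r g a (restr {1..k} d) = r (restr {1..card ?A} (\<lambda>i. d (g i) * a i))"
    unfolding block_norm_def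
  proof (rule norm_on_cong[OF r(1)])
    fix i assume i: "i \<in> {1..N}"
    then have "i \<in> {1..card ?A} \<longleftrightarrow> g i \<le> k" using A by blast
    then show "restr {1..k} d (g i) * a i = restr {1..card ?A} (\<lambda>i. d (g i) * a i) i"
      using gin[OF i] by (auto simp: restr_def)
  qed
  also have "\<dots> \<le> r (\<lambda>i. d (g i) * a i)"
    by (rule monotone_restr[OF r]) fact
  also have "\<dots> = block_norm r g a (restr {1..m} d)"
    unfolding block_norm_def using gin by (intro norm_on_cong[OF r(1)]) (simp add: restr_def)
  finally show "block_norm r g a (restr {1..k} d) \<le> block_norm r g a (restr {1..m} d)" .
qed

lemma approximates_scaled:
  fixes smul :: "'k::real_normed_field \<Rightarrow> 'v::real_normed_vector \<Rightarrow> 'v"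
  assumes "normed_space_over smul" and r: "norm_on n r" and x: "approximates smul n D x \<delta> r"
    and t: "t \<in> lists D" "length t = n" and M: "0 < M" "\<And>i. i \<in> {1..n} \<Longrightarrow> norm (b i) \<le> M"
  shows "\<bar>norm (\<Sum>i=1..n. smul (b i) (x (take i t))) - r b\<bar> < M * \<delta>"
proof -
  interpret normed_space_over smul by fact
  define c where "c i = of_real (1 / M) * b i" for i
  have b: "b i = of_real M * c i" for i using M(1) by (simp add: c_def)
  have "norm (c i) \<le> 1" if "i \<in> {1..n}" for i
    using M(1) M(2)[OF that] unfolding c_def by (simp add: norm_mult norm_inverse norm_divide field_simps)
  then have *: "\<bar>norm (\<Sum>i=1..n. smul (c i) (x (take i t))) - r c\<bar> < \<delta>"
    using x t unfolding approximates_def by blast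
  have "(\<Sum>i=1..n. smul (b i) (x (take i t))) = smul (of_real M) (\<Sum>i=1..n. smul (c i) (x (take i t)))"
    by (simp add: b scale_sum_right)
  moreover have "r b = M * r c"
    using norm_on_scale[OF r, of "of_real M" c] M(1) by (simp flip: b)
  ultimately have "norm (\<Sum>i=1..n. smul (b i) (x (take i t))) - r b
      = M * (norm (\<Sum>i=1..n. smul (c i) (x (take i t))) - r c)"
    using M(1) by (simp add: norm_smul algebra_simps)
  then show ?thesis using * M(1) by (simp add: abs_mult)
qed

text \<open>
  From any node, a null tree can be continued by \<open>l\<close> levels so that all new vectors lie in a given
  weak neighbourhood of 0: the new nodes are chosen one after the other.
\<close>
lemma null_tree_small_branch:
  assumes D: "directed D le" and x: "normalized_null_tree V \<Phi> N D le x"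
    and F: "finite F" "F \<subseteq> \<Phi>" and e: "0 < e"
  shows "t \<in> lists D \<Longrightarrow> length t + l \<le> N \<Longrightarrow>
    \<exists>w\<in>lists D. length w = l \<and> (\<forall>i\<in>{1..l}. \<forall>\<phi>\<in>F. norm (\<phi> (x (t @ take i w))) < e)"
proof (induction l arbitrary: t)
  case 0
  then show ?case by (intro bexI[of _ "[]"]) auto
next
  case (Suc l)
  have "\<forall>\<phi>\<in>F. eventually (\<lambda>u. norm (\<phi> (x (t @ [u]))) < e) (tails D le)"
  proof
    fix \<phi> assume "\<phi> \<in> F"
    moreover have "null_net \<Phi> D le (\<lambda>u. x (t @ [u]))"
      using x Suc.prems unfolding normalized_null_tree_def by simp
    ultimately have "((\<lambda>u. \<phi> (x (t @ [u]))) \<longlongrightarrow> 0) (tails D le)"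
      using F unfolding null_net_def by blast
    then show "eventually (\<lambda>u. norm (\<phi> (x (t @ [u]))) < e) (tails D le)"
      using e by (simp add: tendsto_iff dist_norm)
  qed
  then have "eventually (\<lambda>u. \<forall>\<phi>\<in>F. norm (\<phi> (x (t @ [u]))) < e) (tails D le)"
    using F by (simp add: eventually_ball_finite)
  then obtain u where "u \<in> D" "\<forall>v\<in>D. le u v \<longrightarrow> (\<forall>\<phi>\<in>F. norm (\<phi> (x (t @ [v]))) < e)"
    unfolding eventually_tails[OF D] by blast
  then have u: "u \<in> D" "\<forall>\<phi>\<in>F. norm (\<phi> (x (t @ [u]))) < e"
    using D unfolding directed_def by blast+
  obtain w where w: "w \<in> lists D" "length w = l"
    "\<forall>i\<in>{1..l}. \<forall>\<phi>\<in>F. norm (\<phi> (x ((t @ [u]) @ take i w))) < e"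
    using Suc.IH[of "t @ [u]"] Suc.prems u by auto
  have "norm (\<phi> (x (t @ take i (u # w)))) < e" if "i \<in> {1..Suc l}" "\<phi> \<in> F" for i \<phi>
  proof (cases "i = 1")
    case True
    then show ?thesis using u that by simp
  next
    case False
    then have "i = Suc (i - 1)" "i - 1 \<in> {1..l}" using that(1) by auto
    then obtain k where "i = Suc k" "k \<in> {1..l}" by blast
    then show ?thesis using w(3) that(2) by simp
  qed
  then show ?case using u(1) w(1,2) by (intro bexI[of _ "u # w"]) auto
qed

text \<open>
  The blocks of a tree form a tree again. A step of the new tree consists of as many steps of the old
  one as the block has levels, but tuples over \<open>D\<close> with the product order cannot serve as directed
  set: how far one has to go in \<open>D\<close> at one level depends on the choices at the preceding levels.
  The new directed set is instead a base of weak neighbourhoods of 0, and each neighbourhood is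
  answered by a continuation of the old branch inside it. The sum over a block along the branch has
  norm close, but in general not equal, to 1, so it has to be normalised.
\<close>
lemma block_norm_in_tree_norms:
  fixes smul :: "'k::real_normed_field \<Rightarrow> 'v::real_normed_vector \<Rightarrow> 'v" and a :: "nat \<Rightarrow> 'k"
  assumes space: "normed_space_over smul"
    and V: "0 \<in> V" "\<And>x y. x \<in> V \<Longrightarrow> y \<in> V \<Longrightarrow> x + y \<in> V" "\<And>c x. x \<in> V \<Longrightarrow> smul c x \<in> V"
    and \<Phi>: "\<And>\<phi>. \<phi> \<in> \<Phi> \<Longrightarrow> Vector_Spaces.linear smul (*) \<phi>"
    and r: "r \<in> tree_norms smul V \<Phi> N"
    and g: "mono_on {1..N} g" "g ` {1..N} \<subseteq> {1..m}"
    and a: "\<And>j. j \<in> {1..m} \<Longrightarrow> r (restr {i. g i = j} a) = 1"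
  shows "block_norm r g a \<in> tree_norms smul V \<Phi> m"
proof -
  interpret normed_space_over smul by fact
  have r': "norm_on N r" "monotone_normalized N r"
    and trees: "\<And>\<delta>. 0 < \<delta> \<Longrightarrow> \<exists>(D :: 'v set set) le x. directed D le \<and>
      normalized_null_tree V \<Phi> N D le x \<and> approximates smul N D x \<delta> r"
    using r unfolding tree_norms_def by auto
  have gin: "g i \<in> {1..m}" if "i \<in> {1..N}" for i using g that by blast
  \<comment> \<open>\<open>c j\<close> is the last coordinate of the \<open>j\<close>-th block.\<close>
  define c where "c j = card {i \<in> {1..N}. g i \<le> j}" for j
  have c_iff: "g i \<le> j \<longleftrightarrow> i \<le> c j" if i: "i \<in> {1..N}" for i j
  proof -
    have "{i \<in> {1..N}. g i \<le> j} = {1..c j}"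
      unfolding c_def
    proof (rule downward_closed_eq_interval[of _ N])
      fix i k assume "i \<in> {i \<in> {1..N}. g i \<le> j}" "1 \<le> k" "k \<le> i"
      then show "k \<in> {i \<in> {1..N}. g i \<le> j}" using mono_onD[OF g(1), of k i] by auto
    qed auto
    then have "i \<in> {i \<in> {1..N}. g i \<le> j} \<longleftrightarrow> i \<in> {1..c j}" by (rule arg_cong)
    then show ?thesis using i by simp
  qed
  have c_mono: "c j \<le> c k" if "j \<le> k" for j k
    unfolding c_def
  proof (rule card_mono)
    show "{i \<in> {1..N}. g i \<le> j} \<subseteq> {i \<in> {1..N}. g i \<le> k}" using that by (auto intro: le_trans)
  qed simp
  have c_le: "c j \<le> N" for j :: nat
  proof -
    have "c j \<le> card {1..N}" unfolding c_def by (rule card_mono) auto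
    then show ?thesis by simp
  qed
  have c_0: "c 0 = 0"
  proof -
    have "\<not> g i \<le> 0" if "i \<in> {1..N}" for i using gin[OF that] by simp
    then have "{i \<in> {1..N}. g i \<le> 0} = {}" by blast
    then show ?thesis by (simp add: c_def)
  qed
  have c_m: "c m = N"
  proof -
    have "{i \<in> {1..N}. g i \<le> m} = {1..N}" using g(2) by (auto simp: image_subset_iff)
    then show ?thesis by (simp add: c_def)
  qed
  define M where "M = 1 + (\<Sum>i\<in>{1..N}. norm (a i))"
  have M: "1 \<le> M" unfolding M_def by (simp add: sum_nonneg)
  have aM: "norm (a i) \<le> M" if "i \<in> {1..N}" for i
    unfolding M_def using member_le_sum[OF that, of "\<lambda>i. norm (a i)"] by simp
  show ?thesis
    unfolding tree_norms_def mem_Collect_eq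
  proof (intro conjI allI impI)
    show "norm_on m (block_norm r g a)"
      using a by (intro block_norm_on[OF r'(1) g(2)]) simp
    show "monotone_normalized m (block_norm r g a)"
      using a by (intro block_monotone_normalized[OF r' g]) simp
    fix \<delta> :: real assume \<delta>: "0 < \<delta>"
    \<comment> \<open>The error consists of \<open>\<eta>\<close> for the approximation of \<open>r\<close> and another \<open>\<eta>\<close> for normalising each of
      the \<open>m\<close> blocks; \<open>\<eta> \<le> 1/2\<close> keeps the norms of the blocks away from 0.\<close>
    define \<eta> where "\<eta> = min (1/2) (\<delta> / (m + 1))"
    have \<eta>: "0 < \<eta>" "\<eta> \<le> 1/2" "(m + 1) * \<eta> \<le> \<delta>"
    proof -
      have "\<eta> \<le> \<delta> / (m + 1)" unfolding \<eta>_def by simp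
      then show "(m + 1) * \<eta> \<le> \<delta>" by (simp add: pos_le_divide_eq mult.commute)
      show "\<eta> \<le> 1/2" unfolding \<eta>_def by (rule min.cobounded1)
    qed (use \<delta> in \<open>simp_all add: \<eta>_def\<close>)
    obtain D :: "'v set set" and le x where D: "directed D le"
      and x: "normalized_null_tree V \<Phi> N D le x" and appr: "approximates smul N D x (\<eta> / M) r"
      using trees[of "\<eta> / M"] \<eta> M by auto
    have approx: "\<bar>norm (\<Sum>i=1..N. smul (b i) (x (take i t))) - r b\<bar> < \<eta>"
      if "t \<in> lists D" "length t = N" "\<And>i. i \<in> {1..N} \<Longrightarrow> norm (b i) \<le> M" for t b
      using approximates_scaled[OF space r'(1) appr that(1,2) _ that(3)] M by simp
    obtain d0 where d0: "d0 \<in> D" using D unfolding directed_def by blast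
    \<comment> \<open>\<open>(F, k)\<close> stands for the neighbourhood on which all functionals in \<open>F\<close> are less than \<open>1 / (k + 1)\<close>.\<close>
    define E where "E = {(F, k :: nat). finite F \<and> F \<subseteq> \<Phi>}"
    define leE where "leE A B \<longleftrightarrow> fst A \<subseteq> fst B \<and> snd A \<le> snd B" for A B :: "('v \<Rightarrow> 'k) set \<times> nat"
    have E: "directed E leE"
      unfolding directed_def
    proof (intro conjI ballI impI)
      show "E \<noteq> {}" unfolding E_def by blast
      fix A B assume "A \<in> E" "B \<in> E"
      then show "\<exists>C\<in>E. leE A C \<and> leE B C"
        by (intro bexI[of _ "(fst A \<union> fst B, max (snd A) (snd B))"]) (auto simp: E_def leE_def)
    qed (auto simp: leE_def)
    define good where "good t l A w \<longleftrightarrow> w \<in> lists D \<and> length w = l \<and>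
        (\<forall>i\<in>{1..l}. \<forall>\<phi>\<in>fst A. norm (\<phi> (x (t @ take i w))) < 1 / real (Suc (snd A)))" for t l w and A :: "('v \<Rightarrow> 'k) set \<times> nat"
    define ext where "ext t l A = (SOME w. good t l A w)" for t l A
    \<comment> \<open>\<open>h us\<close> is the branch of the given tree that realises the node \<open>us\<close> of the new one.\<close>
    define h where "h us = rec_list [] (\<lambda>A us t. t @ ext t (c (Suc (length us)) - c (length us)) A) (rev us)" for us
    have h_nil: "h [] = []" by (simp add: h_def)
    have h_snoc: "h (us @ [A]) = h us @ ext (h us) (c (Suc (length us)) - c (length us)) A" for us A
      by (simp add: h_def)
    have good: "good t l A (ext t l A)" if "t \<in> lists D" "length t + l \<le> N" "A \<in> E" for t l A
      unfolding ext_def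
    proof (rule someI_ex)
      have "finite (fst A)" "fst A \<subseteq> \<Phi>" using that(3) by (auto simp: E_def)
      from null_tree_small_branch[OF D x this, of "1 / real (Suc (snd A))" t l]
      show "\<exists>w. good t l A w" using that unfolding good_def by auto
    qed
    have h: "h us \<in> lists D \<and> length (h us) = c (length us)" if "us \<in> lists E" for us
      using that
    proof (induction us rule: rev_induct)
      case Nil then show ?case by (simp add: h_nil c_0)
    next
      case (snoc A us)
      then have "good (h us) (c (Suc (length us)) - c (length us)) A
          (ext (h us) (c (Suc (length us)) - c (length us)) A)"
        using c_le c_mono by (intro good) (auto simp: c_mono)
      then show ?case using snoc c_mono[of "length us" "Suc (length us)"] unfolding h_snoc good_def by auto
    qed
    have h_take: "h (take j us) = take (c j) (h us)" if "us \<in> lists E" "j \<le> length us" for j us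
      using that
    proof (induction us rule: rev_induct)
      case Nil then show ?case by (simp add: h_nil)
    next
      case (snoc A us)
      show ?case
      proof (cases "j \<le> length us")
        case True
        then have "c j \<le> length (h us)" using h[of us] snoc.prems c_mono by auto
        then show ?thesis using snoc True by (simp add: h_snoc)
      next
        case False
        then have j: "j = length (us @ [A])" using snoc.prems by simp
        then show ?thesis using h[OF snoc.prems(1)] by simp
      qed
    qed
    define z where "z us = (\<Sum>i\<in>{i\<in>{1..N}. g i = length us}. smul (a i) (x (take i (h us))))" for us
    define y where "y us = smul (of_real (1 / norm (z us))) (z us)" for us
    have z_norm: "\<bar>norm (z us) - 1\<bar> < \<eta>" if us: "us \<in> lists E" "us \<noteq> []" "length us \<le> m" for us
    proof -
      \<comment> \<open>\<open>approximates\<close> only speaks of branches of full length, so \<open>h us\<close> is completed arbitrarily.\<close>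
      define t where "t = h us @ replicate (N - c (length us)) d0"
      have t: "t \<in> lists D" "length t = N"
        using h[OF us(1)] d0 c_le[of "length us"] unfolding t_def by auto
      have "(\<Sum>i=1..N. smul (restr {i. g i = length us} a i) (x (take i t))) =
          (\<Sum>i\<in>{1..N}. if g i = length us then smul (a i) (x (take i (h us))) else 0)"
      proof (rule sum.cong[OF refl])
        fix i assume i: "i \<in> {1..N}"
        show "smul (restr {i. g i = length us} a i) (x (take i t)) =
          (if g i = length us then smul (a i) (x (take i (h us))) else 0)"
        proof (cases "g i = length us")
          case True
          then have "i \<le> length (h us)" using c_iff[OF i, of "length us"] h[OF us(1)] by simp
          then show ?thesis using True by (simp add: restr_def t_def)
        qed (simp add: restr_def)
      qed
      also have "\<dots> = z us" unfolding z_def by (rule sum.inter_filter[symmetric]) simp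
      finally have "\<bar>norm (z us) - r (restr {i. g i = length us} a)\<bar> < \<eta>"
        using approx[OF t, of "restr {i. g i = length us} a"] aM M by (simp add: restr_def)
      then show ?thesis using a[of "length us"] us(2,3) by (simp add: Suc_le_eq)
    qed
    have z_half: "1/2 < norm (z us)" if "us \<in> lists E" "us \<noteq> []" "length us \<le> m" for us
      using z_norm[OF that] \<eta> by linarith
    have "normalized_null_tree V \<Phi> m E leE y"
      unfolding normalized_null_tree_def
    proof (intro conjI ballI impI)
      fix us assume us: "us \<in> lists E" "us \<noteq> []" "length us \<le> m"
      have xV: "x (take i (h us)) \<in> V" if i: "i \<in> {1..N}" "g i = length us" for i
      proof -
        have "i \<le> length (h us)" using c_iff[OF i(1), of "length us"] i h[OF us(1)] by simp
        then have "take i (h us) \<noteq> []" "length (take i (h us)) \<le> N" "take i (h us) \<in> lists D"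
          using i h[OF us(1)] by (auto dest: in_set_takeD)
        then show ?thesis using x unfolding normalized_null_tree_def by blast
      qed
      have sumV: "(\<Sum>i\<in>I. v i) \<in> V" if "finite I" "\<And>i. i \<in> I \<Longrightarrow> v i \<in> V" for I :: "nat set" and v
        using that by (induction I rule: finite_induct) (auto intro: V)
      have "z us \<in> V" unfolding z_def by (rule sumV) (auto intro!: V(3) xV)
      then show "y us \<in> V" unfolding y_def by (rule V)
      have "z us \<noteq> 0" using z_half[OF us] by auto
      then show "norm (y us) = 1" by (simp add: y_def norm_smul norm_divide)
    next
      fix us assume us: "us \<in> lists E" "length us < m"
      show "null_net \<Phi> E leE (\<lambda>A. y (us @ [A]))"
        unfolding null_net_def tendsto_iff eventually_tails[OF E]
      proof (intro ballI allI impI)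
        fix \<phi> and e :: real assume \<phi>: "\<phi> \<in> \<Phi>" and e: "0 < e"
        interpret \<phi>: Vector_Spaces.linear smul "(*)" \<phi> by (rule \<Phi>[OF \<phi>])
        obtain k :: nat where k: "2 * M / e < real k" using reals_Archimedean2 by blast
        have "dist (\<phi> (y (us @ [A]))) 0 < e" if A: "A \<in> E" "leE ({\<phi>}, k) A" for A
        proof -
          let ?vs = "us @ [A]" and ?j = "Suc (length us)"
          let ?w = "ext (h us) (c ?j - c (length us)) A"
          have vs: "?vs \<in> lists E" "?vs \<noteq> []" "length ?vs \<le> m" using us A by auto
          have w: "good (h us) (c ?j - c (length us)) A ?w"
            using h[OF us(1)] us A c_le c_mono[of "length us" ?j] by (intro good) auto
          have small: "norm (\<phi> (x (take i (h ?vs)))) \<le> 1 / real (Suc k)"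
            if i: "i \<in> {1..N}" "g i = ?j" for i
          proof -
            have "i \<le> c ?j" "\<not> i \<le> c (length us)"
              using c_iff[OF i(1), of ?j] c_iff[OF i(1), of "length us"] i by auto
            then have "take i (h ?vs) = h us @ take (i - c (length us)) ?w"
              using h[OF us(1)] by (simp add: h_snoc)
            moreover have "i - c (length us) \<in> {1..c ?j - c (length us)}"
              using \<open>i \<le> c ?j\<close> \<open>\<not> i \<le> c (length us)\<close> unfolding atLeastAtMost_iff by linarith
            ultimately have "norm (\<phi> (x (take i (h ?vs)))) < 1 / real (Suc (snd A))"
              using w A unfolding good_def leE_def by auto
            also have "\<dots> \<le> 1 / real (Suc k)"
              using A by (intro divide_left_mono) (auto simp: leE_def)
            finally show ?thesis by simp
          qed
          have "norm (\<phi> (z ?vs)) = norm (\<Sum>i\<in>{i\<in>{1..N}. g i = ?j}. a i * \<phi> (x (take i (h ?vs))))"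
            by (simp add: z_def \<phi>.sum \<phi>.scale)
          also have "\<dots> \<le> (\<Sum>i\<in>{i\<in>{1..N}. g i = ?j}. norm (a i) * (1 / real (Suc k)))"
          proof (rule sum_norm_le)
            fix i assume "i \<in> {i \<in> {1..N}. g i = ?j}"
            then show "norm (a i * \<phi> (x (take i (h ?vs)))) \<le> norm (a i) * (1 / real (Suc k))"
              unfolding norm_mult using small[of i] by (intro mult_left_mono) auto
          qed
          also have "\<dots> \<le> (\<Sum>i\<in>{1..N}. norm (a i) * (1 / real (Suc k)))"
            by (rule sum_mono2) auto
          also have "\<dots> \<le> M * (1 / real (Suc k))"
            unfolding sum_distrib_right[symmetric] M_def by (intro mult_right_mono) auto
          finally have *: "norm (\<phi> (z ?vs)) \<le> M / real (Suc k)" by simp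
          have "norm (\<phi> (y ?vs)) = norm (\<phi> (z ?vs)) / norm (z ?vs)"
            by (simp add: y_def \<phi>.scale norm_mult norm_divide)
          also have "\<dots> \<le> (M / real (Suc k)) / (1/2)"
            using * z_half[OF vs] M by (intro frac_le) auto
          also have "\<dots> < e"
          proof -
            have "2 * M < real k * e" using k e by (simp add: field_simps)
            also have "\<dots> \<le> real (Suc k) * e" using e by (intro mult_right_mono) auto
            finally show ?thesis by (simp add: field_simps)
          qed
          finally show ?thesis by (simp add: dist_norm)
        qed
        moreover have "({\<phi>}, k) \<in> E" using \<phi> by (simp add: E_def)
        ultimately show "\<exists>d\<in>E. \<forall>u\<in>E. leE d u \<longrightarrow> dist (\<phi> (y (us @ [u]))) 0 < e" by blast
      qed
    qed
    moreover have "approximates smul m E y \<delta> (block_norm r g a)"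
      unfolding approximates_def
    proof (intro ballI allI impI)
      fix us d assume us: "us \<in> lists E" "length us = m" and d: "\<forall>i\<in>{1..m}. norm (d i :: 'k) \<le> 1"
      have t: "h us \<in> lists D" "length (h us) = N" using h[OF us(1)] us(2) c_m by auto
      have zt: "z (take j us) = (\<Sum>i\<in>{i\<in>{1..N}. g i = j}. smul (a i) (x (take i (h us))))"
        if j: "j \<in> {1..m}" for j
        unfolding z_def
      proof (rule sum.cong)
        show "{i \<in> {1..N}. g i = length (take j us)} = {i \<in> {1..N}. g i = j}" using j us(2) by auto
        fix i assume "i \<in> {i \<in> {1..N}. g i = j}"
        then have "i \<le> c j" using c_iff[of i j] by auto
        then show "smul (a i) (x (take i (h (take j us)))) = smul (a i) (x (take i (h us)))"
          using h_take[OF us(1), of j] j us(2) by (simp add: min_def)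
      qed
      have "(\<Sum>j=1..m. smul (d j) (z (take j us))) =
          (\<Sum>j=1..m. \<Sum>i\<in>{i\<in>{1..N}. g i = j}. smul (d (g i) * a i) (x (take i (h us))))"
        by (rule sum.cong[OF refl]) (auto simp: zt scale_sum_right intro!: sum.cong)
      also have "\<dots> = (\<Sum>i=1..N. smul (d (g i) * a i) (x (take i (h us))))"
        using g(2) by (intro sum.group) auto
      finally have zsum: "(\<Sum>j=1..m. smul (d j) (z (take j us))) = \<dots>" .
      have "norm (d (g i) * a i) \<le> M" if i: "i \<in> {1..N}" for i
      proof -
        have "norm (d (g i)) * norm (a i) \<le> 1 * norm (a i)"
          using d gin[OF i] by (intro mult_right_mono) auto
        then show ?thesis using aM[OF i] by (simp add: norm_mult)
      qed
      then have 1: "\<bar>norm (\<Sum>j=1..m. smul (d j) (z (take j us))) - block_norm r g a d\<bar> < \<eta>"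
        unfolding zsum block_norm_def by (intro approx t)
      have "norm ((\<Sum>j=1..m. smul (d j) (y (take j us))) - (\<Sum>j=1..m. smul (d j) (z (take j us))))
          = norm (\<Sum>j=1..m. smul (d j) (y (take j us) - z (take j us)))"
        by (simp add: scale_right_diff_distrib sum_subtractf)
      also have "\<dots> \<le> (\<Sum>j=1..m. \<eta>)"
      proof (rule sum_norm_le)
        fix j assume j: "j \<in> {1..m}"
        let ?z = "z (take j us)"
        have tj: "take j us \<in> lists E" "take j us \<noteq> []" "length (take j us) \<le> m"
          using us j by (auto dest: in_set_takeD)
        have nz: "norm ?z > 0" using z_half[OF tj] by linarith
        have "y (take j us) - ?z = smul (of_real (1 / norm ?z - 1)) ?z"
          by (simp add: y_def scale_left_diff_distrib)
        then have "norm (y (take j us) - ?z) = \<bar>1 / norm ?z - 1\<bar> * norm ?z"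
          by (simp only: norm_smul norm_of_real)
        also have "\<dots> = \<bar>(1 / norm ?z - 1) * norm ?z\<bar>" by (simp add: abs_mult)
        also have "(1 / norm ?z - 1) * norm ?z = 1 - norm ?z" using nz by (simp add: field_simps)
        finally have "norm (y (take j us) - ?z) \<le> \<eta>" using z_norm[OF tj] by linarith
        moreover have "norm (d j) \<le> 1" using d j by blast
        ultimately have "norm (d j) * norm (y (take j us) - ?z) \<le> 1 * \<eta>"
          by (intro mult_mono) auto
        then show "norm (smul (d j) (y (take j us) - ?z)) \<le> \<eta>" by (simp add: norm_smul)
      qed
      finally have 2: "norm ((\<Sum>j=1..m. smul (d j) (y (take j us))) -
          (\<Sum>j=1..m. smul (d j) (z (take j us)))) \<le> m * \<eta>" by simp
      have "m * \<eta> + \<eta> \<le> \<delta>" using \<eta>(3) by (simp add: algebra_simps)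
      then show "\<bar>norm (\<Sum>j=1..m. smul (d j) (y (take j us))) - block_norm r g a d\<bar> < \<delta>"
        using 1 2 norm_triangle_ineq3[of "\<Sum>j=1..m. smul (d j) (y (take j us))" "\<Sum>j=1..m. smul (d j) (z (take j us))"]
        by linarith
    qed
    ultimately show "\<exists>(D :: 'v set set) le x. directed D le \<and> normalized_null_tree V \<Phi> m D le x \<and>
        approximates smul m D x \<delta> (block_norm r g a)"
      using directed_set_irrelevant[OF E] by blast
  qed
qed

section \<open>From block estimates to power-type estimates\<close>

lemma exists_initial_segment:
  assumes "A \<subseteq> {1..N :: nat}" "q \<le> card A"
  shows "\<exists>c. card (A \<inter> {..c}) = q"
  using assms(2)
proof (induction q)
  case 0
  have "A \<inter> {..0} = {}" using assms(1) by auto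
  then show ?case by (metis card.empty)
next
  case (Suc q)
  have fin: "finite A" using assms(1) finite_subset by blast
  obtain c where c: "card (A \<inter> {..c}) = q" using Suc by auto
  let ?B = "A \<inter> {c<..}"
  have "?B \<noteq> {}"
  proof
    assume "?B = {}"
    then have "A \<inter> {..c} = A" by auto
    then show False using c Suc.prems by simp
  qed
  then have Min: "Min ?B \<in> ?B" "\<And>i. i \<in> ?B \<Longrightarrow> Min ?B \<le> i" using fin by (simp_all del: Int_iff)
  have "A \<inter> {..Min ?B} = insert (Min ?B) (A \<inter> {..c})"
  proof (intro set_eqI iffI)
    fix i assume "i \<in> A \<inter> {..Min ?B}"
    then show "i \<in> insert (Min ?B) (A \<inter> {..c})" using Min(2)[of i] by force
  next
    fix i assume "i \<in> insert (Min ?B) (A \<inter> {..c})"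
    then show "i \<in> A \<inter> {..Min ?B}" using Min(1) by auto
  qed
  then have "card (A \<inter> {..Min ?B}) = Suc q" using c fin Min(1) by simp
  then show ?case by blast
qed

text \<open>
  The first block ends at the \<open>q\<close>-th element of \<open>A\<close>; the rest is cut by induction.
\<close>
lemma exists_block_partition:
  assumes "1 \<le> m" "A \<subseteq> {1..N :: nat}" "m * q \<le> card A"
  shows "\<exists>g. mono_on {1..N} g \<and> g ` {1..N} \<subseteq> {1..m} \<and> (\<forall>j\<in>{1..m}. q \<le> card {i \<in> A. g i = j})"
  using assms
proof (induction m arbitrary: A rule: nat_induct_at_least)
  case base
  then show ?case by (intro exI[of _ "\<lambda>_. 1"]) (auto simp: mono_on_def)
next
  case (Suc m)
  have fin: "finite A" using Suc.prems(1) finite_subset by blast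
  obtain c where c: "card (A \<inter> {..c}) = q"
    using exists_initial_segment[OF Suc.prems(1), of q] Suc.prems(2) by auto
  have "A = A \<inter> {..c} \<union> A \<inter> {c<..}" "A \<inter> {..c} \<inter> (A \<inter> {c<..}) = {}" by auto
  then have card_A: "card A = q + card (A \<inter> {c<..})"
    using card_Un_disjoint[of "A \<inter> {..c}" "A \<inter> {c<..}"] fin c by auto
  obtain g where g: "mono_on {1..N} g" "g ` {1..N} \<subseteq> {1..m}"
    "\<And>j. j \<in> {1..m} \<Longrightarrow> q \<le> card {i \<in> A \<inter> {c<..}. g i = j}"
  proof -
    have "A \<inter> {c<..} \<subseteq> {1..N}" "m * q \<le> card (A \<inter> {c<..})"
      using Suc.prems card_A by auto
    from Suc.IH[OF this] show ?thesis using that by blast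
  qed
  have gin: "1 \<le> g i \<and> g i \<le> m" if "i \<in> {1..N}" for i
  proof -
    have "g i \<in> {1..m}" using g(2) that by blast
    then show ?thesis by simp
  qed
  let ?h = "\<lambda>i. if i \<le> c then 1 else Suc (g i)"
  have "mono_on {1..N} ?h"
  proof (rule mono_onI)
    fix i j assume "i \<in> {1..N}" "j \<in> {1..N}" "i \<le> j"
    then show "?h i \<le> ?h j" using mono_onD[OF g(1), of i j] by auto
  qed
  moreover have "?h ` {1..N} \<subseteq> {1..Suc m}"
  proof (rule image_subsetI)
    fix i assume "i \<in> {1..N}"
    then show "?h i \<in> {1..Suc m}" using gin[of i] by auto
  qed
  moreover have "q \<le> card {i \<in> A. ?h i = j}" if j: "j \<in> {1..Suc m}" for j
  proof (cases "j = 1")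
    case True
    have "A \<inter> {..c} \<subseteq> {i \<in> A. ?h i = j}" using True by auto
    then show ?thesis using c fin card_mono[of "{i \<in> A. ?h i = j}" "A \<inter> {..c}"] by auto
  next
    case False
    then have j': "j - 1 \<in> {1..m}" using j by auto
    have "{i \<in> A \<inter> {c<..}. g i = j - 1} \<subseteq> {i \<in> A. ?h i = j}" using False j by auto
    then have "card {i \<in> A \<inter> {c<..}. g i = j - 1} \<le> card {i \<in> A. ?h i = j}"
      using fin by (intro card_mono) auto
    then show ?thesis using g(3)[OF j'] by linarith
  qed
  ultimately show ?case by blast
qed

text \<open>
  Only nonzero blocks occur in the two block estimates because only these can be normalised.
\<close>
definition upper_block_estimate :: "nat \<Rightarrow> real \<Rightarrow> nat \<Rightarrow> ((nat \<Rightarrow> 'k::real_normed_field) \<Rightarrow> real) \<Rightarrow> bool" where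
  "upper_block_estimate m \<kappa> N r \<longleftrightarrow> (\<forall>g a M. mono_on {1..N} g \<longrightarrow> g ` {1..N} \<subseteq> {1..m} \<longrightarrow>
     (\<forall>j\<in>{1..m}. 0 < r (restr {i. g i = j} a) \<and> r (restr {i. g i = j} a) \<le> M) \<longrightarrow> r a \<le> \<kappa> * M)"

definition lower_block_estimate :: "nat \<Rightarrow> real \<Rightarrow> nat \<Rightarrow> ((nat \<Rightarrow> 'k::real_normed_field) \<Rightarrow> real) \<Rightarrow> bool" where
  "lower_block_estimate m \<rho> N r \<longleftrightarrow> (\<forall>g a M. mono_on {1..N} g \<longrightarrow> g ` {1..N} \<subseteq> {1..m} \<longrightarrow>
     0 < M \<longrightarrow> (\<forall>j\<in>{1..m}. M \<le> r (restr {i. g i = j} a)) \<longrightarrow> \<rho> * M \<le> r a)"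

text \<open>
  Let \<open>B\<^sub>k\<close> be the best bound for vectors with at most \<open>m\<^sup>k\<close> nonzero coordinates of modulus at most 1.
  A vector with \<open>m q + s\<close> nonzero coordinates, \<open>s < m\<close>, is a sum of \<open>m\<close> consecutive blocks with
  exactly \<open>q\<close> nonzero coordinates each, and of a remainder of norm at most \<open>m\<close>. This gives
  \<open>B\<^sub>k\<^sub>+\<^sub>1 \<le> \<kappa> B\<^sub>k + m\<close>, and \<open>(1 + L) \<kappa>\<^sup>k - L\<close> is the solution of this recursion that starts at 1. That
  all \<open>m\<close> blocks have the same number of coordinates, and not just at most that number, makes them
  nonzero.
\<close>
lemma upper_block_estimate_growth:
  assumes r: "norm_on N r" "monotone_normalized N r" and ube: "upper_block_estimate m \<kappa> N r"
    and m: "2 \<le> m" and \<kappa>: "1 < \<kappa>" and b: "0 \<le> b"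
  defines "L \<equiv> m / (\<kappa> - 1)"
  shows "card {i \<in> {1..N}. a i \<noteq> 0} \<le> m ^ k \<Longrightarrow> (\<And>i. i \<in> {1..N} \<Longrightarrow> norm (a i) \<le> b) \<Longrightarrow>
    r a \<le> b * ((1 + L) * \<kappa> ^ k - L)"
proof (induction k arbitrary: a)
  case 0
  have "r a \<le> b * real (card {i \<in> {1..N}. a i \<noteq> 0})"
    by (rule norm_on_le_support[OF r 0(2)])
  also have "\<dots> \<le> b * 1" using 0(1) b by (intro mult_left_mono) auto
  finally show ?case by simp
next
  case (Suc k)
  define B where "B = (1 + L) * \<kappa> ^ k - L"
  have L: "L * (\<kappa> - 1) = m" "0 \<le> L" using \<kappa> by (auto simp: L_def)
  have step: "(1 + L) * \<kappa> ^ Suc k - L = \<kappa> * B + m"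
    using L(1) by (simp add: B_def algebra_simps)
  have "(1 + L) * 1 \<le> (1 + L) * \<kappa> ^ k" using L \<kappa> by (intro mult_left_mono) auto
  then have B: "1 \<le> B" by (simp add: B_def)
  define A where "A = {i \<in> {1..N}. a i \<noteq> 0}"
  define q where "q = card A div m"
  have A: "A \<subseteq> {1..N}" "finite A" by (auto simp: A_def)
  show ?case
  proof (cases "q = 0")
    case True
    then have "card A < m" using m by (auto simp: q_def div_eq_0_iff)
    have "r a \<le> b * real (card A)"
      unfolding A_def by (rule norm_on_le_support[OF r Suc.prems(2)])
    also have "\<dots> \<le> b * (\<kappa> * B + m)"
    proof (rule mult_left_mono[OF _ b])
      have "0 \<le> \<kappa> * B" using B \<kappa> by simp
      then show "real (card A) \<le> \<kappa> * B + m" using \<open>card A < m\<close> by simp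
    qed
    finally show ?thesis unfolding step .
  next
    case False
    have mq: "m * q \<le> card A" "card A < m * q + m"
    proof -
      have "card A mod m < m" using m by simp
      then show "card A < m * q + m"
        using mult_div_mod_eq[of m "card A"] unfolding q_def by linarith
      show "m * q \<le> card A" by (simp add: q_def)
    qed
    have qk: "q \<le> m ^ k"
    proof -
      have "q \<le> (m * m ^ k) div m"
        unfolding q_def using Suc.prems(1) by (intro div_le_mono) (simp add: A_def)
      then show ?thesis using m by simp
    qed
    obtain c where c: "card (A \<inter> {..c}) = m * q" using exists_initial_segment[OF A(1) mq(1)] by blast
    define a1 a2 where "a1 = restr {..c} a" and "a2 = restr {c<..} a"
    have a12: "a = (\<lambda>i. a1 i + a2 i)" by (auto simp: a1_def a2_def restr_def)
    have "A = A \<inter> {..c} \<union> A \<inter> {c<..}" "A \<inter> {..c} \<inter> (A \<inter> {c<..}) = {}" by auto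
    then have "card A = m * q + card (A \<inter> {c<..})"
      using card_Un_disjoint[of "A \<inter> {..c}" "A \<inter> {c<..}"] A(2) c by auto
    moreover have "{i \<in> {1..N}. a2 i \<noteq> 0} = A \<inter> {c<..}" by (auto simp: a2_def restr_def A_def)
    ultimately have card2: "card {i \<in> {1..N}. a2 i \<noteq> 0} < m" using mq by simp
    have "r a2 \<le> b * real (card {i \<in> {1..N}. a2 i \<noteq> 0})"
      using Suc.prems(2) b by (intro norm_on_le_support[OF r]) (simp add: a2_def restr_def)
    also have "\<dots> \<le> b * m" using card2 b by (intro mult_left_mono) auto
    finally have r2: "r a2 \<le> b * m" .
    obtain g where g: "mono_on {1..N} g" "g ` {1..N} \<subseteq> {1..m}"
      "\<And>j. j \<in> {1..m} \<Longrightarrow> q \<le> card {i \<in> A \<inter> {..c}. g i = j}"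
    proof -
      have "1 \<le> m" "A \<inter> {..c} \<subseteq> {1..N}" "m * q \<le> card (A \<inter> {..c})" using m A(1) c by auto
      from exists_block_partition[OF this] show ?thesis using that by blast
    qed
    have sum_card: "(\<Sum>j\<in>{1..m}. card {i \<in> A \<inter> {..c}. g i = j}) = m * q"
    proof -
      have "(\<Sum>j\<in>{1..m}. \<Sum>i\<in>{i \<in> A \<inter> {..c}. g i = j}. (1::nat)) = (\<Sum>i\<in>A \<inter> {..c}. 1)"
        using g(2) A by (intro sum.group) auto
      then show ?thesis using c by simp
    qed
    have card_q: "card {i \<in> A \<inter> {..c}. g i = j} = q" if j: "j \<in> {1..m}" for j
    proof -
      have "(\<Sum>j\<in>{1..m} - {j}. q) \<le> (\<Sum>j\<in>{1..m} - {j}. card {i \<in> A \<inter> {..c}. g i = j})"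
        using g(3) by (intro sum_mono) auto
      moreover have "(\<Sum>j\<in>{1..m} - {j}. q) + q = m * q" using j by (simp add: mult_eq_if)
      moreover have "card {i \<in> A \<inter> {..c}. g i = j} + (\<Sum>j\<in>{1..m} - {j}. card {i \<in> A \<inter> {..c}. g i = j}) = m * q"
        using sum_card sum.remove[OF _ j, of "\<lambda>j. card {i \<in> A \<inter> {..c}. g i = j}"] by simp
      ultimately show ?thesis using g(3)[OF j] by linarith
    qed
    have "r a1 \<le> \<kappa> * (b * B)"
    proof (rule ube[unfolded upper_block_estimate_def, rule_format, OF g(1,2)], intro conjI)
      fix j assume j: "j \<in> {1..m}"
      have supp: "{i \<in> {1..N}. restr {i. g i = j} a1 i \<noteq> 0} = {i \<in> A \<inter> {..c}. g i = j}"
        by (auto simp: a1_def restr_def A_def)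
      then have "card {i \<in> {1..N}. restr {i. g i = j} a1 i \<noteq> 0} = q" using card_q[OF j] by simp
      then show "r (restr {i. g i = j} a1) \<le> b * B"
        unfolding B_def using qk Suc.prems(2) b by (intro Suc.IH) (auto simp: a1_def restr_def)
      have "{i \<in> {1..N}. restr {i. g i = j} a1 i \<noteq> 0} \<noteq> {}"
        using supp card_q[OF j] False by (metis card.empty)
      then show "0 < r (restr {i. g i = j} a1)" using norm_on_pos[OF r(1)] by blast
    qed
    then have "r a \<le> \<kappa> * (b * B) + b * m"
      using r2 norm_on_triangle[OF r(1), of a1 a2] unfolding a12[symmetric] by linarith
    then show ?thesis unfolding step by (simp add: algebra_simps)
  qed
qed

text \<open>
  Let \<open>a\<close> have \<open>\<ell>\<^sub>p\<close>-norm 1, where \<open>m = \<mu>\<^sup>p\<close>. At most \<open>m\<^sup>l\<close> coordinates are larger than \<open>\<mu>\<^sup>-\<^sup>l\<close>, so the part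
  of \<open>a\<close> with moduli between \<open>\<mu>\<^sup>-\<^sup>l\<^sup>-\<^sup>1\<close> and \<open>\<mu>\<^sup>-\<^sup>l\<close> has norm of order \<open>\<mu>\<^sup>-\<^sup>l \<kappa>\<^sup>l\<^sup>+\<^sup>1\<close>, which is summable
  as soon as \<open>\<kappa> < \<mu>\<close>. The bound \<open>p \<le> 2\<close> allows comparing \<open>L\<^sub>p\<close>-averages with square averages.
\<close>
lemma upper_block_estimate_imp_type:
  fixes m :: nat and \<kappa> :: real
  assumes m: "2 \<le> m" and \<kappa>: "1 < \<kappa>" "\<kappa> < m"
  shows "\<exists>p>1. p \<le> 2 \<and> (\<exists>K>0. \<forall>N r (a :: nat \<Rightarrow> 'k::real_normed_field).
    norm_on N r \<longrightarrow> monotone_normalized N r \<longrightarrow> upper_block_estimate m \<kappa> N r \<longrightarrow> r a \<le> K * lp_norm p N a)"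
proof -
  \<comment> \<open>\<open>\<mu> < m\<close> gives \<open>p > 1\<close>, and \<open>\<mu> \<ge> sqrt m\<close> gives \<open>p \<le> 2\<close>.\<close>
  define \<mu> where "\<mu> = max ((\<kappa> + m) / 2) (sqrt m)"
  have "sqrt m < sqrt (real m * real m)" using m by (intro real_sqrt_less_mono) auto
  then have \<mu>: "1 < \<mu>" "\<kappa> < \<mu>" "\<mu> < m" "sqrt m \<le> \<mu>"
  proof -
    have "(\<kappa> + m) / 2 \<le> \<mu>" "sqrt m \<le> \<mu>" unfolding \<mu>_def by simp_all
    then show "1 < \<mu>" "\<kappa> < \<mu>" using \<kappa> by (simp_all add: field_simps)
    show "sqrt m \<le> \<mu>" by fact
    show "\<mu> < m" unfolding \<mu>_def using \<kappa> \<open>sqrt m < sqrt (real m * real m)\<close> by simp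
  qed
  define p where "p = ln m / ln \<mu>"
  have "1 < p" using \<mu> by (simp add: p_def)
  have "ln m \<le> ln (\<mu>\<^sup>2)"
  proof (subst ln_le_cancel_iff)
    have "(sqrt m)\<^sup>2 \<le> \<mu>\<^sup>2" using \<mu> by (intro power_mono) auto
    then show "m \<le> \<mu>\<^sup>2" by simp
  qed (use m \<mu> in auto)
  then have "p \<le> 2" using \<mu> by (simp add: p_def ln_realpow pos_divide_le_eq)
  have \<mu>p: "\<mu> powr p = m" using \<mu> by (simp add: p_def powr_def)
  define L where "L = m / (\<kappa> - 1)"
  define K where "K = 1 + (1 + L) * \<kappa> / (1 - \<kappa> / \<mu>)"
  have L: "0 \<le> L" using \<kappa> by (simp add: L_def)
  have ratio: "0 < 1 - \<kappa> / \<mu>" using \<mu> by simp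
  have K: "0 < K" using L ratio \<kappa> by (simp add: K_def add_pos_nonneg)
  have main: "r a \<le> K"
    if r: "norm_on N r" "monotone_normalized N r" and ube: "upper_block_estimate m \<kappa> N r"
      and a: "lp_norm p N a = 1" for N r and a :: "nat \<Rightarrow> 'k"
  proof -
    have a1: "(\<Sum>i=1..N. norm (a i) powr p) = 1" using sum_powr_eq_1[OF _ a] \<open>1 < p\<close> by simp
    have card: "card {i \<in> {1..N}. (1 / \<mu>) ^ l < norm (a i)} \<le> m ^ l" (is "card ?A \<le> _") for l
    proof -
      have "real (card ?A) * (1 / m) ^ l = (\<Sum>i\<in>?A. (1 / m) ^ l)" by simp
      also have "\<dots> \<le> (\<Sum>i\<in>?A. norm (a i) powr p)"
      proof (rule sum_mono)
        fix i assume "i \<in> ?A"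
        have "(1 / m) ^ l = ((1 / \<mu>) ^ l) powr p"
        proof -
          have "((1 / \<mu>) ^ l) powr p = ((1 / \<mu>) powr p) ^ l"
            using \<mu> by (simp add: powr_power powr_powr mult.commute flip: powr_realpow)
          also have "(1 / \<mu>) powr p = 1 / m" using \<mu> \<mu>p by (simp add: powr_divide)
          finally show ?thesis by simp
        qed
        also have "\<dots> \<le> norm (a i) powr p"
          using \<open>i \<in> ?A\<close> \<open>1 < p\<close> \<mu> by (intro powr_mono2) auto
        finally show "(1 / m) ^ l \<le> norm (a i) powr p" .
      qed
      also have "\<dots> \<le> 1" unfolding a1[symmetric] by (intro sum_mono2) auto
      finally have "real (card ?A) \<le> real (m ^ l)" using m by (simp add: field_simps)
      then show ?thesis by linarith
    qed
    have le1: "norm (a i) \<le> 1" if i: "i \<in> {1..N}" for i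
    proof -
      have "norm (a i) powr p \<le> 1"
        unfolding a1[symmetric] using i by (intro member_le_sum) auto
      then show ?thesis using \<open>1 < p\<close> by (metis linorder_not_less gr_one_powr less_trans zero_less_one)
    qed
    have level: "r (restr {i. (1 / \<mu>) ^ l < norm (a i)} a) \<le> (\<Sum>k<l. (1 + L) * \<kappa> * (\<kappa> / \<mu>) ^ k)" for l
    proof (induction l)
      case 0
      have "\<not> 1 < norm (a i)" if "i \<in> {1..N}" for i using le1[OF that] by simp
      then have "r (restr {i. (1 / \<mu>) ^ 0 < norm (a i)} a) = 0"
        unfolding norm_on_eq_0[OF r(1)] by (simp add: restr_def)
      then show ?case by simp
    next
      case (Suc l)
      let ?A = "{i. (1 / \<mu>) ^ l < norm (a i)}" and ?B = "{i. (1 / \<mu>) ^ Suc l < norm (a i)}"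
      have "(1 / \<mu>) ^ Suc l \<le> (1 / \<mu>) ^ l" using \<mu> by (intro power_decreasing) auto
      then have "restr ?B a = (\<lambda>i. restr ?A a i + restr (?B - ?A) a i)"
        by (fastforce simp: restr_def)
      then have "r (restr ?B a) \<le> r (restr ?A a) + r (restr (?B - ?A) a)"
        using norm_on_triangle[OF r(1)] by metis
      moreover have "r (restr (?B - ?A) a) \<le> (1 / \<mu>) ^ l * ((1 + L) * \<kappa> ^ Suc l - L)"
        unfolding L_def
      proof (rule upper_block_estimate_growth[OF r ube m \<kappa>(1)])
        have "card {i \<in> {1..N}. restr (?B - ?A) a i \<noteq> 0} \<le> card {i \<in> {1..N}. (1 / \<mu>) ^ Suc l < norm (a i)}"
          by (intro card_mono) (auto simp: restr_def)
        then show "card {i \<in> {1..N}. restr (?B - ?A) a i \<noteq> 0} \<le> m ^ Suc l" using card[of "Suc l"] by linarith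
      qed (use \<mu> in \<open>auto simp: restr_def\<close>)
      moreover have "(1 / \<mu>) ^ l * ((1 + L) * \<kappa> ^ Suc l - L) \<le> (1 / \<mu>) ^ l * ((1 + L) * \<kappa> ^ Suc l)"
        using \<mu> L by (intro mult_left_mono) auto
      moreover have "(1 / \<mu>) ^ l * ((1 + L) * \<kappa> ^ Suc l) = (1 + L) * \<kappa> * (\<kappa> / \<mu>) ^ l"
        by (simp add: power_divide)
      ultimately show ?case using Suc unfolding sum.lessThan_Suc by linarith
    qed
    have geo: "(\<Sum>k<l. (1 + L) * \<kappa> * (\<kappa> / \<mu>) ^ k) \<le> K" for l
    proof -
      have "(\<Sum>k<l. (\<kappa> / \<mu>) ^ k) \<le> (\<Sum>k. (\<kappa> / \<mu>) ^ k)"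
        using \<mu> \<kappa> by (intro sum_le_suminf) (auto intro!: summable_geometric)
      also have "\<dots> = 1 / (1 - \<kappa> / \<mu>)" using \<mu> \<kappa> by (intro suminf_geometric) auto
      finally have "(1 + L) * \<kappa> * (\<Sum>k<l. (\<kappa> / \<mu>) ^ k) \<le> (1 + L) * \<kappa> * (1 / (1 - \<kappa> / \<mu>))"
        using L \<kappa> by (intro mult_left_mono) auto
      then show ?thesis by (simp add: K_def sum_distrib_left)
    qed
    have "\<exists>l. \<forall>i\<in>{1..N}. a i \<noteq> 0 \<longrightarrow> (1 / \<mu>) ^ l < norm (a i)"
    proof -
      have "eventually (\<lambda>l. a i \<noteq> 0 \<longrightarrow> (1 / \<mu>) ^ l < norm (a i)) sequentially" for i
      proof (cases "a i = 0")
        case False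
        have "(\<lambda>l. (1 / \<mu>) ^ l) \<longlonglongrightarrow> 0" using \<mu> by (intro LIMSEQ_power_zero) auto
        then have "eventually (\<lambda>l. (1 / \<mu>) ^ l < norm (a i)) sequentially"
          using False by (intro order_tendstoD(2)) auto
        then show ?thesis by (rule eventually_mono) simp
      qed simp
      then have "eventually (\<lambda>l. \<forall>i\<in>{1..N}. a i \<noteq> 0 \<longrightarrow> (1 / \<mu>) ^ l < norm (a i)) sequentially"
        by (intro eventually_ball_finite) auto
      then show ?thesis by (auto dest: eventually_happens)
    qed
    then obtain l where l: "\<And>i. i \<in> {1..N} \<Longrightarrow> a i \<noteq> 0 \<Longrightarrow> (1 / \<mu>) ^ l < norm (a i)" by blast
    have "r a = r (restr {i. (1 / \<mu>) ^ l < norm (a i)} a)"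
      using l by (intro norm_on_cong[OF r(1)]) (auto simp: restr_def)
    then show ?thesis using level[of l] geo[of l] by linarith
  qed
  have "r a \<le> K * lp_norm p N a"
    if r: "norm_on N r" "monotone_normalized N r" and ube: "upper_block_estimate m \<kappa> N r"
    for N r and a :: "nat \<Rightarrow> 'k"
  proof (cases "lp_norm p N a = 0")
    case True
    then have "r a = 0"
      unfolding norm_on_eq_0[OF r(1)] using lp_norm_eq_0[of p N a] \<open>1 < p\<close> by auto
    then show ?thesis using True by simp
  next
    case False
    define s where "s = lp_norm p N a"
    have s: "0 < s" using False lp_norm_nonneg[of p N a] by (simp add: s_def)
    let ?c = "of_real (1 / s) :: 'k"
    have "lp_norm p N (\<lambda>i. ?c * a i) = 1"
      using lp_norm_scale[of p N ?c a] \<open>1 < p\<close> s by (simp add: s_def norm_divide)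
    from main[OF r ube this] have "norm ?c * r a \<le> K" unfolding norm_on_scale[OF r(1)] .
    then show ?thesis using s by (simp add: s_def norm_divide field_simps)
  qed
  then show ?thesis using \<open>1 < p\<close> \<open>p \<le> 2\<close> K by blast
qed

text \<open>
  The \<open>m\<^sup>k\<^sup>+\<^sup>1\<close> large coordinates are distributed over \<open>m\<close> consecutive blocks, \<open>m\<^sup>k\<close> to each.
\<close>
lemma lower_block_estimate_growth:
  assumes r: "norm_on N r" "monotone_normalized N r" and lbe: "lower_block_estimate m \<rho> N r"
    and m: "1 \<le> m" and \<rho>: "0 < \<rho>" and b: "0 < b"
  shows "m ^ k \<le> card {i \<in> {1..N}. b \<le> norm (a i)} \<Longrightarrow> \<rho> ^ k * b / 2 \<le> r a"
proof (induction k arbitrary: a)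
  case 0
  have "{i \<in> {1..N}. b \<le> norm (a i)} \<noteq> {}"
  proof
    assume "{i \<in> {1..N}. b \<le> norm (a i)} = {}"
    then show False using 0 by (metis card.empty not_one_le_zero power_0)
  qed
  then obtain i where "i \<in> {1..N}" "b \<le> norm (a i)" by blast
  then show ?case using norm_on_coordinate_le[OF r, of i a] by simp
next
  case (Suc k)
  let ?A = "{i \<in> {1..N}. b \<le> norm (a i)}"
  obtain g where g: "mono_on {1..N} g" "g ` {1..N} \<subseteq> {1..m}"
    "\<And>j. j \<in> {1..m} \<Longrightarrow> m ^ k \<le> card {i \<in> ?A. g i = j}"
  proof -
    have "?A \<subseteq> {1..N}" "m * m ^ k \<le> card ?A" using Suc.prems by auto
    from exists_block_partition[OF m this] show ?thesis using that by blast
  qed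
  have "\<rho> * (\<rho> ^ k * b / 2) \<le> r a"
  proof (rule lbe[unfolded lower_block_estimate_def, rule_format, OF g(1,2)])
    fix j assume j: "j \<in> {1..m}"
    have "{i \<in> {1..N}. b \<le> norm (restr {i. g i = j} a i)} = {i \<in> ?A. g i = j}"
      using b by (auto simp: restr_def)
    then show "\<rho> ^ k * b / 2 \<le> r (restr {i. g i = j} a)"
      using g(3)[OF j] by (intro Suc.IH) simp
  qed (use \<rho> b in simp)
  then show ?case by (simp add: mult.assoc)
qed

text \<open>
  If \<open>r a < 1/2\<close>, then fewer than \<open>m\<^sup>l\<close> coordinates have modulus at least \<open>\<rho>\<^sup>-\<^sup>l\<close>. So the coordinates
  between \<open>\<rho>\<^sup>-\<^sup>l\<^sup>-\<^sup>1\<close> and \<open>\<rho>\<^sup>-\<^sup>l\<close> contribute at most \<open>\<rho>\<^sup>-\<^sup>l\<^sup>q m\<^sup>l\<^sup>+\<^sup>1\<close> to the sum of the \<open>q\<close>-th powers, and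
  \<open>\<rho>\<^sup>q \<ge> 2 m\<close> makes this \<open>m 2\<^sup>-\<^sup>l\<close> or less. The bound \<open>q \<ge> 2\<close> allows comparing \<open>L\<^sub>q\<close>-averages with square
  averages.
\<close>
lemma lower_block_estimate_imp_cotype:
  fixes m :: nat and \<rho> :: real
  assumes m: "1 \<le> m" and \<rho>: "1 < \<rho>"
  shows "\<exists>q\<ge>2. \<exists>K>0. \<forall>N r (a :: nat \<Rightarrow> 'k::real_normed_field).
    norm_on N r \<longrightarrow> monotone_normalized N r \<longrightarrow> lower_block_estimate m \<rho> N r \<longrightarrow> lp_norm q N a \<le> K * r a"
proof -
  define q where "q = max 2 (log \<rho> (2 * m))"
  have q: "2 \<le> q" by (simp add: q_def)
  have "2 * real m = \<rho> powr log \<rho> (2 * m)" using \<rho> m by simp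
  also have "\<dots> \<le> \<rho> powr q" using \<rho> by (intro powr_mono) (auto simp: q_def)
  finally have \<rho>q: "2 * real m \<le> \<rho> powr q" .
  define K where "K = 4 * (2 * m) powr (1 / q)"
  have K: "0 < K" using m by (simp add: K_def)
  have main: "(\<Sum>i=1..N. norm (a i) powr q) \<le> 2 * m"
    if r: "norm_on N r" "monotone_normalized N r" and lbe: "lower_block_estimate m \<rho> N r"
      and a: "r a < 1 / 2" for N r and a :: "nat \<Rightarrow> 'k"
  proof -
    have card: "card {i \<in> {1..N}. (1 / \<rho>) ^ l \<le> norm (a i)} < m ^ l" for l
    proof (rule ccontr)
      assume "\<not> ?thesis"
      then have "\<rho> ^ l * (1 / \<rho>) ^ l / 2 \<le> r a"
        using \<rho> by (intro lower_block_estimate_growth[OF r lbe m]) auto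
      then show False using a \<rho> by (simp add: power_divide)
    qed
    have level: "(\<Sum>i\<in>{i\<in>{1..N}. (1 / \<rho>) ^ l \<le> norm (a i)}. norm (a i) powr q) \<le> (\<Sum>k<l. m * (1 / 2) ^ k)" for l
    proof (induction l)
      case 0
      have "{i\<in>{1..N}. (1 / \<rho>) ^ 0 \<le> norm (a i)} = {}"
        using card[of 0] by (auto simp: card_eq_0_iff)
      then show ?case by (simp only: sum.empty) simp
    next
      case (Suc l)
      let ?A = "{i\<in>{1..N}. (1 / \<rho>) ^ l \<le> norm (a i)}" and ?B = "{i\<in>{1..N}. (1 / \<rho>) ^ Suc l \<le> norm (a i)}"
      have "(1 / \<rho>) ^ Suc l \<le> (1 / \<rho>) ^ l" using \<rho> by (intro power_decreasing) auto
      then have "?A \<subseteq> ?B" by auto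
      have "(\<Sum>i\<in>?B. norm (a i) powr q) = (\<Sum>i\<in>?B - ?A. norm (a i) powr q) + (\<Sum>i\<in>?A. norm (a i) powr q)"
        using \<open>?A \<subseteq> ?B\<close> by (intro sum.subset_diff) auto
      moreover have "(\<Sum>i\<in>?B - ?A. norm (a i) powr q) \<le> (\<Sum>i\<in>?B - ?A. (1 / (2 * m)) ^ l)"
      proof (rule sum_mono)
        fix i assume "i \<in> ?B - ?A"
        then have "norm (a i) powr q \<le> ((1 / \<rho>) ^ l) powr q"
          using q by (intro powr_mono2) auto
        also have "\<dots> = ((1 / \<rho>) powr q) ^ l"
          using \<rho> by (simp add: powr_power powr_powr mult.commute flip: powr_realpow)
        also have "\<dots> \<le> (1 / (2 * m)) ^ l"
          using \<rho> \<rho>q m by (intro power_mono) (auto simp: powr_divide intro!: divide_left_mono)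
        finally show "norm (a i) powr q \<le> (1 / (2 * m)) ^ l" .
      qed
      moreover have "(\<Sum>i\<in>?B - ?A. (1 / (2 * real m)) ^ l) \<le> m * (1 / 2) ^ l"
      proof -
        have "card (?B - ?A) \<le> card ?B" by (intro card_mono) auto
        then have "real (card (?B - ?A)) \<le> real (m ^ Suc l)" using card[of "Suc l"] by linarith
        then have "real (card (?B - ?A)) * (1 / (2 * real m)) ^ l \<le> real (m ^ Suc l) * (1 / (2 * real m)) ^ l"
          by (intro mult_right_mono) auto
        also have "\<dots> = m * (1 / 2) ^ l" using m by (simp add: power_divide power_mult_distrib)
        finally show ?thesis by simp
      qed
      ultimately show ?case using Suc by simp
    qed
    have geo: "(\<Sum>k<l. m * (1 / 2 :: real) ^ k) \<le> 2 * m" for l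
    proof -
      have "(\<Sum>k<l. (1 / 2 :: real) ^ k) \<le> (\<Sum>k. (1 / 2) ^ k)"
        by (intro sum_le_suminf) (auto intro!: summable_geometric)
      also have "\<dots> = 2" by (subst suminf_geometric) auto
      finally have "real m * (\<Sum>k<l. (1 / 2) ^ k) \<le> real m * 2" by (intro mult_left_mono) auto
      then show ?thesis by (simp add: sum_distrib_left mult.commute)
    qed
    have "eventually (\<lambda>l. a i \<noteq> 0 \<longrightarrow> (1 / \<rho>) ^ l \<le> norm (a i)) sequentially" for i
    proof (cases "a i = 0")
      case False
      have "(\<lambda>l. (1 / \<rho>) ^ l) \<longlonglongrightarrow> 0" using \<rho> by (intro LIMSEQ_power_zero) auto
      then have "eventually (\<lambda>l. (1 / \<rho>) ^ l < norm (a i)) sequentially"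
        using False by (intro order_tendstoD(2)) auto
      then show ?thesis by (rule eventually_mono) simp
    qed simp
    then have "eventually (\<lambda>l. \<forall>i\<in>{1..N}. a i \<noteq> 0 \<longrightarrow> (1 / \<rho>) ^ l \<le> norm (a i)) sequentially"
      by (intro eventually_ball_finite) auto
    then obtain l where l: "\<forall>i\<in>{1..N}. a i \<noteq> 0 \<longrightarrow> (1 / \<rho>) ^ l \<le> norm (a i)"
      using eventually_happens[of _ sequentially] by auto
    have "(\<Sum>i=1..N. norm (a i) powr q) = (\<Sum>i\<in>{i\<in>{1..N}. (1 / \<rho>) ^ l \<le> norm (a i)}. norm (a i) powr q)"
      using l by (intro sum.mono_neutral_right) auto
    then show ?thesis using level[of l] geo[of l] by linarith
  qed
  have "lp_norm q N a \<le> K * r a"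
    if r: "norm_on N r" "monotone_normalized N r" and lbe: "lower_block_estimate m \<rho> N r"
    for N r and a :: "nat \<Rightarrow> 'k"
  proof (cases "r a = 0")
    case True
    then have "\<forall>i\<in>{1..N}. a i = 0" unfolding norm_on_eq_0[OF r(1)] .
    then have "lp_norm q N a = 0" by (simp add: lp_norm_def)
    then show ?thesis using True by simp
  next
    case False
    then have ra: "0 < r a" using norm_on_nonneg[OF r(1), of a] by linarith
    let ?c = "of_real (1 / (4 * r a)) :: 'k"
    have c: "norm ?c = 1 / (4 * r a)" using ra by (simp add: norm_divide norm_mult)
    have "r (\<lambda>i. ?c * a i) < 1 / 2" unfolding norm_on_scale[OF r(1)] c using ra by simp
    from main[OF r lbe this] have "lp_norm q N (\<lambda>i. ?c * a i) \<le> (2 * m) powr (1 / q)"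
      unfolding lp_norm_def using q by (intro powr_mono2) (auto intro: sum_nonneg)
    then have "norm ?c * lp_norm q N a \<le> (2 * m) powr (1 / q)"
      using lp_norm_scale[of q N ?c a] q by simp
    then show ?thesis unfolding c K_def using ra by (simp add: field_simps)
  qed
  then show ?thesis using q K by blast
qed

section \<open>Rademacher averages\<close>

definition mean :: "'b set \<Rightarrow> ('b \<Rightarrow> real) \<Rightarrow> real" where
  "mean A f = (\<Sum>x\<in>A. f x) / card A"

lemma mean_mono: "(\<And>x. x \<in> A \<Longrightarrow> f x \<le> g x) \<Longrightarrow> mean A f \<le> mean A g"
  unfolding mean_def by (intro divide_right_mono sum_mono) auto

lemma mean_cong: "(\<And>x. x \<in> A \<Longrightarrow> f x = g x) \<Longrightarrow> mean A f = mean A g"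
  unfolding mean_def by (metis (mono_tags, lifting) sum.cong)

lemma mean_nonneg: "(\<And>x. x \<in> A \<Longrightarrow> 0 \<le> f x) \<Longrightarrow> 0 \<le> mean A f"
  unfolding mean_def by (intro divide_nonneg_nonneg sum_nonneg) auto

lemma mean_add: "mean A (\<lambda>x. f x + g x) = mean A f + mean A g"
  by (simp add: mean_def sum.distrib add_divide_distrib)

lemma mean_sum: "mean A (\<lambda>x. \<Sum>j\<in>J. f j x) = (\<Sum>j\<in>J. mean A (f j))"
  unfolding mean_def by (subst sum.swap) (simp add: sum_divide_distrib)

lemma mean_cmult: "mean A (\<lambda>x. c * f x) = c * mean A f"
  by (simp add: mean_def sum_distrib_left)

lemma mean_const: "finite A \<Longrightarrow> A \<noteq> {} \<Longrightarrow> mean A (\<lambda>_. c) = c"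
  by (simp add: mean_def)

lemma mean_swap: "mean A (\<lambda>x. mean B (f x)) = mean B (\<lambda>y. mean A (\<lambda>x. f x y))"
  unfolding mean_def
  by (simp add: sum_divide_distrib[symmetric] mult.commute sum.swap[of _ A B])

lemma mean_square_le: "(mean A f)\<^sup>2 \<le> mean A (\<lambda>x. (f x)\<^sup>2)"
proof (cases "card A = 0")
  case True
  then show ?thesis by (simp add: mean_def)
next
  case False
  have "(\<Sum>x\<in>A. f x)\<^sup>2 \<le> (\<Sum>x\<in>A. (f x)\<^sup>2) * card A"
    by (rule sum_squared_le_sum_of_squares)
  then show ?thesis using False by (simp add: mean_def power_divide power2_eq_square field_simps)
qed

lemma mean_Cauchy_Schwarz: "(mean A (\<lambda>x. f x * g x))\<^sup>2 \<le> mean A (\<lambda>x. (f x)\<^sup>2) * mean A (\<lambda>x. (g x)\<^sup>2)"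
  using Cauchy_Schwarz_ineq_sum[of f g A]
  by (simp add: mean_def power_divide power2_eq_square divide_right_mono)

lemma mean_eq_0_iff:
  assumes "finite A" "\<And>x. x \<in> A \<Longrightarrow> 0 \<le> f x"
  shows "mean A f = 0 \<longleftrightarrow> (\<forall>x\<in>A. f x = 0)"
  using assms by (auto simp: mean_def sum_nonneg_eq_0_iff)

text \<open>
  After division by the \<open>L\<^sub>q\<close>-norm this is the pointwise inequality \<open>x\<^sup>p \<le> (p/q) x\<^sup>q + (1 - p/q)\<close>.
\<close>
lemma mean_powr_mono:
  assumes A: "finite A" "A \<noteq> {}" and pq: "0 < p" "p \<le> q" and f: "\<And>x. x \<in> A \<Longrightarrow> 0 \<le> f x"
  shows "mean A (\<lambda>x. f x powr p) powr (1 / p) \<le> mean A (\<lambda>x. f x powr q) powr (1 / q)"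
proof (cases "mean A (\<lambda>x. f x powr q) = 0")
  case True
  then have "\<forall>x\<in>A. f x = 0" using mean_eq_0_iff[OF A(1), of "\<lambda>x. f x powr q"] f by auto
  then have "mean A (\<lambda>x. f x powr p) = 0" by (simp add: mean_def)
  then show ?thesis by simp
next
  case False
  define B where "B = mean A (\<lambda>x. f x powr q)"
  have B: "0 < B" using False mean_nonneg[of A "\<lambda>x. f x powr q"] by (simp add: B_def)
  have pw: "f x powr p \<le> B powr (p / q) * ((p / q) * (f x powr q / B) + (1 - p / q))" if "x \<in> A" for x
  proof (cases "f x = 0")
    case True
    then show ?thesis using pq by simp
  next
    case False
    then have fx: "0 < f x" using f[OF that] by simp
    have "(f x powr q / B) powr (p / q) * 1 powr (1 - p / q) \<le> (p / q) * (f x powr q / B) + (1 - p / q) * 1"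
      using pq fx B by (intro Youngs_inequality_0) (auto simp: field_simps)
    then have "B powr (p / q) * (f x powr q / B) powr (p / q)
        \<le> B powr (p / q) * ((p / q) * (f x powr q / B) + (1 - p / q))"
      by (intro mult_left_mono) auto
    moreover have "B powr (p / q) * (f x powr q / B) powr (p / q) = f x powr p"
      using B fx pq by (simp add: powr_divide powr_powr)
    ultimately show ?thesis by simp
  qed
  have "mean A (\<lambda>x. f x powr p) \<le> mean A (\<lambda>x. B powr (p / q) * ((p / q) * (f x powr q / B) + (1 - p / q)))"
    by (rule mean_mono) (rule pw)
  also have "\<dots> = B powr (p / q) * ((p / q) * (1 / B) * B + (1 - p / q))"
  proof -
    have "mean A (\<lambda>x. (p / q) * (f x powr q / B)) = (p / q) * (1 / B) * B"
      using mean_cmult[of A "(p / q) * (1 / B)" "\<lambda>x. f x powr q"] by (simp add: B_def)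
    then show ?thesis unfolding mean_cmult[of A "B powr (p / q)"] mean_add mean_const[OF A] by simp
  qed
  also have "\<dots> = B powr (p / q)" using B by simp
  finally have "mean A (\<lambda>x. f x powr p) powr (1 / p) \<le> (B powr (p / q)) powr (1 / p)"
    using pq by (intro powr_mono2) (auto intro: mean_nonneg)
  also have "\<dots> = B powr (1 / q)" using pq by (simp add: powr_powr)
  finally show ?thesis by (simp add: B_def)
qed

text \<open>
  Minkowski's inequality, in the form that also gives convexity of square averages.
\<close>
lemma mean_L2_combination:
  assumes f: "\<And>x. x \<in> A \<Longrightarrow> 0 \<le> f x" "\<And>x. x \<in> A \<Longrightarrow> f x \<le> \<alpha> * g x + \<beta> * h x"
    and "0 \<le> \<alpha>" "0 \<le> \<beta>"
  shows "sqrt (mean A (\<lambda>x. (f x)\<^sup>2)) \<le> \<alpha> * sqrt (mean A (\<lambda>x. (g x)\<^sup>2)) + \<beta> * sqrt (mean A (\<lambda>x. (h x)\<^sup>2))"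
proof -
  have eq: "sqrt (mean A (\<lambda>x. (u x)\<^sup>2)) = L2_set u A / sqrt (card A)" for u :: "'a \<Rightarrow> real"
    by (simp add: mean_def L2_set_def real_sqrt_divide)
  have "L2_set f A \<le> L2_set (\<lambda>x. \<alpha> * g x + \<beta> * h x) A" using f by (intro L2_set_mono) auto
  also have "\<dots> \<le> L2_set (\<lambda>x. \<alpha> * g x) A + L2_set (\<lambda>x. \<beta> * h x) A" by (rule L2_set_triangle_ineq)
  also have "\<dots> = \<alpha> * L2_set g A + \<beta> * L2_set h A" using assms by (simp add: L2_set_right_distrib)
  finally have "L2_set f A / sqrt (card A) \<le> (\<alpha> * L2_set g A + \<beta> * L2_set h A) / sqrt (card A)"
    by (intro divide_right_mono) auto
  then show ?thesis unfolding eq by (simp add: add_divide_distrib)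
qed

text \<open>
  With \<open>M\<^sub>k\<close> the \<open>k\<close>-th moment, the Cauchy-Schwarz inequality gives \<open>M\<^sub>2\<^sup>2 \<le> M\<^sub>1 M\<^sub>3\<close> and \<open>M\<^sub>3\<^sup>2 \<le> M\<^sub>2 M\<^sub>4\<close>, hence
  \<open>M\<^sub>2\<^sup>3 \<le> M\<^sub>1\<^sup>2 M\<^sub>4\<close>.
\<close>
lemma mean_square_le_of_fourth_moment:
  assumes f: "\<And>x. x \<in> A \<Longrightarrow> 0 \<le> f x" and K: "0 \<le> K" "mean A (\<lambda>x. f x ^ 4) \<le> K * (mean A (\<lambda>x. (f x)\<^sup>2))\<^sup>2"
  shows "mean A (\<lambda>x. (f x)\<^sup>2) \<le> K * (mean A f)\<^sup>2"
proof -
  define M where "M k = mean A (\<lambda>x. f x ^ k)" for k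
  have M: "0 \<le> M k" for k unfolding M_def using f by (intro mean_nonneg) auto
  have M1: "M 1 = mean A f" by (simp add: M_def)
  have "(mean A (\<lambda>x. sqrt (f x) * sqrt (f x ^ 3)))\<^sup>2 \<le> mean A (\<lambda>x. (sqrt (f x))\<^sup>2) * mean A (\<lambda>x. (sqrt (f x ^ 3))\<^sup>2)"
    by (rule mean_Cauchy_Schwarz)
  moreover have "mean A (\<lambda>x. sqrt (f x) * sqrt (f x ^ 3)) = M 2"
    unfolding M_def
  proof (rule mean_cong)
    fix x assume "x \<in> A"
    have "sqrt (f x) * sqrt (f x ^ 3) = sqrt (f x ^ 4)"
      unfolding real_sqrt_mult[symmetric] by (simp add: eval_nat_numeral)
    also have "\<dots> = f x ^ 2" by (rule real_sqrt_unique) (simp_all flip: power_mult)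
    finally show "sqrt (f x) * sqrt (f x ^ 3) = f x ^ 2" .
  qed
  moreover have "mean A (\<lambda>x. (sqrt (f x))\<^sup>2) = M 1" "mean A (\<lambda>x. (sqrt (f x ^ 3))\<^sup>2) = M 3"
    unfolding M_def using f by (auto intro!: mean_cong)
  ultimately have 1: "(M 2)\<^sup>2 \<le> M 1 * M 3" by simp
  have 2: "(M 3)\<^sup>2 \<le> M 2 * M 4"
    using mean_Cauchy_Schwarz[of A f "\<lambda>x. (f x)\<^sup>2"]
    unfolding M_def by (simp add: eval_nat_numeral mult.assoc)
  have "(M 2) ^ 4 = ((M 2)\<^sup>2)\<^sup>2" by simp
  also have "\<dots> \<le> (M 1 * M 3)\<^sup>2" using 1 by (intro power_mono) auto
  also have "\<dots> \<le> (M 1)\<^sup>2 * (M 2 * M 4)"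
    unfolding power_mult_distrib using 2 by (intro mult_left_mono) auto
  also have "\<dots> \<le> (M 1)\<^sup>2 * (M 2 * (K * (M 2)\<^sup>2))"
    using K(2) M by (intro mult_left_mono) (auto simp: M_def)
  finally have "M 2 ^ 3 * M 2 \<le> M 2 ^ 3 * (K * (M 1)\<^sup>2)" by (simp add: eval_nat_numeral mult_ac)
  then have "M 2 \<le> K * (M 1)\<^sup>2"
    using M[of 2] K(1) by (cases "M 2 = 0") (auto simp: mult_le_cancel_left)
  then show ?thesis unfolding M1 by (simp add: M_def)
qed

definition signs :: "nat set \<Rightarrow> (nat \<Rightarrow> real) set" where
  "signs A = PiE_dflt A 0 (\<lambda>_. {-1, 1})"

lemma finite_signs: "finite A \<Longrightarrow> finite (signs A)"
  unfolding signs_def by (intro finite_PiE_dflt) auto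

lemma signs_nonempty: "signs A \<noteq> {}"
  unfolding signs_def by simp

lemma signs_iff: "\<epsilon> \<in> signs A \<longleftrightarrow> (\<forall>i. if i \<in> A then \<epsilon> i = -1 \<or> \<epsilon> i = 1 else \<epsilon> i = 0)"
  by (auto simp: signs_def PiE_dflt_def)

lemma signs_values:
  assumes "\<epsilon> \<in> signs A"
  shows "i \<in> A \<Longrightarrow> \<epsilon> i = -1 \<or> \<epsilon> i = 1" and "i \<notin> A \<Longrightarrow> \<epsilon> i = 0"
  using assms unfolding signs_iff by (auto dest: spec[of _ i])

lemma rademacher_norm_eq_mean:
  "rademacher_norm p n f = mean (signs {1..n}) (\<lambda>\<epsilon>. \<bar>f \<epsilon>\<bar> powr p) powr (1 / p)"
proof -
  have "rademacher n = pmf_of_set (signs {1..n})"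
    unfolding rademacher_def signs_def by (rule Pi_pmf_of_set) auto
  then show ?thesis
    unfolding rademacher_norm_def mean_def
    by (simp add: integral_pmf_of_set finite_signs signs_nonempty)
qed

lemma mean_signs_flip:
  assumes \<delta>: "\<And>i. i \<in> A \<Longrightarrow> \<delta> i = -1 \<or> \<delta> i = 1"
  shows "mean (signs A) (\<lambda>\<epsilon>. f (\<lambda>i. \<delta> i * \<epsilon> i)) = mean (signs A) f"
proof -
  have inv: "(\<lambda>i. \<delta> i * (\<delta> i * \<epsilon> i)) = \<epsilon>" if "\<epsilon> \<in> signs A" for \<epsilon>
  proof
    fix i show "\<delta> i * (\<delta> i * \<epsilon> i) = \<epsilon> i"
      using that \<delta>[of i] by (cases "i \<in> A") (auto simp: signs_iff)
  qed
  have cl: "(\<lambda>i. \<delta> i * \<epsilon> i) \<in> signs A" if "\<epsilon> \<in> signs A" for \<epsilon>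
    unfolding signs_iff
  proof
    fix i show "if i \<in> A then \<delta> i * \<epsilon> i = - 1 \<or> \<delta> i * \<epsilon> i = 1 else \<delta> i * \<epsilon> i = 0"
      using that[unfolded signs_iff, rule_format, of i] \<delta>[of i] by (cases "i \<in> A") auto
  qed
  have "bij_betw (\<lambda>\<epsilon> i. \<delta> i * \<epsilon> i) (signs A) (signs A)"
    by (rule bij_betwI[where g = "\<lambda>\<epsilon> i. \<delta> i * \<epsilon> i"]) (use cl inv in auto)
  from sum.reindex_bij_betw[OF this, of f] show ?thesis by (simp add: mean_def)
qed

lemma mean_signs_insert:
  assumes "finite A" "i \<notin> A"
  shows "mean (signs (insert i A)) f =
    (mean (signs A) (\<lambda>\<epsilon>. f (\<epsilon>(i := 1))) + mean (signs A) (\<lambda>\<epsilon>. f (\<epsilon>(i := -1)))) / 2"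
proof -
  let ?P = "(\<lambda>\<epsilon>. \<epsilon>(i := 1 :: real)) ` signs A" and ?M = "(\<lambda>\<epsilon>. \<epsilon>(i := -1 :: real)) ` signs A"
  have un: "signs (insert i A) = ?P \<union> ?M"
  proof (intro set_eqI iffI)
    fix \<epsilon> assume \<epsilon>: "\<epsilon> \<in> signs (insert i A)"
    then have "\<epsilon>(i := 0) \<in> signs A" using assms by (auto simp: signs_iff)
    moreover have "\<epsilon> = (\<epsilon>(i := 0))(i := 1) \<or> \<epsilon> = (\<epsilon>(i := 0))(i := -1)"
      using \<epsilon>[unfolded signs_iff, rule_format, of i] by auto
    ultimately show "\<epsilon> \<in> ?P \<union> ?M" by blast
  next
    fix \<epsilon> assume "\<epsilon> \<in> ?P \<union> ?M"
    then obtain \<epsilon>' s where *: "\<epsilon>' \<in> signs A" "\<epsilon> = \<epsilon>'(i := s)" "s = 1 \<or> s = -1" by blast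
    show "\<epsilon> \<in> signs (insert i A)"
      unfolding signs_iff using signs_values[OF *(1)] *(2,3) by auto
  qed
  have inj: "inj_on (\<lambda>\<epsilon>. \<epsilon>(i := s)) (signs A)" for s :: real
  proof (rule inj_onI)
    fix \<epsilon> \<epsilon>' assume "\<epsilon> \<in> signs A" "\<epsilon>' \<in> signs A" and eq: "\<epsilon>(i := s) = \<epsilon>'(i := s)"
    then have "\<epsilon> i = 0" "\<epsilon>' i = 0" using assms by (auto simp: signs_iff)
    then show "\<epsilon> = \<epsilon>'" using eq by (metis fun_upd_triv fun_upd_upd)
  qed
  have disj: "?P \<inter> ?M = {}"
  proof -
    have "\<epsilon> i = 1" if "\<epsilon> \<in> ?P" for \<epsilon> using that by auto
    moreover have "\<epsilon> i = -1" if "\<epsilon> \<in> ?M" for \<epsilon> using that by auto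
    ultimately show ?thesis by fastforce
  qed
  have fin: "finite ?P" "finite ?M" using finite_signs[OF assms(1)] by auto
  have "card (signs (insert i A)) = 2 * card (signs A)"
    unfolding un using card_Un_disjoint[OF fin disj] inj by (simp add: card_image)
  moreover have "sum f (signs (insert i A)) = (\<Sum>\<epsilon>\<in>signs A. f (\<epsilon>(i := 1))) + (\<Sum>\<epsilon>\<in>signs A. f (\<epsilon>(i := -1)))"
    unfolding un sum.union_disjoint[OF fin disj] using inj by (simp add: sum.reindex)
  ultimately show ?thesis by (simp add: mean_def add_divide_distrib)
qed

definition scale_coords :: "(nat \<Rightarrow> real) \<Rightarrow> (nat \<Rightarrow> 'k::real_normed_field) \<Rightarrow> nat \<Rightarrow> 'k" where
  "scale_coords \<epsilon> a = (\<lambda>i. of_real (\<epsilon> i) * a i)"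

text \<open>
  Changing all signs but the \<open>i\<close>-th one preserves the distribution of the signs, and the sum of the
  two signed vectors is \<open>\<plusminus>2 a\<^sub>i e\<^sub>i\<close>.
\<close>
lemma mean_signs_ge_coordinate:
  assumes r: "norm_on n r" and e: "r (unit_vec i) = 1" and i: "i \<in> {1..n}"
  shows "norm (a i) \<le> mean (signs {1..n}) (\<lambda>\<epsilon>. r (scale_coords \<epsilon> a))"
proof -
  let ?\<delta> = "\<lambda>j. if j = i then 1 else -1 :: real" and ?f = "\<lambda>\<epsilon>. r (scale_coords \<epsilon> a)"
  have "2 * norm (a i) \<le> ?f \<epsilon> + ?f (\<lambda>j. ?\<delta> j * \<epsilon> j)" if \<epsilon>: "\<epsilon> \<in> signs {1..n}" for \<epsilon>
  proof -
    have "\<bar>\<epsilon> i\<bar> = 1" using signs_values(1)[OF \<epsilon> i] by auto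
    then have "2 * norm (a i) = r (\<lambda>j. (2 * of_real (\<epsilon> i) * a i) * unit_vec i j)"
      unfolding norm_on_scale[OF r] using e by (simp add: norm_mult)
    also have "(\<lambda>j. (2 * of_real (\<epsilon> i) * a i) * unit_vec i j) =
        (\<lambda>j. scale_coords \<epsilon> a j + scale_coords (\<lambda>j. ?\<delta> j * \<epsilon> j) a j)"
      by (auto simp: scale_coords_def unit_vec_def fun_eq_iff)
    also have "r \<dots> \<le> ?f \<epsilon> + ?f (\<lambda>j. ?\<delta> j * \<epsilon> j)" by (rule norm_on_triangle[OF r])
    finally show ?thesis .
  qed
  then have "mean (signs {1..n}) (\<lambda>_. 2 * norm (a i)) \<le> mean (signs {1..n}) (\<lambda>\<epsilon>. ?f \<epsilon> + ?f (\<lambda>j. ?\<delta> j * \<epsilon> j))"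
    by (rule mean_mono)
  also have "\<dots> = 2 * mean (signs {1..n}) ?f"
    unfolding mean_add using mean_signs_flip[of "{1..n}" ?\<delta> ?f] by simp
  finally show ?thesis by (simp add: mean_const finite_signs signs_nonempty)
qed

definition rms_norm :: "nat \<Rightarrow> ((nat \<Rightarrow> 'k::real_normed_field) \<Rightarrow> real) \<Rightarrow> (nat \<Rightarrow> 'k) \<Rightarrow> real" where
  "rms_norm n r a = sqrt (mean (signs {1..n}) (\<lambda>\<epsilon>. (r (scale_coords \<epsilon> a))\<^sup>2))"

lemma rms_norm_square: "(rms_norm n r a)\<^sup>2 = mean (signs {1..n}) (\<lambda>\<epsilon>. (r (scale_coords \<epsilon> a))\<^sup>2)"
  unfolding rms_norm_def by (simp add: mean_nonneg)

lemma norm_on_rms_norm: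
  assumes r: "norm_on n r"
  shows "norm_on n (rms_norm n r)"
  unfolding norm_on_def
proof (intro conjI allI impI)
  fix a b :: "nat \<Rightarrow> 'a" assume "\<forall>i\<in>{1..n}. a i = b i"
  then have "r (scale_coords \<epsilon> a) = r (scale_coords \<epsilon> b)" for \<epsilon>
    by (intro norm_on_cong[OF r]) (simp add: scale_coords_def)
  then show "rms_norm n r a = rms_norm n r b" by (simp add: rms_norm_def)
next
  fix a show "0 \<le> rms_norm n r a" by (simp add: rms_norm_def mean_nonneg)
next
  fix a
  have "rms_norm n r a = 0 \<longleftrightarrow> (\<forall>\<epsilon>\<in>signs {1..n}. r (scale_coords \<epsilon> a) = 0)"
    unfolding rms_norm_def by (simp add: mean_eq_0_iff finite_signs)
  also have "\<dots> \<longleftrightarrow> (\<forall>\<epsilon>\<in>signs {1..n}. \<forall>i\<in>{1..n}. a i = 0)"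
    unfolding norm_on_eq_0[OF r] scale_coords_def
    by (intro ball_cong refl) (fastforce dest: signs_values(1))
  finally show "rms_norm n r a = 0 \<longleftrightarrow> (\<forall>i\<in>{1..n}. a i = 0)"
    using signs_nonempty[of "{1..n}"] by blast
next
  fix c a
  have "r (scale_coords \<epsilon> (\<lambda>i. c * a i)) = norm c * r (scale_coords \<epsilon> a)" for \<epsilon>
    using norm_on_scale[OF r, of c "scale_coords \<epsilon> a"] by (simp add: scale_coords_def mult.left_commute)
  then show "rms_norm n r (\<lambda>i. c * a i) = norm c * rms_norm n r a"
    by (simp add: rms_norm_def power_mult_distrib mean_cmult real_sqrt_mult)
next
  fix a b
  have "r (scale_coords \<epsilon> (\<lambda>i. a i + b i)) \<le> 1 * r (scale_coords \<epsilon> a) + 1 * r (scale_coords \<epsilon> b)" for \<epsilon>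
    using norm_on_triangle[OF r, of "scale_coords \<epsilon> a" "scale_coords \<epsilon> b"]
    by (simp add: scale_coords_def distrib_left)
  then show "rms_norm n r (\<lambda>i. a i + b i) \<le> rms_norm n r a + rms_norm n r b"
    using mean_L2_combination[of "signs {1..n}" "\<lambda>\<epsilon>. r (scale_coords \<epsilon> (\<lambda>i. a i + b i))" 1
        "\<lambda>\<epsilon>. r (scale_coords \<epsilon> a)" 1 "\<lambda>\<epsilon>. r (scale_coords \<epsilon> b)"] norm_on_nonneg[OF r]
    by (simp add: rms_norm_def)
qed

lemma monotone_normalized_rms_norm:
  assumes r: "norm_on n r" "monotone_normalized n r"
  shows "monotone_normalized n (rms_norm n r)"
  unfolding monotone_normalized_def restr_unit_vec_sum
proof (intro conjI ballI allI impI)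
  fix i assume i: "i \<in> {1..n}"
  have "r (scale_coords \<epsilon> (unit_vec i)) = 1" if \<epsilon>: "\<epsilon> \<in> signs {1..n}" for \<epsilon>
  proof -
    have "\<bar>\<epsilon> i\<bar> = 1" using signs_values(1)[OF \<epsilon> i] by auto
    moreover have "scale_coords \<epsilon> (unit_vec i :: nat \<Rightarrow> 'a) = (\<lambda>j. of_real (\<epsilon> i) * unit_vec i j)"
      by (auto simp: scale_coords_def unit_vec_def)
    moreover have "r (unit_vec i) = 1" using r(2) i unfolding monotone_normalized_def by blast
    ultimately show ?thesis using norm_on_scale[OF r(1), of "of_real (\<epsilon> i)" "unit_vec i"] by simp
  qed
  then have "mean (signs {1..n}) (\<lambda>\<epsilon>. (r (scale_coords \<epsilon> (unit_vec i)))\<^sup>2) = mean (signs {1..n}) (\<lambda>_. 1)"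
    by (intro mean_cong) simp
  then show "rms_norm n r (unit_vec i) = 1"
    by (simp add: rms_norm_def mean_const finite_signs signs_nonempty)
next
  fix m a assume "m \<le> n"
  have "r (scale_coords \<epsilon> (restr {1..m} a)) \<le> r (scale_coords \<epsilon> (restr {1..n} a))" for \<epsilon>
  proof -
    have "r (scale_coords \<epsilon> (restr {1..m} a)) = r (restr {1..m} (scale_coords \<epsilon> (restr {1..n} a)))"
      using \<open>m \<le> n\<close> by (intro norm_on_cong[OF r(1)]) (auto simp: scale_coords_def restr_def)
    then show ?thesis using monotone_restr[OF r \<open>m \<le> n\<close>] by simp
  qed
  then show "rms_norm n r (restr {1..m} a) \<le> rms_norm n r (restr {1..n} a)"
    unfolding rms_norm_def by (intro real_sqrt_le_mono mean_mono power_mono norm_on_nonneg[OF r(1)])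
qed

text \<open>
  Doubling the exponent \<open>2\<^sup>j\<^sup>+\<^sup>1\<close> costs a factor \<open>1/2\<close> in the coefficient of \<open>v\<close>: the squares
  \<open>(u \<plusminus> \<sigma> v)\<^sup>2\<close> are again of the form \<open>U \<plusminus> 2 \<sigma> V\<close>, with \<open>V = u v\<close> and \<open>U\<^sup>2 + V\<^sup>2 \<le> (u\<^sup>2 + v\<^sup>2)\<^sup>2\<close>.
\<close>
lemma two_point_inequality:
  "((u + (1/2) ^ j * v) ^ (2 * 2 ^ j) + (u - (1/2) ^ j * v) ^ (2 * 2 ^ j)) / 2 \<le> (u\<^sup>2 + v\<^sup>2 :: real) ^ (2 ^ j)"
proof (induction j arbitrary: u v)
  case 0
  show ?case by (simp add: power2_eq_square algebra_simps)
next
  case (Suc j)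
  define \<sigma> :: real where "\<sigma> = (1/2) ^ Suc j"
  have \<sigma>: "0 \<le> \<sigma>" "\<sigma> \<le> 1/2" "(1/2) ^ j = 2 * \<sigma>"
    using power_le_one[of "1/2 :: real" j] by (auto simp: \<sigma>_def)
  define U where "U = u\<^sup>2 + \<sigma>\<^sup>2 * v\<^sup>2"
  have "((u + \<sigma> * v) ^ (2 * 2 ^ Suc j) + (u - \<sigma> * v) ^ (2 * 2 ^ Suc j)) / 2
      = (((u + \<sigma> * v)\<^sup>2) ^ (2 * 2 ^ j) + ((u - \<sigma> * v)\<^sup>2) ^ (2 * 2 ^ j)) / 2"
    by (simp flip: power_mult add: mult.assoc)
  also have "(u + \<sigma> * v)\<^sup>2 = U + (1/2) ^ j * (u * v)"
    by (simp add: U_def \<sigma>(3) power2_eq_square algebra_simps)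
  also have "(u - \<sigma> * v)\<^sup>2 = U - (1/2) ^ j * (u * v)"
    by (simp add: U_def \<sigma>(3) power2_eq_square algebra_simps)
  also have "((U + (1/2) ^ j * (u * v)) ^ (2 * 2 ^ j) + (U - (1/2) ^ j * (u * v)) ^ (2 * 2 ^ j)) / 2
      \<le> (U\<^sup>2 + (u * v)\<^sup>2) ^ (2 ^ j)"
    by (rule Suc.IH)
  also have "\<dots> \<le> ((u\<^sup>2 + v\<^sup>2)\<^sup>2) ^ (2 ^ j)"
  proof (rule power_mono)
    have s2: "\<sigma>\<^sup>2 \<le> (1/2)\<^sup>2" using \<sigma> by (intro power_mono) auto
    then have "\<sigma>\<^sup>2 * \<sigma>\<^sup>2 \<le> 1 * 1" by (intro mult_mono) (auto simp: power2_eq_square)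
    then have "(\<sigma>\<^sup>2 * \<sigma>\<^sup>2) * (v\<^sup>2 * v\<^sup>2) \<le> 1 * (v\<^sup>2 * v\<^sup>2)" by (intro mult_right_mono) auto
    moreover have "(2 * \<sigma>\<^sup>2) * (u\<^sup>2 * v\<^sup>2) \<le> 1 * (u\<^sup>2 * v\<^sup>2)"
      using s2 by (intro mult_right_mono) (auto simp: power2_eq_square)
    moreover have "U\<^sup>2 + (u * v)\<^sup>2 = u\<^sup>2 * u\<^sup>2 + (2 * \<sigma>\<^sup>2) * (u\<^sup>2 * v\<^sup>2) + (\<sigma>\<^sup>2 * \<sigma>\<^sup>2) * (v\<^sup>2 * v\<^sup>2) + u\<^sup>2 * v\<^sup>2"
      by (simp add: U_def power2_eq_square algebra_simps)
    moreover have "(u\<^sup>2 + v\<^sup>2)\<^sup>2 = u\<^sup>2 * u\<^sup>2 + 2 * (u\<^sup>2 * v\<^sup>2) + v\<^sup>2 * v\<^sup>2"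
      by (simp add: power2_eq_square algebra_simps)
    ultimately show "U\<^sup>2 + (u * v)\<^sup>2 \<le> (u\<^sup>2 + v\<^sup>2)\<^sup>2" by linarith
  qed auto
  also have "\<dots> = (u\<^sup>2 + v\<^sup>2) ^ (2 ^ Suc j)" by (simp flip: power_mult)
  finally show ?case unfolding \<sigma>_def .
qed

text \<open>
  Induction on the number of signs. For a fixed value of the new sign, the induction hypothesis
  bounds the average over the other signs by a power of an \<open>L\<^sub>2\<close>-seminorm \<open>N\<close>, and the remaining
  average over the new sign is controlled by the two-point inequality for \<open>N\<close>. The latter reduces to
  real numbers because \<open>N\<close> is convex along the line through the two points. The shift \<open>x\<close> is there
  to make the induction work.
\<close>
lemma hypercontractive_inequality:
  fixes a :: "nat \<Rightarrow> 'k::real_normed_field"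
  assumes r: "norm_on n r" and A: "finite A"
  shows "mean (signs A) (\<lambda>\<epsilon>. r (\<lambda>i. x i + of_real ((1/2) ^ j) * scale_coords \<epsilon> a i) ^ (2 * 2 ^ j))
    \<le> mean (signs A) (\<lambda>\<epsilon>. (r (\<lambda>i. x i + scale_coords \<epsilon> a i))\<^sup>2) ^ (2 ^ j)"
  using A
proof (induction A arbitrary: x rule: finite_induct)
  case empty
  have "signs {} = {\<lambda>_. 0}" by (auto simp: signs_iff)
  then show ?case by (simp add: mean_def scale_coords_def power_mult)
next
  case (insert k A)
  define \<sigma> :: real where "\<sigma> = (1/2) ^ j"
  have \<sigma>: "0 \<le> \<sigma>" "\<sigma> \<le> 1" by (auto simp: \<sigma>_def power_le_one)
  define y where "y t = (\<lambda>i. x i + of_real t * (a k * unit_vec k i))" for t :: real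
  define N where "N t = sqrt (mean (signs A) (\<lambda>\<epsilon>. (r (\<lambda>i. y t i + scale_coords \<epsilon> a i))\<^sup>2))" for t
  have N0: "0 \<le> N t" for t by (simp add: N_def mean_nonneg)
  have N2: "mean (signs A) (\<lambda>\<epsilon>. (r (\<lambda>i. y t i + scale_coords \<epsilon> a i))\<^sup>2) = (N t)\<^sup>2" for t
    by (simp add: N_def mean_nonneg)
  have convex: "N t \<le> (1 + t) / 2 * N 1 + (1 - t) / 2 * N (-1)" if t: "\<bar>t\<bar> \<le> 1" for t
    unfolding N_def
  proof (rule mean_L2_combination)
    fix \<epsilon>
    have comb: "(\<lambda>i. y t i + scale_coords \<epsilon> a i) = (\<lambda>i. of_real ((1 + t) / 2) * (y 1 i + scale_coords \<epsilon> a i)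
        + of_real ((1 - t) / 2) * (y (-1) i + scale_coords \<epsilon> a i))"
      by (simp add: y_def fun_eq_iff field_simps)
    have "r (\<lambda>i. y t i + scale_coords \<epsilon> a i) \<le> norm (of_real ((1 + t) / 2) :: 'k) * r (\<lambda>i. y 1 i + scale_coords \<epsilon> a i)
        + norm (of_real ((1 - t) / 2) :: 'k) * r (\<lambda>i. y (-1) i + scale_coords \<epsilon> a i)"
      unfolding comb norm_on_scale[OF r, symmetric] by (rule norm_on_triangle[OF r])
    then show "r (\<lambda>i. y t i + scale_coords \<epsilon> a i) \<le> (1 + t) / 2 * r (\<lambda>i. y 1 i + scale_coords \<epsilon> a i)
        + (1 - t) / 2 * r (\<lambda>i. y (-1) i + scale_coords \<epsilon> a i)"
      using t unfolding norm_of_real by (simp add: abs_if split: if_splits)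
  qed (use t in \<open>auto intro: norm_on_nonneg[OF r]\<close>)
  have upd: "(\<lambda>i. x i + of_real t * scale_coords (\<epsilon>(k := s)) a i) = (\<lambda>i. y (t * s) i + of_real t * scale_coords \<epsilon> a i)"
    if "\<epsilon> \<in> signs A" for \<epsilon> s t
  proof
    fix i
    have "\<epsilon> k = 0" using that insert.hyps by (auto simp: signs_iff)
    then show "x i + of_real t * scale_coords (\<epsilon>(k := s)) a i = y (t * s) i + of_real t * scale_coords \<epsilon> a i"
      by (simp add: y_def scale_coords_def unit_vec_def)
  qed
  have split: "mean (signs (insert k A)) (\<lambda>\<epsilon>. r (\<lambda>i. x i + of_real t * scale_coords \<epsilon> a i) ^ e) =
      (mean (signs A) (\<lambda>\<epsilon>. r (\<lambda>i. y t i + of_real t * scale_coords \<epsilon> a i) ^ e) +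
       mean (signs A) (\<lambda>\<epsilon>. r (\<lambda>i. y (- t) i + of_real t * scale_coords \<epsilon> a i) ^ e)) / 2" for t e
    unfolding mean_signs_insert[OF insert.hyps(1,2)] using upd[of _ t 1] upd[of _ t "-1"]
    by (simp cong: mean_cong)
  have "mean (signs (insert k A)) (\<lambda>\<epsilon>. r (\<lambda>i. x i + of_real \<sigma> * scale_coords \<epsilon> a i) ^ (2 * 2 ^ j))
      \<le> (((N \<sigma>)\<^sup>2) ^ (2 ^ j) + ((N (- \<sigma>))\<^sup>2) ^ (2 ^ j)) / 2"
    unfolding split
    using insert.IH[of "y \<sigma>"] insert.IH[of "y (- \<sigma>)"] unfolding N2 \<sigma>_def[symmetric] by simp
  also have "\<dots> \<le> (((N 1 + N (-1)) / 2 + \<sigma> * ((N 1 - N (-1)) / 2)) ^ (2 * 2 ^ j) +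
      ((N 1 + N (-1)) / 2 - \<sigma> * ((N 1 - N (-1)) / 2)) ^ (2 * 2 ^ j)) / 2"
  proof -
    have "N \<sigma> \<le> (N 1 + N (-1)) / 2 + \<sigma> * ((N 1 - N (-1)) / 2)"
      "N (- \<sigma>) \<le> (N 1 + N (-1)) / 2 - \<sigma> * ((N 1 - N (-1)) / 2)"
      using convex[of \<sigma>] convex[of "- \<sigma>"] \<sigma> by (simp_all add: field_simps)
    then show ?thesis
      unfolding power_mult[symmetric] using N0 by (intro divide_right_mono add_mono power_mono) auto
  qed
  also have "\<dots> \<le> (((N 1 + N (-1)) / 2)\<^sup>2 + ((N 1 - N (-1)) / 2)\<^sup>2) ^ (2 ^ j)"
    unfolding \<sigma>_def by (rule two_point_inequality)
  also have "((N 1 + N (-1)) / 2)\<^sup>2 + ((N 1 - N (-1)) / 2)\<^sup>2 = ((N 1)\<^sup>2 + (N (-1))\<^sup>2) / 2"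
    by (simp add: power2_eq_square field_simps)
  also have "\<dots> = mean (signs (insert k A)) (\<lambda>\<epsilon>. (r (\<lambda>i. x i + scale_coords \<epsilon> a i))\<^sup>2)"
    using split[of 1 2] N2[of 1] N2[of "-1"] by simp
  finally show ?case unfolding \<sigma>_def .
qed

lemma Kahane_moment_bound:
  assumes r: "norm_on n r"
  shows "(1/2) ^ (j * (2 * 2 ^ j)) * mean (signs {1..n}) (\<lambda>\<epsilon>. r (scale_coords \<epsilon> a) ^ (2 * 2 ^ j))
    \<le> mean (signs {1..n}) (\<lambda>\<epsilon>. (r (scale_coords \<epsilon> a))\<^sup>2) ^ (2 ^ j)"
proof -
  have "r (\<lambda>i. 0 + of_real ((1/2) ^ j) * scale_coords \<epsilon> a i) ^ (2 * 2 ^ j)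
      = (1/2) ^ (j * (2 * 2 ^ j)) * r (scale_coords \<epsilon> a) ^ (2 * 2 ^ j)" for \<epsilon>
    using norm_on_scale[OF r, of "of_real ((1/2) ^ j)" "scale_coords \<epsilon> a"]
    by (simp add: power_mult_distrib power_mult norm_power norm_divide)
  then show ?thesis
    using hypercontractive_inequality[OF r, of "{1..n}" "\<lambda>_. 0" j a] by (simp add: mean_cmult)
qed

text \<open>
  The averages \<open>L\<^sub>q \<le> L\<^sub>Q\<close>, with \<open>Q\<close> a large power of 2, are bounded by \<open>L\<^sub>2\<close> through hypercontractivity,
  and \<open>L\<^sub>2\<close> is bounded by \<open>L\<^sub>1\<close> through the bound of \<open>L\<^sub>4\<close> by \<open>L\<^sub>2\<close>.
\<close>
lemma Kahane_inequality:
  fixes q :: real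
  assumes q: "0 < q"
  shows "\<exists>K>0. \<forall>n r (a :: nat \<Rightarrow> 'k::real_normed_field). norm_on n r \<longrightarrow>
    mean (signs {1..n}) (\<lambda>\<epsilon>. r (scale_coords \<epsilon> a) powr q) powr (1 / q)
      \<le> K * mean (signs {1..n}) (\<lambda>\<epsilon>. r (scale_coords \<epsilon> a))"
proof -
  obtain j where j: "q \<le> 2 ^ j" using real_arch_pow[of 2 q] by (auto intro: less_imp_le)
  define Q :: nat where "Q = 2 * 2 ^ j"
  have Q: "q \<le> Q" "0 < Q" using j unfolding Q_def by (auto intro: order_trans)
  have "mean (signs {1..n}) (\<lambda>\<epsilon>. r (scale_coords \<epsilon> a) powr q) powr (1 / q)
      \<le> 4 * 2 ^ j * mean (signs {1..n}) (\<lambda>\<epsilon>. r (scale_coords \<epsilon> a))"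
    if r: "norm_on n r" for n r and a :: "nat \<Rightarrow> 'k"
  proof -
    let ?f = "\<lambda>\<epsilon>. r (scale_coords \<epsilon> a)" and ?E = "mean (signs {1..n})"
    have f0: "0 \<le> ?f \<epsilon>" for \<epsilon> by (rule norm_on_nonneg[OF r])
    have "?E (\<lambda>\<epsilon>. ?f \<epsilon> powr q) powr (1 / q) \<le> ?E (\<lambda>\<epsilon>. ?f \<epsilon> powr Q) powr (1 / Q)"
      using q Q f0 by (intro mean_powr_mono) (auto simp: finite_signs signs_nonempty)
    also have "?E (\<lambda>\<epsilon>. ?f \<epsilon> powr Q) = ?E (\<lambda>\<epsilon>. ?f \<epsilon> ^ Q)"
      using Q f0 by (intro mean_cong) (simp add: powr_realpow')
    also have "?E (\<lambda>\<epsilon>. ?f \<epsilon> ^ Q) powr (1 / Q) \<le> ((2 ^ j * sqrt (?E (\<lambda>\<epsilon>. (?f \<epsilon>)\<^sup>2))) ^ Q) powr (1 / Q)"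
    proof (rule powr_mono2)
      have "(1/2) ^ (j * Q) * ?E (\<lambda>\<epsilon>. ?f \<epsilon> ^ Q) \<le> ?E (\<lambda>\<epsilon>. (?f \<epsilon>)\<^sup>2) ^ (2 ^ j)"
        unfolding Q_def by (rule Kahane_moment_bound[OF r])
      also have "?E (\<lambda>\<epsilon>. (?f \<epsilon>)\<^sup>2) ^ (2 ^ j) = sqrt (?E (\<lambda>\<epsilon>. (?f \<epsilon>)\<^sup>2)) ^ Q"
        by (simp add: Q_def power_mult mean_nonneg)
      finally have "2 ^ (j * Q) * ((1/2) ^ (j * Q) * ?E (\<lambda>\<epsilon>. ?f \<epsilon> ^ Q)) \<le> 2 ^ (j * Q) * sqrt (?E (\<lambda>\<epsilon>. (?f \<epsilon>)\<^sup>2)) ^ Q"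
        by (intro mult_left_mono) auto
      then show "?E (\<lambda>\<epsilon>. ?f \<epsilon> ^ Q) \<le> (2 ^ j * sqrt (?E (\<lambda>\<epsilon>. (?f \<epsilon>)\<^sup>2))) ^ Q"
        by (simp add: power_mult_distrib power_mult power_divide)
    qed (use f0 in \<open>auto intro: mean_nonneg\<close>)
    also have "\<dots> = 2 ^ j * sqrt (?E (\<lambda>\<epsilon>. (?f \<epsilon>)\<^sup>2))"
    proof -
      have "(y ^ Q) powr (1 / Q) = y" if "0 \<le> y" for y :: real
        using that Q by (simp add: powr_powr flip: powr_realpow')
      then show ?thesis by (simp add: mean_nonneg)
    qed
    also have "sqrt (?E (\<lambda>\<epsilon>. (?f \<epsilon>)\<^sup>2)) \<le> sqrt (16 * (?E ?f)\<^sup>2)"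
    proof (rule real_sqrt_le_mono, rule mean_square_le_of_fourth_moment)
      show "?E (\<lambda>\<epsilon>. ?f \<epsilon> ^ 4) \<le> 16 * (?E (\<lambda>\<epsilon>. (?f \<epsilon>)\<^sup>2))\<^sup>2"
        using Kahane_moment_bound[OF r, of 1 a] by (simp add: power_divide)
    qed (use f0 in auto)
    also have "sqrt (16 * (?E ?f)\<^sup>2) = 4 * ?E ?f"
      using f0 by (simp add: real_sqrt_mult mean_nonneg)
    finally show ?thesis by (simp add: mult_ac)
  qed
  then show ?thesis by (intro exI[of _ "4 * 2 ^ j"]) auto
qed

lemma scale_coords_pos_iff:
  assumes r: "norm_on n r" and \<epsilon>: "\<epsilon> \<in> signs {1..n}"
  shows "0 < r (scale_coords \<epsilon> a) \<longleftrightarrow> 0 < r a"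
proof -
  have "r (scale_coords \<epsilon> a) = 0 \<longleftrightarrow> r a = 0"
    unfolding norm_on_eq_0[OF r] scale_coords_def using signs_values(1)[OF \<epsilon>] by fastforce
  then show ?thesis using norm_on_nonneg[OF r] by (metis order_less_le)
qed

lemma rademacher_norm_nonneg: "0 \<le> rademacher_norm p n f"
  by (simp add: rademacher_norm_def)

section \<open>Square averages of signed sums\<close>

text \<open>
  Let \<open>A\<close> be the quadratic mean of the \<open>|d\<^sub>i|\<close>. The trivial bound of \<open>r\<close> by \<open>\<Sum>\<^sub>i |d\<^sub>i| \<le> m A\<close> gives the
  estimate with \<open>m\<^sup>2\<close> in place of \<open>(m - 1/8)\<^sup>2\<close>. If \<open>max |d\<^sub>i| \<le> 3/2 A\<close>, one of the two factors of \<open>r\<^sup>2\<close>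
  can be averaged with the hypothesis, which yields \<open>3/4 m\<^sup>2\<close>. Otherwise some \<open>|d\<^sub>i|\<close> differs from \<open>A\<close>
  by more than \<open>A/2\<close>, and then \<open>\<Sum>\<^sub>i |d\<^sub>i| \<le> (m - 1/8) A\<close>.
\<close>
lemma mean_square_signs_upper:
  fixes d :: "nat \<Rightarrow> 'k::real_normed_field"
  assumes r: "norm_on m r" "monotone_normalized m r" and m: "1 \<le> m"
    and half: "mean (signs {1..m}) (\<lambda>\<delta>. r (scale_coords \<delta> d)) \<le> m / 2 * (MAX i\<in>{1..m}. norm (d i))"
  shows "mean (signs {1..m}) (\<lambda>\<delta>. (r (scale_coords \<delta> d))\<^sup>2) \<le> (m - 1/8)\<^sup>2 / m * (\<Sum>i=1..m. (norm (d i))\<^sup>2)"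
proof -
  let ?f = "\<lambda>\<delta>. r (scale_coords \<delta> d)" and ?E = "mean (signs {1..m})"
  define s where "s = (\<Sum>i=1..m. norm (d i))"
  define A where "A = sqrt ((\<Sum>i=1..m. (norm (d i))\<^sup>2) / m)"
  have s: "0 \<le> s" by (simp add: s_def sum_nonneg)
  have A: "0 \<le> A" "m * A\<^sup>2 = (\<Sum>i=1..m. (norm (d i))\<^sup>2)" using m by (auto simp: A_def sum_nonneg)
  have f: "0 \<le> ?f \<delta>" for \<delta> by (rule norm_on_nonneg[OF r(1)])
  have fs: "?f \<delta> \<le> s" if \<delta>: "\<delta> \<in> signs {1..m}" for \<delta>
  proof -
    have "?f \<delta> = r (restr {1..m} (scale_coords \<delta> d))"
      by (rule norm_on_cong[OF r(1)]) (simp add: restr_def)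
    also have "\<dots> \<le> (\<Sum>i=1..m. norm (scale_coords \<delta> d i))"
      using r(2) by (intro norm_on_restr_le_sum[OF r(1)]) (auto simp: monotone_normalized_def)
    also have "\<dots> = s"
      unfolding s_def
    proof (rule sum.cong[OF refl])
      fix i assume "i \<in> {1..m}"
      then show "norm (scale_coords \<delta> d i) = norm (d i)"
        using signs_values(1)[OF \<delta>, of i] by (auto simp: scale_coords_def norm_mult)
    qed
    finally show ?thesis .
  qed
  have dev: "(\<Sum>i=1..m. (norm (d i) - A)\<^sup>2) = 2 * m * A\<^sup>2 - 2 * A * s"
  proof -
    have "(\<Sum>i=1..m. (norm (d i) - A)\<^sup>2) = (\<Sum>i=1..m. (norm (d i))\<^sup>2 + A\<^sup>2 - 2 * A * norm (d i))"
      by (simp add: power2_eq_square algebra_simps)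
    also have "\<dots> = (\<Sum>i=1..m. (norm (d i))\<^sup>2) + m * A\<^sup>2 - 2 * A * s"
      by (simp add: sum.distrib sum_subtractf sum_distrib_left s_def)
    finally show ?thesis using A(2) by simp
  qed
  have "?E (\<lambda>\<delta>. (?f \<delta>)\<^sup>2) \<le> (m - 1/8)\<^sup>2 * A\<^sup>2"
  proof (cases "(MAX i\<in>{1..m}. norm (d i)) \<le> 3/2 * A")
    case True
    have sA: "s \<le> m * A"
    proof (cases "A = 0")
      case False
      have "0 \<le> 2 * m * A\<^sup>2 - 2 * A * s" unfolding dev[symmetric] by (intro sum_nonneg) auto
      then have "A * s \<le> A * (m * A)" by (simp add: power2_eq_square algebra_simps)
      then show ?thesis using False A(1) by simp
    next
      case True
      then have "\<forall>i\<in>{1..m}. norm (d i) = 0" using A(2) by (simp add: sum_nonneg_eq_0_iff)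
      then have "s = 0" unfolding s_def by simp
      then show ?thesis using A(1) by simp
    qed
    have "?E (\<lambda>\<delta>. (?f \<delta>)\<^sup>2) \<le> ?E (\<lambda>\<delta>. s * ?f \<delta>)"
      using fs f by (intro mean_mono) (simp add: power2_eq_square mult_right_mono)
    also have "\<dots> \<le> s * (m / 2 * (3/2 * A))"
      unfolding mean_cmult
    proof (rule mult_left_mono[OF order_trans[OF half] s])
      show "m / 2 * (MAX i\<in>{1..m}. norm (d i)) \<le> m / 2 * (3/2 * A)"
        using True by (intro mult_left_mono) auto
    qed
    also have "\<dots> \<le> (m * A) * (m / 2 * (3/2 * A))" using sA A(1) by (intro mult_right_mono) auto
    also have "\<dots> = (3/4 * (real m)\<^sup>2) * A\<^sup>2" by (simp add: power2_eq_square)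
    also have "\<dots> \<le> (m - 1/8)\<^sup>2 * A\<^sup>2"
    proof (rule mult_right_mono)
      have "real m \<le> real m * real m" using m by simp
      then show "3/4 * (real m)\<^sup>2 \<le> (m - 1/8)\<^sup>2" by (simp add: power2_eq_square algebra_simps)
    qed simp
    finally show ?thesis .
  next
    case False
    have "(MAX i\<in>{1..m}. norm (d i)) \<in> (\<lambda>i. norm (d i)) ` {1..m}" using m by (intro Max_in) auto
    then obtain i where i: "i \<in> {1..m}" "3/2 * A < norm (d i)" using False by auto
    have "(A / 2)\<^sup>2 \<le> (norm (d i) - A)\<^sup>2" using i A(1) by (intro power_mono) auto
    also have "\<dots> \<le> (\<Sum>i=1..m. (norm (d i) - A)\<^sup>2)" using i by (intro member_le_sum) auto
    finally have "2 * A * s \<le> 2 * A * ((m - 1/8) * A)"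
      unfolding dev by (simp add: power2_eq_square algebra_simps)
    have sA: "s \<le> (m - 1/8) * A"
    proof (cases "A = 0")
      case True
      then have "\<forall>i\<in>{1..m}. norm (d i) = 0" using A(2) by (simp add: sum_nonneg_eq_0_iff)
      then show ?thesis using True by (simp add: s_def)
    next
      case False
      then show ?thesis using \<open>2 * A * s \<le> 2 * A * ((m - 1/8) * A)\<close> A(1) by simp
    qed
    have "?E (\<lambda>\<delta>. (?f \<delta>)\<^sup>2) \<le> ?E (\<lambda>\<delta>. s\<^sup>2)"
      using fs f by (intro mean_mono power_mono) auto
    also have "\<dots> = s\<^sup>2" by (simp add: mean_const finite_signs signs_nonempty)
    also have "\<dots> \<le> ((m - 1/8) * A)\<^sup>2" using sA s by (intro power_mono) auto
    finally show ?thesis by (simp add: power_mult_distrib)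
  qed
  also have "A\<^sup>2 = (\<Sum>i=1..m. (norm (d i))\<^sup>2) / m" using A(2) m by (simp add: field_simps)
  finally show ?thesis by simp
qed

text \<open>
  Let \<open>M\<close> be the largest \<open>|d\<^sub>i|\<close>. The average of \<open>r\<close> is at least \<open>M\<close>, which gives the estimate with \<open>m\<close>
  in place of \<open>m - 3/4\<close>. If all \<open>|d\<^sub>i|\<close> are at least \<open>M/2\<close>, the hypothesis improves this lower bound
  to \<open>2 M\<close>. Otherwise one term of \<open>\<Sum>\<^sub>i |d\<^sub>i|\<^sup>2\<close> is less than \<open>M\<^sup>2/4\<close>, and the sum is less than
  \<open>(m - 3/4) M\<^sup>2\<close>.
\<close>
lemma mean_square_signs_lower:
  fixes d :: "nat \<Rightarrow> 'k::real_normed_field"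
  assumes r: "norm_on m r" "monotone_normalized m r" and m: "1 \<le> m"
    and quarter: "(MIN i\<in>{1..m}. norm (d i)) \<le> 1/4 * mean (signs {1..m}) (\<lambda>\<delta>. r (scale_coords \<delta> d))"
  shows "(\<Sum>i=1..m. (norm (d i))\<^sup>2) / (m - 3/4) \<le> mean (signs {1..m}) (\<lambda>\<delta>. (r (scale_coords \<delta> d))\<^sup>2)"
proof -
  let ?f = "\<lambda>\<delta>. r (scale_coords \<delta> d)" and ?E = "mean (signs {1..m})"
  define M where "M = (MAX i\<in>{1..m}. norm (d i))"
  have leM: "norm (d i) \<le> M" if "i \<in> {1..m}" for i unfolding M_def using that by (intro Max_ge) auto
  have M0: "0 \<le> M" using order_trans[OF norm_ge_zero leM[of 1]] m by simp
  have "M \<in> (\<lambda>i. norm (d i)) ` {1..m}" unfolding M_def using m by (intro Max_in) auto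
  then obtain k where k: "k \<in> {1..m}" "M = norm (d k)" by blast
  have "r (unit_vec k) = 1" using r(2) k(1) unfolding monotone_normalized_def by blast
  then have EM: "M \<le> ?E ?f" unfolding k(2) by (rule mean_signs_ge_coordinate[OF r(1) _ k(1)])
  have m': "0 < real m - 3/4" using m by simp
  have "(\<Sum>i=1..m. (norm (d i))\<^sup>2) \<le> (m - 3/4) * (?E ?f)\<^sup>2"
  proof (cases "M / 2 \<le> (MIN i\<in>{1..m}. norm (d i))")
    case True
    then have "2 * M \<le> ?E ?f" using quarter by simp
    then have "(2 * M)\<^sup>2 \<le> (?E ?f)\<^sup>2" using M0 by (intro power_mono) auto
    have "(\<Sum>i=1..m. (norm (d i))\<^sup>2) \<le> (\<Sum>i=1..m. M\<^sup>2)"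
      using leM by (intro sum_mono power_mono) auto
    also have "\<dots> = m / 4 * (2 * M)\<^sup>2" by (simp add: power2_eq_square)
    also have "\<dots> \<le> m / 4 * (?E ?f)\<^sup>2"
      using \<open>(2 * M)\<^sup>2 \<le> (?E ?f)\<^sup>2\<close> by (intro mult_left_mono) auto
    also have "\<dots> \<le> (m - 3/4) * (?E ?f)\<^sup>2" using m by (intro mult_right_mono) auto
    finally show ?thesis .
  next
    case False
    have "(MIN i\<in>{1..m}. norm (d i)) \<in> (\<lambda>i. norm (d i)) ` {1..m}" using m by (intro Min_in) auto
    then obtain i where i: "i \<in> {1..m}" "norm (d i) < M / 2" using False by auto
    have "(\<Sum>i=1..m. (norm (d i))\<^sup>2) = (norm (d i))\<^sup>2 + (\<Sum>i\<in>{1..m} - {i}. (norm (d i))\<^sup>2)"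
      using i by (intro sum.remove) auto
    also have "(norm (d i))\<^sup>2 \<le> (M / 2)\<^sup>2" using i by (intro power_mono) auto
    also have "(\<Sum>i\<in>{1..m} - {i}. (norm (d i))\<^sup>2) \<le> (\<Sum>i\<in>{1..m} - {i}. M\<^sup>2)"
      using leM by (intro sum_mono power_mono) auto
    also have "(M / 2)\<^sup>2 + (\<Sum>i\<in>{1..m} - {i}. M\<^sup>2) = (m - 3/4) * M\<^sup>2"
      using i(1) m by (simp add: power2_eq_square of_nat_diff algebra_simps)
    also have "\<dots> \<le> (m - 3/4) * (?E ?f)\<^sup>2"
      using m' EM M0 by (intro mult_left_mono power_mono) auto
    finally show ?thesis by simp
  qed
  also have "\<dots> \<le> (m - 3/4) * ?E (\<lambda>\<delta>. (?f \<delta>)\<^sup>2)"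
    using m' by (intro mult_left_mono mean_square_le) auto
  finally show ?thesis using m' by (simp add: pos_divide_le_eq mult.commute)
qed

section \<open>Limits and suprema of optimal constants\<close>

text \<open>
  All constants are infima of upward closed sets. The next two lemmas translate boundedness and
  convergence to 0 of such infima into estimates with explicit constants. Monotonicity in the constant
  is assumed from the index 1 on, since at 0 the maximum over the coordinates is that of the empty
  set.
\<close>
lemma SUP_Inf_finite_iff:
  fixes P :: "nat \<Rightarrow> real \<Rightarrow> bool"
  assumes up: "\<And>n T T'. 1 \<le> n \<Longrightarrow> T \<le> T' \<Longrightarrow> P n T \<Longrightarrow> P n T'"
  shows "(SUP n\<in>{1..}. Inf {ereal T | T. 0 < T \<and> P n T}) < \<infinity> \<longleftrightarrow> (\<exists>T>0. \<forall>n\<ge>1. P n T)"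
proof
  assume fin: "(SUP n\<in>{1..}. Inf {ereal T | T. 0 < T \<and> P n T}) < \<infinity>"
  then obtain C :: real where C: "(SUP n\<in>{1..}. Inf {ereal T | T. 0 < T \<and> P n T}) < ereal C"
    using ereal_dense2 by blast
  have "P n (max C 1)" if n: "1 \<le> n" for n
  proof -
    have "Inf {ereal T | T. 0 < T \<and> P n T} \<le> (SUP n\<in>{1..}. Inf {ereal T | T. 0 < T \<and> P n T})"
      using n by (intro SUP_upper) auto
    then have "Inf {ereal T | T. 0 < T \<and> P n T} < ereal C" using C by (rule le_less_trans)
    then obtain T where "P n T" "T < C" by (auto simp: Inf_less_iff)
    then show ?thesis using up[OF n, of T "max C 1"] by simp
  qed
  then show "\<exists>T>0. \<forall>n\<ge>1. P n T" by (intro exI[of _ "max C 1"]) auto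
next
  assume "\<exists>T>0. \<forall>n\<ge>1. P n T"
  then obtain T where "0 < T" "\<forall>n\<ge>1. P n T" by blast
  then have "(SUP n\<in>{1..}. Inf {ereal T | T. 0 < T \<and> P n T}) \<le> ereal T"
    by (intro SUP_least Inf_lower) auto
  also have "\<dots> < \<infinity>" by simp
  finally show "(SUP n\<in>{1..}. Inf {ereal T | T. 0 < T \<and> P n T}) < \<infinity>" .
qed

lemma Inf_tendsto_0_iff:
  fixes P :: "nat \<Rightarrow> real \<Rightarrow> bool"
  assumes up: "\<And>n T T'. 1 \<le> n \<Longrightarrow> T \<le> T' \<Longrightarrow> P n T \<Longrightarrow> P n T'"
  shows "(\<lambda>n. Inf {ereal T | T. 0 < T \<and> P n T}) \<longlonglongrightarrow> 0 \<longleftrightarrow> (\<forall>e>0. \<forall>\<^sub>F n in sequentially. P n e)"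
proof
  assume lim: "(\<lambda>n. Inf {ereal T | T. 0 < T \<and> P n T}) \<longlonglongrightarrow> 0"
  show "\<forall>e>0. \<forall>\<^sub>F n in sequentially. P n e"
  proof (intro allI impI)
    fix e :: real assume e: "0 < e"
    have "\<forall>\<^sub>F n in sequentially. Inf {ereal T | T. 0 < T \<and> P n T} < ereal e"
      using order_tendstoD(2)[OF lim, of "ereal e"] e by simp
    then show "\<forall>\<^sub>F n in sequentially. P n e"
      using eventually_ge_at_top[of 1]
    proof eventually_elim
      case (elim n)
      then obtain T where "P n T" "T < e" by (auto simp: Inf_less_iff)
      then show ?case using up[OF elim(2), of T e] by simp
    qed
  qed
next
  assume ev: "\<forall>e>0. \<forall>\<^sub>F n in sequentially. P n e"
  have nonneg: "0 \<le> Inf {ereal T | T. 0 < T \<and> P n T}" for n by (intro Inf_greatest) auto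
  show "(\<lambda>n. Inf {ereal T | T. 0 < T \<and> P n T}) \<longlonglongrightarrow> 0"
  proof (rule order_tendstoI)
    fix c :: ereal assume "c < 0"
    then show "\<forall>\<^sub>F n in sequentially. c < Inf {ereal T | T. 0 < T \<and> P n T}"
      using nonneg by (intro always_eventually allI) (rule less_le_trans)
  next
    fix c :: ereal assume "0 < c"
    then obtain e where e: "0 < ereal e" "ereal e < c" using ereal_dense2[of 0 c] by blast
    then have "\<forall>\<^sub>F n in sequentially. P n e" using ev by simp
    then show "\<forall>\<^sub>F n in sequentially. Inf {ereal T | T. 0 < T \<and> P n T} < c"
    proof eventually_elim
      case (elim n)
      then have "Inf {ereal T | T. 0 < T \<and> P n T} \<le> ereal e" using e(1) by (intro Inf_lower) auto
      then show ?case using e(2) by (rule le_less_trans)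
    qed
  qed
qed

lemma eventually_le_powr_neg:
  fixes c e T :: real
  assumes "0 < c" "0 < e"
  shows "\<forall>\<^sub>F n in sequentially. T * real n powr (- c) \<le> e"
proof -
  have "(\<lambda>n. real n powr (- c)) \<longlonglongrightarrow> 0"
    using assms by (intro tendsto_neg_powr filterlim_real_sequentially) auto
  then have "(\<lambda>n. T * real n powr (- c)) \<longlonglongrightarrow> 0" by (rule tendsto_mult_right_zero)
  from order_tendstoD(2)[OF this assms(2)] show ?thesis by (rule eventually_mono) simp
qed

lemma lp_norm_scaled_le:
  assumes p: "1 < p" and n: "1 \<le> n" and T: "0 < T" and e: "T * real n powr (- (1 - 1 / p)) \<le> e"
  shows "1 / n * (T * lp_norm p n a) \<le> e * (MAX i\<in>{1..n}. norm (a i))"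
proof -
  have "1 / n * (T * lp_norm p n a) \<le> 1 / n * (T * (real n powr (1 / p) * (MAX i\<in>{1..n}. norm (a i))))"
    using p n T lp_norm_le_Max[of p n a] by (intro mult_left_mono) auto
  also have "\<dots> = (T * real n powr (- (1 - 1 / p))) * (MAX i\<in>{1..n}. norm (a i))"
    using n by (simp add: powr_diff field_simps)
  also have "\<dots> \<le> e * (MAX i\<in>{1..n}. norm (a i))"
    using e Max_norm_nonneg[OF n] by (intro mult_right_mono) auto
  finally show ?thesis .
qed

lemma Min_norm_le_of_lp_norm_le:
  assumes q: "0 < q" and n: "1 \<le> n" and e: "C * real n powr (- (1 / q)) \<le> e"
    and x: "0 \<le> x" "lp_norm q n a \<le> C * x"
  shows "(MIN i\<in>{1..n}. norm (a i)) \<le> e * x"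
proof -
  have "(MIN i\<in>{1..n}. norm (a i)) = real n powr (- (1 / q)) * (real n powr (1 / q) * (MIN i\<in>{1..n}. norm (a i)))"
    using n by (simp add: powr_minus field_simps)
  also have "\<dots> \<le> real n powr (- (1 / q)) * (C * x)"
    using lp_norm_ge_Min[OF q n, of a] x(2) by (intro mult_left_mono) auto
  also have "\<dots> = (C * real n powr (- (1 / q))) * x" by simp
  also have "\<dots> \<le> e * x" using e x(1) by (intro mult_right_mono)
  finally show ?thesis .
qed

section \<open>Families of norms closed under normalised blocks\<close>

locale block_closed_norms =
  fixes S :: "nat \<Rightarrow> ((nat \<Rightarrow> 'k::real_normed_field) \<Rightarrow> real) set"
  assumes norm_on: "r \<in> S n \<Longrightarrow> norm_on n r"
    and monotone: "r \<in> S n \<Longrightarrow> monotone_normalized n r"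
    and block_norm: "r \<in> S N \<Longrightarrow> mono_on {1..N} g \<Longrightarrow> g ` {1..N} \<subseteq> {1..m} \<Longrightarrow>
      (\<And>j. j \<in> {1..m} \<Longrightarrow> r (restr {i. g i = j} a) = 1) \<Longrightarrow> block_norm r g a \<in> S m"
begin

text \<open>
  For arbitrary nonzero blocks, the norms of the blocks appear as weights.
\<close>
lemma weighted_block_norm:
  assumes r: "r \<in> S N" and g: "mono_on {1..N} g" "g ` {1..N} \<subseteq> {1..m}"
    and pos: "\<And>j. j \<in> {1..m} \<Longrightarrow> 0 < r (restr {i. g i = j} a)"
  obtains s where "s \<in> S m"
    and "\<And>d. s (\<lambda>j. d j * of_real (r (restr {i. g i = j} a))) = r (\<lambda>i. d (g i) * a i)"
proof -
  define \<rho> where "\<rho> j = r (restr {i. g i = j} a)" for j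
  define b where "b i = of_real (1 / \<rho> (g i)) * a i" for i
  have r': "norm_on N r" by (rule norm_on[OF r])
  have "r (restr {i. g i = j} b) = 1" if j: "j \<in> {1..m}" for j
  proof -
    have "restr {i. g i = j} b = (\<lambda>i. of_real (1 / \<rho> j) * restr {i. g i = j} a i)"
      by (auto simp: restr_def b_def)
    then have "r (restr {i. g i = j} b) = norm (of_real (1 / \<rho> j) :: 'k) * \<rho> j"
      unfolding \<rho>_def by (simp only: norm_on_scale[OF r'])
    then show ?thesis using pos[OF j] by (simp add: \<rho>_def norm_divide)
  qed
  then have "block_norm r g b \<in> S m" by (rule block_norm[OF r g])
  moreover have "block_norm r g b (\<lambda>j. d j * of_real (\<rho> j)) = r (\<lambda>i. d (g i) * a i)" for d
    unfolding block_norm_def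
  proof (rule norm_on_cong[OF r'])
    fix i assume "i \<in> {1..N}"
    then have "g i \<in> {1..m}" using g(2) by blast
    then have "\<rho> (g i) \<noteq> 0" using pos by (force simp: \<rho>_def)
    then show "d (g i) * of_real (\<rho> (g i)) * b i = d (g i) * a i"
      by (simp add: b_def)
  qed
  ultimately show ?thesis by (rule that[unfolded \<rho>_def[symmetric]])
qed

lemma upper_block_estimate_of_subtype:
  assumes m: "2 \<le> m"
    and half: "\<forall>r\<in>S m. \<forall>a. r (\<lambda>i. of_real (1 / real m) * a i) \<le> 1/2 * (MAX i\<in>{1..m}. norm (a i))"
    and r: "r \<in> S N"
  shows "upper_block_estimate m (m - 1/8) N r"
  unfolding upper_block_estimate_def
proof (intro allI impI)
  fix g a M assume g: "mono_on {1..N} g" "g ` {1..N} \<subseteq> {1..m}"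
    and blocks: "\<forall>j\<in>{1..m}. 0 < r (restr {i. g i = j} a) \<and> r (restr {i. g i = j} a) \<le> M"
  define \<rho> where "\<rho> j = r (restr {i. g i = j} a)" for j
  obtain s where s: "s \<in> S m" "\<And>d. s (\<lambda>j. d j * of_real (\<rho> j)) = r (\<lambda>i. d (g i) * a i)"
    using weighted_block_norm[OF r g, of a] blocks unfolding \<rho>_def by blast
  have "norm (of_real (1 / real m) :: 'k) * s (\<lambda>j. of_real (\<rho> j)) \<le> 1/2 * (MAX j\<in>{1..m}. norm (of_real (\<rho> j) :: 'k))"
    unfolding norm_on_scale[OF norm_on[OF s(1)], symmetric] by (rule half[rule_format, OF s(1)])
  also have "(MAX j\<in>{1..m}. norm (of_real (\<rho> j) :: 'k)) \<le> M"
    using blocks m by (subst Max_le_iff) (auto simp: \<rho>_def)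
  finally have "s (\<lambda>j. of_real (\<rho> j)) \<le> m / 2 * M" using m by (simp add: norm_divide field_simps)
  also have "\<dots> \<le> (m - 1/8) * M"
  proof (rule mult_right_mono)
    have "0 < \<rho> 1 \<and> \<rho> 1 \<le> M" using blocks m unfolding \<rho>_def by auto
    then show "0 \<le> M" by linarith
  qed (use m in simp)
  finally show "r a \<le> (m - 1/8) * M" using s(2)[of "\<lambda>_. 1"] by simp
qed

lemma lower_block_estimate_of_subcotype:
  assumes m: "1 \<le> m"
    and half: "\<forall>r\<in>S m. \<forall>a. 1/2 * r a \<ge> (MIN i\<in>{1..m}. norm (a i))"
    and r: "r \<in> S N"
  shows "lower_block_estimate m 2 N r"
  unfolding lower_block_estimate_def
proof (intro allI impI)
  fix g a M assume g: "mono_on {1..N} g" "g ` {1..N} \<subseteq> {1..m}"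
    and blocks: "\<forall>j\<in>{1..m}. M \<le> r (restr {i. g i = j} a)" and M: "0 < M"
  define \<rho> where "\<rho> j = r (restr {i. g i = j} a)" for j
  have "0 < r (restr {i. g i = j} a)" if "j \<in> {1..m}" for j using blocks M that by force
  then obtain s where s: "s \<in> S m" "\<And>d. s (\<lambda>j. d j * of_real (\<rho> j)) = r (\<lambda>i. d (g i) * a i)"
    using weighted_block_norm[OF r g, of a] unfolding \<rho>_def by blast
  have "M \<le> (MIN j\<in>{1..m}. norm (of_real (\<rho> j) :: 'k))"
    using blocks m M by (subst Min_ge_iff) (auto simp: \<rho>_def)
  also have "\<dots> \<le> 1/2 * s (\<lambda>j. of_real (\<rho> j))" by (rule half[rule_format, OF s(1)])
  finally show "2 * M \<le> r a" using s(2)[of "\<lambda>_. 1"] by simp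
qed

text \<open>
  Multiplying the signs in each block by an independent common sign does not change their
  distribution. This introduces the signs \<open>\<delta>\<close> to which the assumption on norms of order \<open>m\<close> applies,
  for each fixed \<open>\<epsilon>\<close>.
\<close>
lemma rms_norm_square_blocks:
  assumes r: "r \<in> S N" and g: "g ` {1..N} \<subseteq> {1..m}"
  shows "(rms_norm N r a)\<^sup>2 = mean (signs {1..N}) (\<lambda>\<epsilon>. mean (signs {1..m}) (\<lambda>\<delta>.
    (r (\<lambda>i. of_real (\<delta> (g i)) * scale_coords \<epsilon> a i))\<^sup>2))"
proof -
  have "mean (signs {1..N}) (\<lambda>\<epsilon>. (r (\<lambda>i. of_real (\<delta> (g i)) * scale_coords \<epsilon> a i))\<^sup>2) = (rms_norm N r a)\<^sup>2"
    if \<delta>: "\<delta> \<in> signs {1..m}" for \<delta>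
  proof -
    have "mean (signs {1..N}) (\<lambda>\<epsilon>. (r (scale_coords (\<lambda>i. \<delta> (g i) * \<epsilon> i) a))\<^sup>2)
        = mean (signs {1..N}) (\<lambda>\<epsilon>. (r (scale_coords \<epsilon> a))\<^sup>2)"
      using g by (intro mean_signs_flip signs_values(1)[OF \<delta>]) blast
    then show ?thesis by (simp add: rms_norm_square scale_coords_def mult.assoc)
  qed
  then have "mean (signs {1..m}) (\<lambda>\<delta>. mean (signs {1..N}) (\<lambda>\<epsilon>.
      (r (\<lambda>i. of_real (\<delta> (g i)) * scale_coords \<epsilon> a i))\<^sup>2)) = mean (signs {1..m}) (\<lambda>_. (rms_norm N r a)\<^sup>2)"
    by (intro mean_cong)
  then show ?thesis by (subst mean_swap) (simp add: mean_const finite_signs signs_nonempty)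
qed

lemma signed_weighted_block_norm:
  assumes r: "r \<in> S N" and g: "mono_on {1..N} g" "g ` {1..N} \<subseteq> {1..m}"
    and pos: "\<And>j. j \<in> {1..m} \<Longrightarrow> 0 < rms_norm N r (restr {i. g i = j} a)" and \<epsilon>: "\<epsilon> \<in> signs {1..N}"
  obtains s where "s \<in> S m"
    and "\<And>\<delta>. s (scale_coords \<delta> (\<lambda>j. of_real (r (scale_coords \<epsilon> (restr {i. g i = j} a))))) =
      r (\<lambda>i. of_real (\<delta> (g i)) * scale_coords \<epsilon> a i)"
proof -
  have restr: "restr {i. g i = j} (scale_coords \<epsilon> a) = scale_coords \<epsilon> (restr {i. g i = j} a)" for j
    by (auto simp: restr_def scale_coords_def)
  have "0 < r (restr {i. g i = j} (scale_coords \<epsilon> a))" if "j \<in> {1..m}" for j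
  proof -
    have "rms_norm N r (restr {i. g i = j} a) \<noteq> 0" using pos[OF that] by simp
    then have "r (restr {i. g i = j} a) \<noteq> 0"
      unfolding norm_on_eq_0[OF norm_on_rms_norm[OF norm_on[OF r]]] norm_on_eq_0[OF norm_on[OF r]] .
    then have "0 < r (restr {i. g i = j} a)"
      using norm_on_nonneg[OF norm_on[OF r]] by (metis order_less_le)
    then show ?thesis unfolding restr scale_coords_pos_iff[OF norm_on[OF r] \<epsilon>] .
  qed
  then obtain s where "s \<in> S m"
    "\<And>d. s (\<lambda>j. d j * of_real (r (restr {i. g i = j} (scale_coords \<epsilon> a)))) = r (\<lambda>i. d (g i) * scale_coords \<epsilon> a i)"
    using weighted_block_norm[OF r g, of "scale_coords \<epsilon> a"] by blast
  then show ?thesis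
    unfolding restr by (intro that[of s]) (simp_all add: scale_coords_def[of _ "\<lambda>j. of_real (_ j)"])
qed

text \<open>
  For fixed \<open>\<epsilon>\<close> the hypothesis on norms of order \<open>m\<close> gives an estimate by a sum of squares over the
  blocks, and averaging it over \<open>\<epsilon>\<close> produces the squares of the averaged norms of the blocks.
\<close>
lemma upper_block_estimate_rms_norm:
  assumes m: "2 \<le> m"
    and half: "\<forall>r\<in>S m. \<forall>a. mean (signs {1..m}) (\<lambda>\<delta>. r (scale_coords \<delta> a)) \<le> m / 2 * (MAX i\<in>{1..m}. norm (a i))"
    and r: "r \<in> S N"
  shows "upper_block_estimate m (m - 1/8) N (rms_norm N r)"
  unfolding upper_block_estimate_def
proof (intro allI impI)
  fix g a M assume g: "mono_on {1..N} g" "g ` {1..N} \<subseteq> {1..m}"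
    and blocks: "\<forall>j\<in>{1..m}. 0 < rms_norm N r (restr {i. g i = j} a) \<and> rms_norm N r (restr {i. g i = j} a) \<le> M"
  have M: "0 \<le> M" using bspec[OF blocks, of 1] m by simp
  define \<rho> where "\<rho> \<epsilon> j = r (scale_coords \<epsilon> (restr {i. g i = j} a))" for \<epsilon> j
  let ?C = "(m - 1/8)\<^sup>2 / m"
  have "mean (signs {1..m}) (\<lambda>\<delta>. (r (\<lambda>i. of_real (\<delta> (g i)) * scale_coords \<epsilon> a i))\<^sup>2)
      \<le> ?C * (\<Sum>j=1..m. (\<rho> \<epsilon> j)\<^sup>2)" if \<epsilon>: "\<epsilon> \<in> signs {1..N}" for \<epsilon>
  proof -
    obtain s where s: "s \<in> S m" "\<And>\<delta>. s (scale_coords \<delta> (\<lambda>j. of_real (\<rho> \<epsilon> j))) =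
        r (\<lambda>i. of_real (\<delta> (g i)) * scale_coords \<epsilon> a i)"
      using signed_weighted_block_norm[OF r g _ \<epsilon>, of a] blocks unfolding \<rho>_def by blast
    have "1 \<le> m" using m by simp
    from mean_square_signs_upper[OF norm_on[OF s(1)] monotone[OF s(1)] this half[rule_format, OF s(1)],
        of "\<lambda>j. of_real (\<rho> \<epsilon> j)"]
    show ?thesis unfolding s(2) by simp
  qed
  then have "(rms_norm N r a)\<^sup>2 \<le> mean (signs {1..N}) (\<lambda>\<epsilon>. ?C * (\<Sum>j=1..m. (\<rho> \<epsilon> j)\<^sup>2))"
    unfolding rms_norm_square_blocks[OF r g(2)] by (rule mean_mono)
  also have "\<dots> = ?C * (\<Sum>j=1..m. (rms_norm N r (restr {i. g i = j} a))\<^sup>2)"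
    unfolding mean_cmult mean_sum rms_norm_square \<rho>_def ..
  also have "\<dots> \<le> ?C * (\<Sum>j=1..m. M\<^sup>2)"
  proof (intro mult_left_mono sum_mono power_mono)
    fix j assume "j \<in> {1..m}"
    then show "rms_norm N r (restr {i. g i = j} a) \<le> M" "0 \<le> rms_norm N r (restr {i. g i = j} a)"
      using blocks by (auto intro: less_imp_le)
  qed simp
  also have "\<dots> = ((m - 1/8) * M)\<^sup>2" using m by (simp add: power_mult_distrib)
  finally show "rms_norm N r a \<le> (m - 1/8) * M"
    by (rule power2_le_imp_le) (use m M in simp)
qed

lemma lower_block_estimate_rms_norm:
  assumes m: "1 \<le> m"
    and quarter: "\<forall>r\<in>S m. \<forall>a. (MIN i\<in>{1..m}. norm (a i)) \<le> 1/4 * mean (signs {1..m}) (\<lambda>\<delta>. r (scale_coords \<delta> a))"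
    and r: "r \<in> S N"
  shows "lower_block_estimate m (sqrt (m / (m - 3/4))) N (rms_norm N r)"
  unfolding lower_block_estimate_def
proof (intro allI impI)
  fix g a M assume g: "mono_on {1..N} g" "g ` {1..N} \<subseteq> {1..m}"
    and blocks: "\<forall>j\<in>{1..m}. M \<le> rms_norm N r (restr {i. g i = j} a)" and M: "0 < M"
  define \<rho> where "\<rho> \<epsilon> j = r (scale_coords \<epsilon> (restr {i. g i = j} a))" for \<epsilon> j
  let ?C = "1 / (real m - 3/4)"
  have m': "0 < real m - 3/4" using m by simp
  have pos: "0 < rms_norm N r (restr {i. g i = j} a)" if "j \<in> {1..m}" for j using blocks M that by force
  have "?C * (\<Sum>j=1..m. (\<rho> \<epsilon> j)\<^sup>2) \<le>
      mean (signs {1..m}) (\<lambda>\<delta>. (r (\<lambda>i. of_real (\<delta> (g i)) * scale_coords \<epsilon> a i))\<^sup>2)"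
    if \<epsilon>: "\<epsilon> \<in> signs {1..N}" for \<epsilon>
  proof -
    obtain s where s: "s \<in> S m" "\<And>\<delta>. s (scale_coords \<delta> (\<lambda>j. of_real (\<rho> \<epsilon> j))) =
        r (\<lambda>i. of_real (\<delta> (g i)) * scale_coords \<epsilon> a i)"
      using signed_weighted_block_norm[OF r g pos \<epsilon>] unfolding \<rho>_def by blast
    from mean_square_signs_lower[OF norm_on[OF s(1)] monotone[OF s(1)] m quarter[rule_format, OF s(1)],
        of "\<lambda>j. of_real (\<rho> \<epsilon> j)"]
    show ?thesis unfolding s(2) by simp
  qed
  then have "mean (signs {1..N}) (\<lambda>\<epsilon>. ?C * (\<Sum>j=1..m. (\<rho> \<epsilon> j)\<^sup>2)) \<le> (rms_norm N r a)\<^sup>2"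
    unfolding rms_norm_square_blocks[OF r g(2)] by (rule mean_mono)
  moreover have "mean (signs {1..N}) (\<lambda>\<epsilon>. ?C * (\<Sum>j=1..m. (\<rho> \<epsilon> j)\<^sup>2))
      = ?C * (\<Sum>j=1..m. (rms_norm N r (restr {i. g i = j} a))\<^sup>2)"
    unfolding mean_cmult mean_sum rms_norm_square \<rho>_def ..
  moreover have "?C * (\<Sum>j=1..m. M\<^sup>2) \<le> ?C * (\<Sum>j=1..m. (rms_norm N r (restr {i. g i = j} a))\<^sup>2)"
    using blocks M m' by (intro mult_left_mono sum_mono power_mono) auto
  moreover have "?C * (\<Sum>j=1..m. M\<^sup>2) = (sqrt (m / (m - 3/4)) * M)\<^sup>2"
    using m' by (simp add: power_mult_distrib)
  ultimately have "(sqrt (m / (m - 3/4)) * M)\<^sup>2 \<le> (rms_norm N r a)\<^sup>2" by linarith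
  then show "sqrt (m / (m - 3/4)) * M \<le> rms_norm N r a"
    by (rule power2_le_imp_le) (rule norm_on_nonneg[OF norm_on_rms_norm[OF norm_on[OF r]]])
qed

lemma rademacher_norm_signs:
  assumes "r \<in> S n"
  shows "rademacher_norm p n (\<lambda>\<epsilon>. r (\<lambda>i. of_real (\<epsilon> i) * a i))
    = mean (signs {1..n}) (\<lambda>\<epsilon>. r (scale_coords \<epsilon> a) powr p) powr (1 / p)"
  unfolding rademacher_norm_eq_mean scale_coords_def
  using norm_on_nonneg[OF norm_on[OF assms]] by simp

lemma rademacher_norm_1_signs:
  assumes "r \<in> S n"
  shows "rademacher_norm 1 n (\<lambda>\<epsilon>. r (\<lambda>i. of_real (\<epsilon> i) * a i)) = mean (signs {1..n}) (\<lambda>\<epsilon>. r (scale_coords \<epsilon> a))"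
  using norm_on_nonneg[OF norm_on[OF assms]] by (simp add: rademacher_norm_signs[OF assms] mean_nonneg)

lemma rademacher_norm_1_scaled_signs:
  assumes "r \<in> S n"
  shows "rademacher_norm 1 n (\<lambda>\<epsilon>. r (\<lambda>i. of_real (1 / real n) * (of_real (\<epsilon> i) * a i)))
    = 1 / n * mean (signs {1..n}) (\<lambda>\<epsilon>. r (scale_coords \<epsilon> a))"
  using norm_on_nonneg[OF norm_on[OF assms]]
  unfolding norm_on_scale[OF norm_on[OF assms]] rademacher_norm_eq_mean scale_coords_def
  by (simp add: abs_mult norm_divide mean_cmult[of _ "1 / n", simplified] mean_nonneg)

lemma basic_type_iff:
  "basic_type p S \<longleftrightarrow> (\<exists>T>0. \<forall>n\<ge>1. \<forall>r\<in>S n. \<forall>a. r a \<le> T * lp_norm p n a)"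
  unfolding basic_type_def const_alpha_def
  by (rule SUP_Inf_finite_iff) (meson mult_right_mono lp_norm_nonneg order_trans)

lemma basic_cotype_iff:
  "basic_cotype q S \<longleftrightarrow> (\<exists>C>0. \<forall>n\<ge>1. \<forall>r\<in>S n. \<forall>a. C * r a \<ge> lp_norm q n a)"
  unfolding basic_cotype_def const_beta_def
  by (rule SUP_Inf_finite_iff) (meson mult_right_mono norm_on_nonneg norm_on order_trans)

lemma type_iff:
  "type_p p S \<longleftrightarrow> (\<exists>T>0. \<forall>n\<ge>1. \<forall>r\<in>S n. \<forall>a.
    rademacher_norm p n (\<lambda>\<epsilon>. r (\<lambda>i. of_real (\<epsilon> i) * a i)) \<le> T * lp_norm p n a)"
  unfolding type_p_def const_tau_def
  by (rule SUP_Inf_finite_iff) (meson mult_right_mono lp_norm_nonneg order_trans)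

lemma cotype_iff:
  "cotype_q q S \<longleftrightarrow> (\<exists>C>0. \<forall>n\<ge>1. \<forall>r\<in>S n. \<forall>a.
    C * rademacher_norm q n (\<lambda>\<epsilon>. r (\<lambda>i. of_real (\<epsilon> i) * a i)) \<ge> lp_norm q n a)"
  unfolding cotype_q_def const_gamma_def
  by (rule SUP_Inf_finite_iff) (blast intro: order_trans[OF _ mult_right_mono] rademacher_norm_nonneg)

lemma basic_subtype_iff:
  "basic_subtype S \<longleftrightarrow> (\<forall>e>0. \<forall>\<^sub>F n in sequentially. \<forall>r\<in>S n. \<forall>a.
    r (\<lambda>i. of_real (1 / real n) * a i) \<le> e * (MAX i\<in>{1..n}. norm (a i)))"
  unfolding basic_subtype_def const_theta_def
  by (rule Inf_tendsto_0_iff) (blast intro: order_trans[OF _ mult_right_mono] Max_norm_nonneg)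

lemma subtype_iff:
  "subtype S \<longleftrightarrow> (\<forall>e>0. \<forall>\<^sub>F n in sequentially. \<forall>r\<in>S n. \<forall>a.
    rademacher_norm 1 n (\<lambda>\<epsilon>. r (\<lambda>i. of_real (1 / real n) * (of_real (\<epsilon> i) * a i)))
      \<le> e * (MAX i\<in>{1..n}. norm (a i)))"
  unfolding subtype_def const_Theta_def
  by (rule Inf_tendsto_0_iff) (blast intro: order_trans[OF _ mult_right_mono] Max_norm_nonneg)

lemma basic_subcotype_iff:
  "basic_subcotype S \<longleftrightarrow> (\<forall>e>0. \<forall>\<^sub>F n in sequentially. \<forall>r\<in>S n. \<forall>a.
    e * r a \<ge> (MIN i\<in>{1..n}. norm (a i)))"
  unfolding basic_subcotype_def const_upsilon_def
  by (rule Inf_tendsto_0_iff) (meson mult_right_mono norm_on_nonneg norm_on order_trans)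

lemma subcotype_iff:
  "subcotype S \<longleftrightarrow> (\<forall>e>0. \<forall>\<^sub>F n in sequentially. \<forall>r\<in>S n. \<forall>a.
    e * rademacher_norm 1 n (\<lambda>\<epsilon>. r (\<lambda>i. of_real (\<epsilon> i) * a i)) \<ge> (MIN i\<in>{1..n}. norm (a i)))"
  unfolding subcotype_def const_Upsilon_def
  by (rule Inf_tendsto_0_iff) (blast intro: order_trans[OF _ mult_right_mono] rademacher_norm_nonneg)

lemma basic_subtype_iff_basic_type: "basic_subtype S \<longleftrightarrow> (\<exists>p>1. basic_type p S)"
proof
  assume sub: "basic_subtype S"
  have "\<forall>\<^sub>F n in sequentially. \<forall>r\<in>S n. \<forall>a.
      r (\<lambda>i. of_real (1 / real n) * a i) \<le> 1/2 * (MAX i\<in>{1..n}. norm (a i))"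
    by (rule sub[unfolded basic_subtype_iff, THEN spec, THEN mp]) simp
  from eventually_happens'[OF _ eventually_conj[OF this eventually_ge_at_top[of 2]]]
  obtain m where m: "2 \<le> m" "\<forall>r\<in>S m. \<forall>a.
      r (\<lambda>i. of_real (1 / real m) * a i) \<le> 1/2 * (MAX i\<in>{1..m}. norm (a i))" by auto
  have "1 < real m - 1/8" "real m - 1/8 < m" using m(1) by auto
  from upper_block_estimate_imp_type[OF m(1) this, where 'k = 'k] obtain p K where p: "1 < p" "0 < K"
    and K: "\<And>N r (a :: nat \<Rightarrow> 'k). norm_on N r \<Longrightarrow> monotone_normalized N r \<Longrightarrow>
      upper_block_estimate m (m - 1/8) N r \<Longrightarrow> r a \<le> K * lp_norm p N a" by blast
  have "basic_type p S"
    unfolding basic_type_iff using p(2) K norm_on monotone upper_block_estimate_of_subtype[OF m] by blast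
  then show "\<exists>p>1. basic_type p S" using p(1) by blast
next
  assume "\<exists>p>1. basic_type p S"
  then obtain p T where p: "1 < p" "0 < T" and T: "\<forall>n\<ge>1. \<forall>r\<in>S n. \<forall>a. r a \<le> T * lp_norm p n a"
    unfolding basic_type_iff by blast
  show "basic_subtype S"
    unfolding basic_subtype_iff
  proof (intro allI impI)
    fix e :: real assume "0 < e"
    have "\<forall>\<^sub>F n in sequentially. T * real n powr (- (1 - 1 / p)) \<le> e"
      using p \<open>0 < e\<close> by (intro eventually_le_powr_neg) auto
    then show "\<forall>\<^sub>F n in sequentially. \<forall>r\<in>S n. \<forall>a.
        r (\<lambda>i. of_real (1 / real n) * a i) \<le> e * (MAX i\<in>{1..n}. norm (a i))"
      using eventually_ge_at_top[of 1]
    proof (eventually_elim, intro ballI allI)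
      fix n r and a :: "nat \<Rightarrow> 'k" assume n: "1 \<le> n" and r: "r \<in> S n" and e: "T * real n powr (- (1 - 1 / p)) \<le> e"
      have "r (\<lambda>i. of_real (1 / real n) * a i) = 1 / n * r a"
        unfolding norm_on_scale[OF norm_on[OF r]] by (simp add: norm_divide)
      also have "\<dots> \<le> 1 / n * (T * lp_norm p n a)"
        using T n r by (intro mult_left_mono) auto
      also have "\<dots> \<le> e * (MAX i\<in>{1..n}. norm (a i))" by (rule lp_norm_scaled_le[OF p(1) n p(2) e])
      finally show "r (\<lambda>i. of_real (1 / real n) * a i) \<le> e * (MAX i\<in>{1..n}. norm (a i))" .
    qed
  qed
qed

lemma basic_subcotype_iff_basic_cotype: "basic_subcotype S \<longleftrightarrow> (\<exists>q>1. basic_cotype q S)"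
proof
  assume sub: "basic_subcotype S"
  have "\<forall>\<^sub>F n in sequentially. \<forall>r\<in>S n. \<forall>a. 1/2 * r a \<ge> (MIN i\<in>{1..n}. norm (a i))"
    by (rule sub[unfolded basic_subcotype_iff, THEN spec, THEN mp]) simp
  from eventually_happens'[OF _ eventually_conj[OF this eventually_ge_at_top[of 1]]]
  obtain m where m: "1 \<le> m" "\<forall>r\<in>S m. \<forall>a. 1/2 * r a \<ge> (MIN i\<in>{1..m}. norm (a i))" by auto
  from lower_block_estimate_imp_cotype[OF m(1), of 2, where 'k = 'k] obtain q K where q: "2 \<le> q" "0 < K"
    and K: "\<And>N r (a :: nat \<Rightarrow> 'k). norm_on N r \<Longrightarrow> monotone_normalized N r \<Longrightarrow>
      lower_block_estimate m 2 N r \<Longrightarrow> lp_norm q N a \<le> K * r a" by auto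
  have "basic_cotype q S"
    unfolding basic_cotype_iff using q(2) K norm_on monotone lower_block_estimate_of_subcotype[OF m] by blast
  then show "\<exists>q>1. basic_cotype q S" using q(1) by (intro exI[of _ q]) auto
next
  assume "\<exists>q>1. basic_cotype q S"
  then obtain q C where q: "1 < q" "0 < C" and C: "\<forall>n\<ge>1. \<forall>r\<in>S n. \<forall>a. C * r a \<ge> lp_norm q n a"
    unfolding basic_cotype_iff by blast
  show "basic_subcotype S"
    unfolding basic_subcotype_iff
  proof (intro allI impI)
    fix e :: real assume "0 < e"
    have "\<forall>\<^sub>F n in sequentially. C * real n powr (- (1 / q)) \<le> e"
      using q \<open>0 < e\<close> by (intro eventually_le_powr_neg) auto
    then show "\<forall>\<^sub>F n in sequentially. \<forall>r\<in>S n. \<forall>a. e * r a \<ge> (MIN i\<in>{1..n}. norm (a i))"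
      using eventually_ge_at_top[of 1]
    proof (eventually_elim, intro ballI allI)
      fix n r and a :: "nat \<Rightarrow> 'k" assume n: "1 \<le> n" and r: "r \<in> S n" and e: "C * real n powr (- (1 / q)) \<le> e"
      show "(MIN i\<in>{1..n}. norm (a i)) \<le> e * r a"
        using q C n r norm_on_nonneg[OF norm_on[OF r]] by (intro Min_norm_le_of_lp_norm_le[OF _ n e]) auto
    qed
  qed
qed

lemma subtype_iff_type: "subtype S \<longleftrightarrow> (\<exists>p>1. type_p p S)"
proof
  assume sub: "subtype S"
  have "\<forall>\<^sub>F n in sequentially. \<forall>r\<in>S n. \<forall>a.
      rademacher_norm 1 n (\<lambda>\<epsilon>. r (\<lambda>i. of_real (1 / real n) * (of_real (\<epsilon> i) * a i)))
        \<le> 1/2 * (MAX i\<in>{1..n}. norm (a i))"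
    by (rule sub[unfolded subtype_iff, THEN spec, THEN mp]) simp
  from eventually_happens'[OF _ eventually_conj[OF this eventually_ge_at_top[of 2]]]
  obtain m where m: "2 \<le> m" "\<forall>r\<in>S m. \<forall>a.
      rademacher_norm 1 m (\<lambda>\<epsilon>. r (\<lambda>i. of_real (1 / real m) * (of_real (\<epsilon> i) * a i)))
        \<le> 1/2 * (MAX i\<in>{1..m}. norm (a i))" by auto
  have half: "\<forall>r\<in>S m. \<forall>a. mean (signs {1..m}) (\<lambda>\<delta>. r (scale_coords \<delta> a)) \<le> m / 2 * (MAX i\<in>{1..m}. norm (a i))"
  proof (intro ballI allI)
    fix r and a :: "nat \<Rightarrow> 'k" assume r: "r \<in> S m"
    show "mean (signs {1..m}) (\<lambda>\<delta>. r (scale_coords \<delta> a)) \<le> m / 2 * (MAX i\<in>{1..m}. norm (a i))"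
      using m(2)[rule_format, OF r, of a] m(1)
      unfolding rademacher_norm_1_scaled_signs[OF r] by (simp add: field_simps)
  qed
  have "1 < real m - 1/8" "real m - 1/8 < m" using m(1) by auto
  from upper_block_estimate_imp_type[OF m(1) this, where 'k = 'k] obtain p K where p: "1 < p" "p \<le> 2" "0 < K"
    and K: "\<And>N r (a :: nat \<Rightarrow> 'k). norm_on N r \<Longrightarrow> monotone_normalized N r \<Longrightarrow>
      upper_block_estimate m (m - 1/8) N r \<Longrightarrow> r a \<le> K * lp_norm p N a" by blast
  have "rademacher_norm p n (\<lambda>\<epsilon>. r (\<lambda>i. of_real (\<epsilon> i) * a i)) \<le> K * lp_norm p n a"
    if r: "r \<in> S n" for n r a
  proof -
    have "rademacher_norm p n (\<lambda>\<epsilon>. r (\<lambda>i. of_real (\<epsilon> i) * a i))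
        \<le> mean (signs {1..n}) (\<lambda>\<epsilon>. r (scale_coords \<epsilon> a) powr 2) powr (1 / 2)"
      unfolding rademacher_norm_signs[OF r] using p norm_on_nonneg[OF norm_on[OF r]]
      by (intro mean_powr_mono) (auto simp: finite_signs signs_nonempty)
    also have "\<dots> = rms_norm n r a"
      unfolding rms_norm_def using norm_on_nonneg[OF norm_on[OF r]] by (simp add: powr_half_sqrt mean_nonneg)
    also have "\<dots> \<le> K * lp_norm p n a"
      using r by (intro K norm_on_rms_norm monotone_normalized_rms_norm norm_on monotone
          upper_block_estimate_rms_norm[OF m(1) half])
    finally show ?thesis .
  qed
  then have "type_p p S" unfolding type_iff using p(3) by blast
  then show "\<exists>p>1. type_p p S" using p(1) by blast
next
  assume "\<exists>p>1. type_p p S"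
  then obtain p T where p: "1 < p" "0 < T" and T: "\<forall>n\<ge>1. \<forall>r\<in>S n. \<forall>a.
      rademacher_norm p n (\<lambda>\<epsilon>. r (\<lambda>i. of_real (\<epsilon> i) * a i)) \<le> T * lp_norm p n a"
    unfolding type_iff by blast
  show "subtype S"
    unfolding subtype_iff
  proof (intro allI impI)
    fix e :: real assume "0 < e"
    have "\<forall>\<^sub>F n in sequentially. T * real n powr (- (1 - 1 / p)) \<le> e"
      using p \<open>0 < e\<close> by (intro eventually_le_powr_neg) auto
    then show "\<forall>\<^sub>F n in sequentially. \<forall>r\<in>S n. \<forall>a.
        rademacher_norm 1 n (\<lambda>\<epsilon>. r (\<lambda>i. of_real (1 / real n) * (of_real (\<epsilon> i) * a i)))
          \<le> e * (MAX i\<in>{1..n}. norm (a i))"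
      using eventually_ge_at_top[of 1]
    proof (eventually_elim, intro ballI allI)
      fix n r and a :: "nat \<Rightarrow> 'k" assume n: "1 \<le> n" and r: "r \<in> S n" and e: "T * real n powr (- (1 - 1 / p)) \<le> e"
      have "mean (signs {1..n}) (\<lambda>\<epsilon>. r (scale_coords \<epsilon> a)) = rademacher_norm 1 n (\<lambda>\<epsilon>. r (\<lambda>i. of_real (\<epsilon> i) * a i))"
        by (rule rademacher_norm_1_signs[OF r, symmetric])
      also have "\<dots> \<le> rademacher_norm p n (\<lambda>\<epsilon>. r (\<lambda>i. of_real (\<epsilon> i) * a i))"
        unfolding rademacher_norm_signs[OF r] using p norm_on_nonneg[OF norm_on[OF r]]
        by (intro mean_powr_mono) (auto simp: finite_signs signs_nonempty)
      also have "\<dots> \<le> T * lp_norm p n a" using T n r by blast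
      finally have "1 / n * mean (signs {1..n}) (\<lambda>\<epsilon>. r (scale_coords \<epsilon> a)) \<le> 1 / n * (T * lp_norm p n a)"
        by (intro mult_left_mono) auto
      also have "\<dots> \<le> e * (MAX i\<in>{1..n}. norm (a i))" by (rule lp_norm_scaled_le[OF p(1) n p(2) e])
      finally show "rademacher_norm 1 n (\<lambda>\<epsilon>. r (\<lambda>i. of_real (1 / real n) * (of_real (\<epsilon> i) * a i)))
          \<le> e * (MAX i\<in>{1..n}. norm (a i))"
        unfolding rademacher_norm_1_scaled_signs[OF r] .
    qed
  qed
qed

lemma subcotype_iff_cotype: "subcotype S \<longleftrightarrow> (\<exists>q>1. cotype_q q S)"
proof
  assume sub: "subcotype S"
  have "\<forall>\<^sub>F n in sequentially. \<forall>r\<in>S n. \<forall>a.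
      1/4 * rademacher_norm 1 n (\<lambda>\<epsilon>. r (\<lambda>i. of_real (\<epsilon> i) * a i)) \<ge> (MIN i\<in>{1..n}. norm (a i))"
    by (rule sub[unfolded subcotype_iff, THEN spec, THEN mp]) simp
  from eventually_happens'[OF _ eventually_conj[OF this eventually_ge_at_top[of 1]]]
  obtain m where m: "1 \<le> m" "\<forall>r\<in>S m. \<forall>a.
      1/4 * rademacher_norm 1 m (\<lambda>\<epsilon>. r (\<lambda>i. of_real (\<epsilon> i) * a i)) \<ge> (MIN i\<in>{1..m}. norm (a i))" by auto
  have quarter: "\<forall>r\<in>S m. \<forall>a. (MIN i\<in>{1..m}. norm (a i)) \<le> 1/4 * mean (signs {1..m}) (\<lambda>\<delta>. r (scale_coords \<delta> a))"
    using m(2) rademacher_norm_1_signs by simp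
  let ?\<rho> = "sqrt (m / (m - 3/4))"
  have "1 < ?\<rho>" using m(1) by simp
  from lower_block_estimate_imp_cotype[OF m(1) this, where 'k = 'k] obtain q K where q: "2 \<le> q" "0 < K"
    and K: "\<And>N r (a :: nat \<Rightarrow> 'k). norm_on N r \<Longrightarrow> monotone_normalized N r \<Longrightarrow>
      lower_block_estimate m ?\<rho> N r \<Longrightarrow> lp_norm q N a \<le> K * r a" by auto
  have "lp_norm q n a \<le> K * rademacher_norm q n (\<lambda>\<epsilon>. r (\<lambda>i. of_real (\<epsilon> i) * a i))"
    if r: "r \<in> S n" for n r a
  proof -
    have "lp_norm q n a \<le> K * rms_norm n r a"
      using r by (intro K norm_on_rms_norm monotone_normalized_rms_norm norm_on monotone
          lower_block_estimate_rms_norm[OF m(1) quarter])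
    also have "rms_norm n r a = mean (signs {1..n}) (\<lambda>\<epsilon>. r (scale_coords \<epsilon> a) powr 2) powr (1 / 2)"
      unfolding rms_norm_def using norm_on_nonneg[OF norm_on[OF r]] by (simp add: powr_half_sqrt mean_nonneg)
    also have "\<dots> \<le> rademacher_norm q n (\<lambda>\<epsilon>. r (\<lambda>i. of_real (\<epsilon> i) * a i))"
      unfolding rademacher_norm_signs[OF r] using q norm_on_nonneg[OF norm_on[OF r]]
      by (intro mean_powr_mono) (auto simp: finite_signs signs_nonempty)
    finally show ?thesis using q(2) by simp
  qed
  then have "cotype_q q S" unfolding cotype_iff using q(2) by blast
  then show "\<exists>q>1. cotype_q q S" using q(1) by (intro exI[of _ q]) auto
next
  assume "\<exists>q>1. cotype_q q S"
  then obtain q C where q: "1 < q" "0 < C" and C: "\<forall>n\<ge>1. \<forall>r\<in>S n. \<forall>a.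
      C * rademacher_norm q n (\<lambda>\<epsilon>. r (\<lambda>i. of_real (\<epsilon> i) * a i)) \<ge> lp_norm q n a"
    unfolding cotype_iff by blast
  have "0 < q" using q by simp
  from Kahane_inequality[OF this, where 'k = 'k] obtain K where K: "0 < K"
    "\<And>n r (a :: nat \<Rightarrow> 'k). norm_on n r \<Longrightarrow>
      mean (signs {1..n}) (\<lambda>\<epsilon>. r (scale_coords \<epsilon> a) powr q) powr (1 / q)
        \<le> K * mean (signs {1..n}) (\<lambda>\<epsilon>. r (scale_coords \<epsilon> a))" by blast
  show "subcotype S"
    unfolding subcotype_iff
  proof (intro allI impI)
    fix e :: real assume "0 < e"
    have "\<forall>\<^sub>F n in sequentially. (C * K) * real n powr (- (1 / q)) \<le> e"
      using q \<open>0 < e\<close> by (intro eventually_le_powr_neg) auto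
    then show "\<forall>\<^sub>F n in sequentially. \<forall>r\<in>S n. \<forall>a.
        e * rademacher_norm 1 n (\<lambda>\<epsilon>. r (\<lambda>i. of_real (\<epsilon> i) * a i)) \<ge> (MIN i\<in>{1..n}. norm (a i))"
      using eventually_ge_at_top[of 1]
    proof (eventually_elim, intro ballI allI)
      fix n r and a :: "nat \<Rightarrow> 'k" assume n: "1 \<le> n" and r: "r \<in> S n" and e: "(C * K) * real n powr (- (1 / q)) \<le> e"
      let ?x = "mean (signs {1..n}) (\<lambda>\<epsilon>. r (scale_coords \<epsilon> a))"
      have "lp_norm q n a \<le> C * rademacher_norm q n (\<lambda>\<epsilon>. r (\<lambda>i. of_real (\<epsilon> i) * a i))"
        using C n r by blast
      also have "\<dots> \<le> C * (K * ?x)"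
        unfolding rademacher_norm_signs[OF r] using K(2)[OF norm_on[OF r]] q(2) by (intro mult_left_mono) auto
      finally have "lp_norm q n a \<le> (C * K) * ?x" by (simp add: mult.assoc)
      moreover have "0 \<le> ?x" by (intro mean_nonneg norm_on_nonneg[OF norm_on[OF r]])
      ultimately show "(MIN i\<in>{1..n}. norm (a i)) \<le> e * rademacher_norm 1 n (\<lambda>\<epsilon>. r (\<lambda>i. of_real (\<epsilon> i) * a i))"
        unfolding rademacher_norm_1_signs[OF r] using q by (intro Min_norm_le_of_lp_norm_le[OF _ n e]) auto
    qed
  qed
qed

end

section \<open>Asymptotic structures of Banach spaces\<close>

text \<open>
  This is the case of a finite-dimensional space.
\<close>
lemma block_closed_norms_empty: "block_closed_norms (\<lambda>_. {})"
  by unfold_locales auto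

lemma block_closed_norms_tree_norms:
  fixes smul :: "'k::real_normed_field \<Rightarrow> 'v::real_normed_vector \<Rightarrow> 'v"
  assumes "normed_space_over smul"
    and "0 \<in> V" "\<And>x y. x \<in> V \<Longrightarrow> y \<in> V \<Longrightarrow> x + y \<in> V" "\<And>c x. x \<in> V \<Longrightarrow> smul c x \<in> V"
    and "\<And>\<phi>. \<phi> \<in> \<Phi> \<Longrightarrow> Vector_Spaces.linear smul (*) \<phi>"
  shows "block_closed_norms (tree_norms smul V \<Phi>)"
proof
  fix r n assume "r \<in> tree_norms smul V \<Phi> n"
  then show "norm_on n r" "monotone_normalized n r" unfolding tree_norms_def by auto
next
  fix r N m a and g :: "nat \<Rightarrow> nat" assume "r \<in> tree_norms smul V \<Phi> N" "mono_on {1..N} g" "g ` {1..N} \<subseteq> {1..m}"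
    "\<And>j. j \<in> {1..m} \<Longrightarrow> r (restr {i. g i = j} a) = 1"
  then show "block_norm r g a \<in> tree_norms smul V \<Phi> m"
    by (intro block_norm_in_tree_norms[OF assms]) auto
qed

lemma block_closed_norms_asymptotic_structure:
  fixes smul :: "'k::real_or_complex \<Rightarrow> 'a::banach \<Rightarrow> 'a"
  assumes "banach_space_over smul"
  shows "block_closed_norms (asymptotic_structure smul)"
proof (cases "finite_dim smul")
  case True
  then show ?thesis unfolding asymptotic_structure_def using block_closed_norms_empty by simp
next
  case False
  interpret banach_space_over smul by fact
  have mult: "vector_space ((*) :: 'k \<Rightarrow> 'k \<Rightarrow> 'k)" by unfold_locales (auto simp: algebra_simps)
  have "block_closed_norms (tree_norms smul UNIV (blinfun_apply ` dual smul))"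
  proof (rule block_closed_norms_tree_norms)
    show "normed_space_over smul" by unfold_locales (rule norm_smul)
    fix \<phi> assume "\<phi> \<in> blinfun_apply ` dual smul"
    then show "Vector_Spaces.linear smul (*) \<phi>"
      using vector_space_axioms mult
      by (auto simp: Vector_Spaces.linear_def module_hom_def module_hom_axioms_def dual_def
          module_iff_vector_space blinfun.add_right)
  qed auto
  then show ?thesis using False unfolding asymptotic_structure_def by simp
qed

lemma block_closed_norms_weak_star_asymptotic_structure:
  fixes smul :: "'k::real_or_complex \<Rightarrow> 'a::banach \<Rightarrow> 'a"
  shows "block_closed_norms (weak_star_asymptotic_structure smul)"
proof (cases "finite_dim smul")
  case True
  then show ?thesis unfolding weak_star_asymptotic_structure_def using block_closed_norms_empty by simp
next
  case False
  have apply_smul: "blinfun_apply (dual_smul c f) x = c * blinfun_apply f x" for c :: 'k and f :: "'a \<Rightarrow>\<^sub>L 'k" and x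
    by (simp add: dual_smul_def)
  have mult: "vector_space ((*) :: 'k \<Rightarrow> 'k \<Rightarrow> 'k)" by unfold_locales (auto simp: algebra_simps)
  have norm_le: "norm (dual_smul c f) \<le> norm c * norm f" for c :: 'k and f :: "'a \<Rightarrow>\<^sub>L 'k"
  proof (rule norm_blinfun_bound)
    show "norm (blinfun_apply (dual_smul c f) x) \<le> norm c * norm f * norm x" for x
      using norm_blinfun[of f x] by (simp add: apply_smul norm_mult mult.assoc mult_left_mono)
  qed simp
  have space: "normed_space_over (dual_smul :: 'k \<Rightarrow> ('a \<Rightarrow>\<^sub>L 'k) \<Rightarrow> _)"
  proof
    fix c :: 'k and f :: "'a \<Rightarrow>\<^sub>L 'k"
    show "norm (dual_smul c f) = norm c * norm f"
    proof (cases "c = 0")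
      case True
      have "dual_smul c f = 0" by (rule blinfun_eqI) (simp add: apply_smul True)
      then show ?thesis using True by simp
    next
      case False
      have "f = dual_smul (inverse c) (dual_smul c f)"
        by (rule blinfun_eqI) (simp add: apply_smul False)
      then have "norm f \<le> norm (inverse c) * norm (dual_smul c f)" by (metis norm_le)
      then have "norm c * norm f \<le> norm (dual_smul c f)" using False by (simp add: norm_divide field_simps)
      then show ?thesis using norm_le[of c f] by simp
    qed
  qed (auto intro!: blinfun_eqI simp: apply_smul blinfun.add_left blinfun.add_right algebra_simps)
  then have vs: "vector_space (dual_smul :: 'k \<Rightarrow> ('a \<Rightarrow>\<^sub>L 'k) \<Rightarrow> _)"
    by (simp add: normed_space_over_def)
  have "block_closed_norms (tree_norms dual_smul (dual smul) (range (\<lambda>x f. blinfun_apply f x)))"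
  proof (rule block_closed_norms_tree_norms[OF space])
    show "0 \<in> dual smul" by (simp add: dual_def)
    show "f + g \<in> dual smul" if "f \<in> dual smul" "g \<in> dual smul" for f g
      using that by (simp add: dual_def blinfun.add_left distrib_left)
    show "dual_smul c f \<in> dual smul" if "f \<in> dual smul" for c f
      using that by (simp add: dual_def apply_smul)
    fix \<phi> :: "('a \<Rightarrow>\<^sub>L 'k) \<Rightarrow> 'k" assume "\<phi> \<in> range (\<lambda>x f. blinfun_apply f x)"
    then show "Vector_Spaces.linear dual_smul (*) \<phi>"
      using vs mult
      by (auto simp: Vector_Spaces.linear_def module_hom_def module_hom_axioms_def
          module_iff_vector_space blinfun.add_left apply_smul)
  qed
  then show ?thesis using False unfolding weak_star_asymptotic_structure_def by simp
qed

theorem theorem1p3: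
  fixes smul :: "'k::real_or_complex \<Rightarrow> 'a::banach \<Rightarrow> 'a"
  assumes "banach_space_over smul"
  shows
    "(basic_subtype (asymptotic_structure smul) \<longleftrightarrow>
        (\<exists>p>1. basic_type p (asymptotic_structure smul))) \<and>
     (basic_subcotype (asymptotic_structure smul) \<longleftrightarrow>
        (\<exists>q>1. basic_cotype q (asymptotic_structure smul))) \<and>
     (subtype (asymptotic_structure smul) \<longleftrightarrow>
        (\<exists>p>1. type_p p (asymptotic_structure smul))) \<and>
     (subcotype (asymptotic_structure smul) \<longleftrightarrow>
        (\<exists>q>1. cotype_q q (asymptotic_structure smul))) \<and>
     (basic_subtype (weak_star_asymptotic_structure smul) \<longleftrightarrow>
        (\<exists>p>1. basic_type p (weak_star_asymptotic_structure smul))) \<and>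
     (basic_subcotype (weak_star_asymptotic_structure smul) \<longleftrightarrow>
        (\<exists>q>1. basic_cotype q (weak_star_asymptotic_structure smul))) \<and>
     (subtype (weak_star_asymptotic_structure smul) \<longleftrightarrow>
        (\<exists>p>1. type_p p (weak_star_asymptotic_structure smul))) \<and>
     (subcotype (weak_star_asymptotic_structure smul) \<longleftrightarrow>
        (\<exists>q>1. cotype_q q (weak_star_asymptotic_structure smul)))"
proof -
  interpret weak: block_closed_norms "asymptotic_structure smul"
    by (rule block_closed_norms_asymptotic_structure[OF assms])
  interpret weak_star: block_closed_norms "weak_star_asymptotic_structure smul"
    by (rule block_closed_norms_weak_star_asymptotic_structure)
  show ?thesis
    by (intro conjI weak.basic_subtype_iff_basic_type weak.basic_subcotype_iff_basic_cotype
        weak.subtype_iff_type weak.subcotype_iff_cotype weak_star.basic_subtype_iff_basic_type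
        weak_star.basic_subcotype_iff_basic_cotype weak_star.subtype_iff_type weak_star.subcotype_iff_cotype)
qed

end
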